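(* Let $p,q\in[1,\infty)$, $r\in(1,\infty)$, $\beta\in(1/r,1)$. Let $$\mathfrak{I}\colon L^{p,q}_{\mathcal{P}_T}(L_2(U,H))\to\mathcal{L}^r_{\mathcal{F}_T\otimes\mathcal{B}_T}(\mathbb{W}),\qquad \mathbb{W}:=C([0,T],H),$$ be a linear and continuous operator such that, for every $Q\in L(H)$ and every $\Psi\in L^{p,q}_{\mathcal{P}_T}(L_2(U,H))$, $$Q(\mathfrak{I}\Psi)=\mathfrak{I}(Q\Psi)\quad\text{in }\mathcal{L}^r_{\mathcal{F}_T\otimes\mathcal{B}_T}(\mathbb{W}),$$ where $Q$ applied to a process means pointwise composition. Let $S$ be a strongly continuous semigroup on $H$ and $M:=\sup_{t\in[0,T]}|S(t)|_{L(H)}$. Then there exists a unique linear and continuous function $$\mathbf{C}\colon\Lambda^{p,q,r}_{\mathcal{P}_T,S,\beta}(L(U,H))\to\mathcal{L}^r_{\mathcal{F}_T\otimes\mathcal{B}_T}(\mathbb{W})$$ such that, for all $\Phi\in\Lambda^{p,q,r}_{\mathcal{P}_T,S,\beta}(L(U,H))$ and for all $t\in[0,T]$, $$\big(\mathfrak{I}(\mathbf{1}_{[0,t)}(\cdot)S(t-\cdot)\Phi)\big)_t=(\mathbf{C}(\Phi))_t\qquad\mathbb{P}\text{-a.e.}$$ The operator norm of $\mathbf{C}$ is bounded by a constant depending only on $\beta$, $r$, $T$, $M$, and on the operator norm of $\mathfrak{I}$.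
   Context: $T>0$, $\mathcal{B}_T$ is the Borel $\sigma$-algebra of $[0,T]$, $m$ is Lebesgue measure, $(\Omega,\mathcal{F},\mathbb{F}=\{\mathcal{F}_t\}_{t\in[0,T]},\mathbb{P})$ is a complete filtered probability space, $\Omega_T:=\Omega\times[0,T]$, and $\mathcal{P}_T$ is the predictable $\sigma$-algebra on $\Omega_T$ associated with $\mathbb{F}$. $H$ and $U$ are separable Hilbert spaces, $L(U,H)$, $L(H)$ are the spaces of bounded linear operators from $U$ to $H$ and from $H$ to $H$, and $L_2(U,H)$ is the space of Hilbert-Schmidt operators from $U$ to $H$. For a Banach space $E$, $L^{p,q}_{\mathcal{P}_T}(E)$ is the Banach space of (classes, modulo $\mathbb{P}\otimes m$-a.e. equality, of) $\mathcal{P}_T/\mathcal{B}_E$-measurable $X\colon\Omega_T\to E$ having separable range outside some $\mathbb{P}\otimes m$-null set of $\mathcal{P}_T$ and with $|X|_{p,q}:=\big(\int_0^T(\mathbb{E}[|X_t|_E^p])^{q/p}dt\big)^{1/q}<\infty$. $\mathbb{W}=C([0,T],H)$ is endowed with the sup norm $|\cdot|_\infty$. $\mathcal{L}^r_{\mathcal{F}_T\otimes\mathcal{B}_T}(\mathbb{W})$ is the Banach space of (equivalence classes, with respect to $\mathbb{P}$-a.e. equality of paths, of) measurable $X\colon(\Omega_T,\mathcal{F}_T\otimes\mathcal{B}_T)\to H$ such that for $\mathbb{P}$-a.e. $\omega$ the path $X(\omega)\colon t\mapsto X_t(\omega)$ lies in $\mathbb{W}$, the $\mathbb{P}$-a.e.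 defined map $(\Omega,\mathcal{F}_T)\to\mathbb{W}$, $\omega\mapsto X(\omega)$, is Borel measurable with separable range, and $|X|_{\mathcal{L}^r_{\mathcal{F}_T\otimes\mathcal{B}_T}(\mathbb{W})}:=(\mathbb{E}[|X|_\infty^r])^{1/r}<\infty$. A function $\Phi\colon\Omega_T\to L(U,H)$ is strongly measurable if $(\Omega_T,\mathcal{P}_T)\to H$, $(\omega,t)\mapsto\Phi_t(\omega)u$, is measurable for all $u\in U$. For $\beta\in[0,1)$, $\Lambda^{p,q,r}_{\mathcal{P}_T,S,\beta}(L(U,H))$ is the vector space of equivalence classes of strongly measurable $\Phi\colon\Omega_T\to L(U,H)$ such that $$|\Phi_{S,\beta}|_{p,q,r}:=\Big(\int_0^T\Big(\int_0^t(t-s)^{-\beta q}\big(\mathbb{E}[|S(t-s)\Phi_s|^p_{L_2(U,H)}]\big)^{q/p}ds\Big)^{r/q}dt\Big)^{1/r}<\infty,$$ with the convention that the Hilbert-Schmidt norm of an operator that is not Hilbert-Schmidt is $+\infty$. Two functions $\Phi_1,\Phi_2$ are identified if this quantity vanishes for $\Phi=\Phi_1-\Phi_2$ (equivalently, if $\Phi_1=\Phi_2$ $\mathbb{P}\otimes m$-a.e.). The space is endowed with the norm $\Phi\mapsto|\Phi_{S,\beta}|_{p,q,r}$, and continuity and the operator norm of $\mathbf{C}$ are with respect to this norm. For $t\in[0,T]$, $\mathbf{1}_{[0,t)}(\cdot)S(t-\cdot)\Phi$ denotes the process $(\omega,s)\mapsto\mathbf{1}_{[0,t)}(s)S(t-s)\Phi_s(\omega)$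 (equal to $0$ for $s\ge t$); for $r>1$, $\beta\in(1/r,1)$ and $\Phi\in\Lambda^{p,q,r}_{\mathcal{P}_T,S,\beta}(L(U,H))$ it belongs to $L^{p,q}_{\mathcal{P}_T}(L_2(U,H))$ for every $t\in[0,T]$, so $\mathfrak{I}$ can be applied to it. *)

theory Defs
  imports "HOL-Probability.Probability"
begin

section \<open>Hilbert--Schmidt operators\<close>

definition orthonormal_basis :: "'a::real_inner set \<Rightarrow> bool" where
  "orthonormal_basis B \<longleftrightarrow>
     pairwise orthogonal B \<and> (\<forall>b\<in>B. norm b = 1) \<and> closure (span B) = UNIV"

lemma orthonormal_extend:
  fixes d :: "'a::real_inner"
  assumes "finite B" "pairwise orthogonal B" "\<forall>b\<in>B. norm b = 1"
  shows "\<exists>B'. B \<subseteq> B' \<and> finite B' \<and> pairwise orthogonal B' \<and> (\<forall>b\<in>B'. norm b = 1) \<and> d \<in> span B'"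
proof -
  define w where "w = d - (\<Sum>b\<in>B. (d \<bullet> b) *\<^sub>R b)"
  have orth: "w \<bullet> c = 0" if c: "c \<in> B" for c
  proof -
    have "(\<Sum>b\<in>B. (d \<bullet> b) * (b \<bullet> c)) = (\<Sum>b\<in>B. if b = c then d \<bullet> c else 0)"
    proof (rule sum.cong)
      fix b assume b: "b \<in> B"
      show "(d \<bullet> b) * (b \<bullet> c) = (if b = c then d \<bullet> c else 0)"
        using b c assms(2,3)
        by (auto simp: pairwise_def orthogonal_def simp flip: power2_norm_eq_inner)
    qed simp
    also have "\<dots> = d \<bullet> c" using c assms(1) by simp
    finally show ?thesis by (simp add: w_def inner_diff_left inner_sum_left)
  qed
  have d: "d = w + (\<Sum>b\<in>B. (d \<bullet> b) *\<^sub>R b)" by (simp add: w_def)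
  have sp: "(\<Sum>b\<in>B. (d \<bullet> b) *\<^sub>R b) \<in> span B"
    by (intro span_sum span_scale span_base)
  show ?thesis
  proof (cases "w = 0")
    case True
    then show ?thesis using assms d sp by (intro exI[of _ B]) auto
  next
    case False
    let ?u = "w /\<^sub>R norm w"
    have "norm w *\<^sub>R ?u \<in> span (insert ?u B)"
      by (intro span_scale span_base) simp
    then have "w \<in> span (insert ?u B)" using False by simp
    moreover have "(\<Sum>b\<in>B. (d \<bullet> b) *\<^sub>R b) \<in> span (insert ?u B)"
      using sp span_mono[of B "insert ?u B"] by blast
    ultimately have "d \<in> span (insert ?u B)" using d span_add by metis
    moreover have "pairwise orthogonal (insert ?u B)"
      using assms(2) orth by (auto simp: pairwise_insert orthogonal_def inner_commute)
    ultimately show ?thesis using assms(1,3) False by (intro exI[of _ "insert ?u B"]) auto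
  qed
qed

lemma orthonormal_basis_exists:
  "\<exists>B::'a::{real_inner,second_countable_topology} set. orthonormal_basis B"
proof -
  obtain D :: "'a set" where D: "countable D" "\<And>X. open X \<Longrightarrow> X \<noteq> {} \<Longrightarrow> \<exists>d\<in>D. d \<in> X"
    using countable_dense_exists by blast
  have "D \<noteq> {}" using D(2)[of UNIV] by auto
  define d where "d = from_nat_into D"
  have rd: "range d = D" using D(1) \<open>D \<noteq> {}\<close> by (simp add: d_def)
  define ok where "ok B \<longleftrightarrow> finite B \<and> pairwise orthogonal B \<and> (\<forall>b\<in>B. norm b = 1)" for B :: "'a set"
  have "\<exists>f. \<forall>n. ok (f n) \<and> (f n \<subseteq> f (Suc n) \<and> d n \<in> span (f (Suc n)))"
  proof (rule dependent_nat_choice)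
    show "\<exists>B. ok B" by (intro exI[of _ "{}"]) (simp add: ok_def)
    show "\<exists>B'. ok B' \<and> (B \<subseteq> B' \<and> d n \<in> span B')" if "ok B" for B n
      using orthonormal_extend[of B "d n"] that by (fastforce simp: ok_def)
  qed
  then obtain f where f: "\<And>n. ok (f n)" "\<And>n. f n \<subseteq> f (Suc n)" "\<And>n. d n \<in> span (f (Suc n))"
    by blast
  have mono: "f m \<subseteq> f n" if "m \<le> n" for m n
    using lift_Suc_mono_le[of f, OF f(2) that] .
  define B where "B = (\<Union>n. f n)"
  have "pairwise orthogonal B"
  proof (rule pairwiseI)
    fix x y assume "x \<in> B" "y \<in> B" "x \<noteq> y"
    then obtain m n where "x \<in> f m" "y \<in> f n" by (auto simp: B_def)
    then have "x \<in> f (max m n)" "y \<in> f (max m n)"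
      using mono[of m "max m n"] mono[of n "max m n"] by auto
    then show "orthogonal x y" using f(1)[of "max m n"] \<open>x \<noteq> y\<close> by (auto simp: ok_def pairwise_def)
  qed
  moreover have "\<forall>b\<in>B. norm b = 1" using f(1) by (auto simp: B_def ok_def)
  moreover have "closure (span B) = UNIV"
  proof -
    have "D \<subseteq> span B"
    proof
      fix x assume "x \<in> D"
      then obtain n where "x = d n" using rd by blast
      then show "x \<in> span B" using f(3)[of n] span_mono[of "f (Suc n)" B] by (auto simp: B_def)
    qed
    moreover have "closure D = UNIV"
    proof (rule ccontr)
      assume "closure D \<noteq> UNIV"
      then have "open (- closure D)" "- closure D \<noteq> {}" by auto
      then obtain x where "x \<in> D" "x \<in> - closure D" using D(2) by blast
      then show False using closure_subset by blast
    qed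
    ultimately show ?thesis using closure_mono by blast
  qed
  ultimately show ?thesis unfolding orthonormal_basis_def by blast
qed

text \<open>The Hilbert--Schmidt norm does not depend on the orthonormal basis of the domain, so a
  single basis is chosen once and for all.\<close>

definition hs_basis :: "'a::{real_inner,second_countable_topology} set" where
  "hs_basis = (SOME B. orthonormal_basis B)"

lemma orthonormal_basis_hs_basis: "orthonormal_basis hs_basis"
  unfolding hs_basis_def using orthonormal_basis_exists by (rule someI_ex)

definition hilbert_schmidt ::
  "('u::{real_inner,second_countable_topology} \<Rightarrow>\<^sub>L 'h::real_inner) \<Rightarrow> bool" where
  "hilbert_schmidt A \<longleftrightarrow> (\<lambda>e. (norm (A e))\<^sup>2) summable_on hs_basis"

definition hs_norm ::
  "('u::{real_inner,second_countable_topology} \<Rightarrow>\<^sub>L 'h::real_inner) \<Rightarrow> real" where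
  "hs_norm A = sqrt (\<Sum>\<^sub>\<infinity>e\<in>hs_basis. (norm (A e))\<^sup>2)"

definition hs_enorm ::
  "('u::{real_inner,second_countable_topology} \<Rightarrow>\<^sub>L 'h::real_inner) \<Rightarrow> ennreal" where
  "hs_enorm A = (if hilbert_schmidt A then ennreal (hs_norm A) else \<infinity>)"

lemma hs_finite_le:
  fixes A :: "'u::{real_inner,second_countable_topology} \<Rightarrow>\<^sub>L 'h::real_inner"
  assumes "hilbert_schmidt A" "finite G" "G \<subseteq> hs_basis"
  shows "L2_set (\<lambda>e. norm (A e)) G \<le> hs_norm A"
  unfolding L2_set_def hs_norm_def
  using assms by (intro real_sqrt_le_mono finite_sum_le_infsum) (auto simp: hilbert_schmidt_def)

lemma hs_boundI:
  fixes A :: "'u::{real_inner,second_countable_topology} \<Rightarrow>\<^sub>L 'h::real_inner"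
  assumes "\<And>G. finite G \<Longrightarrow> G \<subseteq> hs_basis \<Longrightarrow> L2_set (\<lambda>e. norm (A e)) G \<le> c"
  shows "hilbert_schmidt A" "hs_norm A \<le> c"
proof -
  have c: "0 \<le> c" using assms[of "{}"] by simp
  have le: "(\<Sum>e\<in>G. (norm (A e))\<^sup>2) \<le> c\<^sup>2" if "finite G" "G \<subseteq> hs_basis" for G
    using assms[OF that] by (simp add: L2_set_def sqrt_le_D)
  show hs: "hilbert_schmidt A"
    unfolding hilbert_schmidt_def
    by (rule nonneg_bdd_above_summable_on) (auto intro!: bdd_aboveI2[of _ _ "c\<^sup>2"] le)
  have "(\<Sum>\<^sub>\<infinity>e\<in>hs_basis. (norm (A e))\<^sup>2) \<le> c\<^sup>2"
    using hs le by (intro infsum_le_finite_sums) (auto simp: hilbert_schmidt_def)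
  then show "hs_norm A \<le> c" using c by (simp add: hs_norm_def real_le_lsqrt real_sqrt_le_iff)
qed

lemma hs_add:
  fixes A B :: "'u::{real_inner,second_countable_topology} \<Rightarrow>\<^sub>L 'h::real_inner"
  assumes "hilbert_schmidt A" "hilbert_schmidt B"
  shows "hilbert_schmidt (A + B)" "hs_norm (A + B) \<le> hs_norm A + hs_norm B"
proof -
  have "L2_set (\<lambda>e. norm ((A + B) e)) G \<le> hs_norm A + hs_norm B"
    if G: "finite G" "G \<subseteq> hs_basis" for G
  proof -
    have "L2_set (\<lambda>e. norm ((A + B) e)) G \<le> L2_set (\<lambda>e. norm (A e) + norm (B e)) G"
      by (rule L2_set_mono) (auto simp: blinfun.add_left norm_triangle_ineq)
    also have "\<dots> \<le> L2_set (\<lambda>e. norm (A e)) G + L2_set (\<lambda>e. norm (B e)) G"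
      by (rule L2_set_triangle_ineq)
    also have "\<dots> \<le> hs_norm A + hs_norm B"
      using hs_finite_le[OF assms(1) G] hs_finite_le[OF assms(2) G] by simp
    finally show ?thesis .
  qed
  then show "hilbert_schmidt (A + B)" "hs_norm (A + B) \<le> hs_norm A + hs_norm B"
    by (fact hs_boundI)+
qed

lemma hs_scaleR:
  fixes A :: "'u::{real_inner,second_countable_topology} \<Rightarrow>\<^sub>L 'h::real_inner"
  assumes "hilbert_schmidt A"
  shows "hilbert_schmidt (c *\<^sub>R A)" "hs_norm (c *\<^sub>R A) = \<bar>c\<bar> * hs_norm A"
  using assms
  by (simp_all add: hilbert_schmidt_def hs_norm_def blinfun.scaleR_left power_mult_distrib
      summable_on_cmult_right infsum_cmult_right' real_sqrt_mult)

lemma hs_zero: "hilbert_schmidt 0"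
  by (simp add: hilbert_schmidt_def)

lemma hs_compose_left:
  fixes A :: "'u::{real_inner,second_countable_topology} \<Rightarrow>\<^sub>L 'h::real_inner"
    and Q :: "'h \<Rightarrow>\<^sub>L 'k::real_inner"
  assumes "hilbert_schmidt A"
  shows "hilbert_schmidt (Q o\<^sub>L A)"
proof -
  have "L2_set (\<lambda>e. norm ((Q o\<^sub>L A) e)) G \<le> norm Q * hs_norm A"
    if G: "finite G" "G \<subseteq> hs_basis" for G
  proof -
    have "L2_set (\<lambda>e. norm ((Q o\<^sub>L A) e)) G \<le> L2_set (\<lambda>e. norm Q * norm (A e)) G"
      by (rule L2_set_mono) (auto simp: norm_blinfun)
    also have "\<dots> = norm Q * L2_set (\<lambda>e. norm (A e)) G"
      by (simp add: L2_set_right_distrib)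
    also have "\<dots> \<le> norm Q * hs_norm A"
      using hs_finite_le[OF assms G] by (simp add: mult_left_mono)
    finally show ?thesis .
  qed
  then show ?thesis by (rule hs_boundI)
qed

lemma hs_norm_eq_0_iff:
  fixes A :: "'u::{real_inner,second_countable_topology} \<Rightarrow>\<^sub>L 'h::real_inner"
  assumes "hilbert_schmidt A"
  shows "hs_norm A = 0 \<longleftrightarrow> A = 0"
proof
  assume 0: "hs_norm A = 0"
  have z: "A e = 0" if "e \<in> hs_basis" for e
    using hs_finite_le[OF assms, of "{e}"] that 0 by simp
  have "A x = 0" for x
  proof -
    have "span hs_basis \<subseteq> {x. A x = 0}"
      by (rule span_minimal) (auto simp: z subspace_def blinfun.add_right blinfun.scaleR_right)
    moreover have "closed {x. A x = 0}"
      by (intro closed_Collect_eq continuous_intros)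
    ultimately have "closure (span hs_basis) \<subseteq> {x. A x = 0}" by (rule closure_minimal)
    then show ?thesis using orthonormal_basis_hs_basis by (auto simp: orthonormal_basis_def)
  qed
  then show "A = 0" by (intro blinfun_eqI) simp
qed (simp add: hs_norm_def)

text \<open>The space \<open>L\<^sub>2(U,H)\<close> with the Hilbert--Schmidt norm; its \<open>borel\<close> is
  the Borel \<open>\<sigma>\<close>-algebra of that norm, not of the operator norm.\<close>

typedef (overloaded) ('u, 'h) hs_op =
  "{A :: 'u::{real_inner,second_countable_topology} \<Rightarrow>\<^sub>L 'h::real_inner. hilbert_schmidt A}"
  morphisms blinfun_of_hs Hs_op
  using hs_zero by blast

setup_lifting type_definition_hs_op

instantiation hs_op :: ("{real_inner,second_countable_topology}", real_inner) real_normed_vector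
begin

lift_definition zero_hs_op :: "('a, 'b) hs_op" is 0 by (rule hs_zero)
lift_definition plus_hs_op :: "('a, 'b) hs_op \<Rightarrow> ('a, 'b) hs_op \<Rightarrow> ('a, 'b) hs_op" is "(+)"
  by (rule hs_add)
lift_definition scaleR_hs_op :: "real \<Rightarrow> ('a, 'b) hs_op \<Rightarrow> ('a, 'b) hs_op" is "(*\<^sub>R)"
  by (rule hs_scaleR)
lift_definition uminus_hs_op :: "('a, 'b) hs_op \<Rightarrow> ('a, 'b) hs_op" is uminus
  using hs_scaleR(1)[of _ "-1"] by simp
lift_definition minus_hs_op :: "('a, 'b) hs_op \<Rightarrow> ('a, 'b) hs_op \<Rightarrow> ('a, 'b) hs_op" is "(-)"
proof -
  fix A B :: "'a \<Rightarrow>\<^sub>L 'b" assume "hilbert_schmidt A" "hilbert_schmidt B"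
  then show "hilbert_schmidt (A - B)" using hs_add(1)[of A "- B"] hs_scaleR(1)[of B "-1"] by simp
qed
lift_definition norm_hs_op :: "('a, 'b) hs_op \<Rightarrow> real" is hs_norm .

definition sgn_hs_op :: "('a, 'b) hs_op \<Rightarrow> ('a, 'b) hs_op" where
  "sgn_hs_op A = inverse (norm A) *\<^sub>R A"
definition dist_hs_op :: "('a, 'b) hs_op \<Rightarrow> ('a, 'b) hs_op \<Rightarrow> real" where
  "dist_hs_op A B = norm (A - B)"
definition uniformity_hs_op :: "(('a, 'b) hs_op \<times> ('a, 'b) hs_op) filter" where
  "uniformity_hs_op = (INF e\<in>{0<..}. principal {(x, y). dist x y < e})"
definition open_hs_op :: "('a, 'b) hs_op set \<Rightarrow> bool" where
  "open_hs_op U = (\<forall>x\<in>U. eventually (\<lambda>(x', y). x' = x \<longrightarrow> y \<in> U) uniformity)"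

instance
proof
  fix A B C :: "('a, 'b) hs_op" and a b :: real and U :: "('a, 'b) hs_op set"
  show "A + B + C = A + (B + C)" by transfer (simp add: add.assoc)
  show "A + B = B + A" by transfer (simp add: add.commute)
  show "0 + A = A" by transfer simp
  show "- A + A = 0" by transfer simp
  show "A - B = A + - B" by transfer simp
  show "a *\<^sub>R (A + B) = a *\<^sub>R A + a *\<^sub>R B" by transfer (simp add: scaleR_add_right)
  show "(a + b) *\<^sub>R A = a *\<^sub>R A + b *\<^sub>R A" by transfer (simp add: scaleR_add_left)
  show "a *\<^sub>R b *\<^sub>R A = (a * b) *\<^sub>R A" by transfer simp
  show "1 *\<^sub>R A = A" by transfer simp
  show "dist A B = norm (A - B)" by (rule dist_hs_op_def)
  show "sgn A = inverse (norm A) *\<^sub>R A" by (rule sgn_hs_op_def)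
  show "(uniformity :: (('a, 'b) hs_op \<times> ('a, 'b) hs_op) filter) =
      (INF e\<in>{0<..}. principal {(x, y). dist x y < e})"
    by (rule uniformity_hs_op_def)
  show "open U = (\<forall>x\<in>U. eventually (\<lambda>(x', y). x' = x \<longrightarrow> y \<in> U) uniformity)"
    by (rule open_hs_op_def)
  show "norm A = 0 \<longleftrightarrow> A = 0" by transfer (rule hs_norm_eq_0_iff)
  show "norm (A + B) \<le> norm A + norm B" by transfer (rule hs_add)
  show "norm (a *\<^sub>R A) = \<bar>a\<bar> * norm A" by transfer (rule hs_scaleR)
qed

end

lift_definition hs_compose ::
  "('h::real_inner \<Rightarrow>\<^sub>L 'k::real_inner) \<Rightarrow> ('u::{real_inner,second_countable_topology}, 'h) hs_op
    \<Rightarrow> ('u, 'k) hs_op" is "(o\<^sub>L)"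
  by (rule hs_compose_left)

definition to_hs ::
  "('u::{real_inner,second_countable_topology} \<Rightarrow>\<^sub>L 'h::real_inner) \<Rightarrow> ('u, 'h) hs_op" where
  "to_hs A = (if hilbert_schmidt A then Hs_op A else 0)"

section \<open>Continuous linear operators between spaces of equivalence classes\<close>

text \<open>
  A space of equivalence classes of functions is given by its representatives, the relation
  identifying them, and the norm of a class in terms of a representative.  An operator between two
  such spaces is given by a map on representatives that respects the relations, and is linear up to
  the relation on the target.
\<close>

record ('x, 'e) class_space =
  reps :: "('x \<Rightarrow> 'e) set"
  same :: "('x \<Rightarrow> 'e) \<Rightarrow> ('x \<Rightarrow> 'e) \<Rightarrow> bool"
  class_norm :: "('x \<Rightarrow> 'e) \<Rightarrow> real"

definition continuous_linear_op ::
  "('x, 'e::real_vector) class_space \<Rightarrow> ('y, 'd::real_vector) class_space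
    \<Rightarrow> (('x \<Rightarrow> 'e) \<Rightarrow> ('y \<Rightarrow> 'd)) \<Rightarrow> bool" where
  "continuous_linear_op V W A \<longleftrightarrow>
     (\<forall>f\<in>reps V. A f \<in> reps W) \<and>
     (\<forall>f\<in>reps V. \<forall>g\<in>reps V. same V f g \<longrightarrow> same W (A f) (A g)) \<and>
     (\<forall>f\<in>reps V. \<forall>g\<in>reps V. same W (A (\<lambda>x. f x + g x)) (\<lambda>y. A f y + A g y)) \<and>
     (\<forall>c. \<forall>f\<in>reps V. same W (A (\<lambda>x. c *\<^sub>R f x)) (\<lambda>y. c *\<^sub>R A f y)) \<and>
     (\<exists>K. \<forall>f\<in>reps V. class_norm W (A f) \<le> class_norm V f * K)"

text \<open>As for \<^const>\<open>onorm\<close>, classes of norm 0 contribute the value 0.\<close>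

definition op_norm ::
  "('x, 'e) class_space \<Rightarrow> ('y, 'd) class_space \<Rightarrow> (('x \<Rightarrow> 'e) \<Rightarrow> ('y \<Rightarrow> 'd)) \<Rightarrow> real" where
  "op_norm V W A = (SUP f\<in>reps V. class_norm W (A f) / class_norm V f)"

section \<open>Filtrations and spaces of processes\<close>

text \<open>\<^term>\<open>F t\<close> is relevant for \<^prop>\<open>t \<in> {0..T}\<close> only.  Completeness: \<^term>\<open>P\<close> is complete and
  every \<^term>\<open>F t\<close> contains the null sets; right-continuity is not part of the assumptions.\<close>

definition complete_filtered_prob_space ::
  "'w measure \<Rightarrow> (real \<Rightarrow> 'w measure) \<Rightarrow> real \<Rightarrow> bool" where
  "complete_filtered_prob_space P F T \<longleftrightarrow>
     prob_space P \<and> complete_measure P \<and>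
     (\<forall>t\<in>{0..T}. subalgebra P (F t) \<and> null_sets P \<subseteq> sets (F t)) \<and>
     (\<forall>s t. 0 \<le> s \<longrightarrow> s \<le> t \<longrightarrow> t \<le> T \<longrightarrow> sets (F s) \<subseteq> sets (F t))"

definition predictable_algebra :: "(real \<Rightarrow> 'w measure) \<Rightarrow> real \<Rightarrow> ('w \<times> real) measure" where
  "predictable_algebra F T = sigma (space (F 0) \<times> {0..T})
     ({A \<times> {0} |A. A \<in> sets (F 0)} \<union>
      {A \<times> {s<..t} |A s t. 0 \<le> s \<and> s \<le> t \<and> t \<le> T \<and> A \<in> sets (F s)})"

definition prod_lebesgue :: "'w measure \<Rightarrow> real \<Rightarrow> ('w \<times> real) measure" where
  "prod_lebesgue P T = P \<Otimes>\<^sub>M restrict_space lborel {0..T}"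

text \<open>Meant for exponents \<^prop>\<open>a > 0\<close>.\<close>

definition epowr :: "ennreal \<Rightarrow> real \<Rightarrow> ennreal" where
  "epowr x a = (if x = \<infinity> then \<infinity> else ennreal (enn2real x powr a))"

definition Lpq_norm ::
  "'w measure \<Rightarrow> real \<Rightarrow> real \<Rightarrow> real \<Rightarrow> ('w \<times> real \<Rightarrow> 'e::real_normed_vector) \<Rightarrow> ennreal" where
  "Lpq_norm P T p q X =
     epowr (\<integral>\<^sup>+t. epowr (\<integral>\<^sup>+\<omega>. ennreal (norm (X (\<omega>, t)) powr p) \<partial>P) (q / p)
              \<partial>restrict_space lborel {0..T}) (1 / q)"

definition Lpq_space ::
  "'w measure \<Rightarrow> (real \<Rightarrow> 'w measure) \<Rightarrow> real \<Rightarrow> real \<Rightarrow> real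
    \<Rightarrow> ('w \<times> real, 'e::real_normed_vector) class_space" where
  "Lpq_space P F T p q =
     \<lparr> reps = {X. X \<in> borel_measurable (predictable_algebra F T) \<and>
          (\<exists>N\<in>sets (predictable_algebra F T). emeasure (prod_lebesgue P T) N = 0 \<and>
             separable_space (top_of_set (X ` (space (predictable_algebra F T) - N)))) \<and>
          Lpq_norm P T p q X < \<infinity>},
       same = (\<lambda>X Y. AE x in prod_lebesgue P T. X x = Y x),
       class_norm = (\<lambda>X. enn2real (Lpq_norm P T p q X)) \<rparr>"

text \<open>\<open>C([0,T],H)\<close> with the supremum distance; its elements are functions that are extensional
  on \<^term>\<open>{0..T}\<close>.\<close>

definition path_space :: "real \<Rightarrow> (real \<Rightarrow> 'h::real_normed_vector) metric" where
  "path_space T = cfunspace (top_of_set {0..T}) euclidean_metric"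

definition path_borel :: "real \<Rightarrow> (real \<Rightarrow> 'h::real_normed_vector) measure" where
  "path_borel T = sigma (mspace (path_space T)) {U. openin (mtopology_of (path_space T)) U}"

definition path :: "real \<Rightarrow> ('w \<times> real \<Rightarrow> 'h) \<Rightarrow> 'w \<Rightarrow> real \<Rightarrow> 'h" where
  "path T X \<omega> = restrict (\<lambda>t. X (\<omega>, t)) {0..T}"

definition path_norm :: "'w measure \<Rightarrow> real \<Rightarrow> real \<Rightarrow> ('w \<times> real \<Rightarrow> 'h::real_normed_vector) \<Rightarrow> ennreal"
  where
  "path_norm P T r X =
     epowr (\<integral>\<^sup>+\<omega>. epowr (SUP t\<in>{0..T}. ennreal (norm (X (\<omega>, t)))) r \<partial>P) (1 / r)"

definition Lr_path_space ::
  "'w measure \<Rightarrow> (real \<Rightarrow> 'w measure) \<Rightarrow> real \<Rightarrow> real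
    \<Rightarrow> ('w \<times> real, 'h::real_normed_vector) class_space" where
  "Lr_path_space P F T r =
     \<lparr> reps = {X. X \<in> borel_measurable (F T \<Otimes>\<^sub>M restrict_space borel {0..T}) \<and>
          (\<exists>N\<in>null_sets P.
             (\<forall>\<omega>\<in>space P - N. path T X \<omega> \<in> mspace (path_space T)) \<and>
             path T X \<in> measurable (restrict_space (F T) (space P - N)) (path_borel T) \<and>
             separable_space (subtopology (mtopology_of (path_space T))
               (path T X ` (space P - N)))) \<and>
          path_norm P T r X < \<infinity>},
       same = (\<lambda>X Y. AE \<omega> in P. \<forall>t\<in>{0..T}. X (\<omega>, t) = Y (\<omega>, t)),
       class_norm = (\<lambda>X. enn2real (path_norm P T r X)) \<rparr>"

section \<open>Semigroups and stochastic convolution\<close>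

definition C0_semigroup :: "(real \<Rightarrow> 'h::real_normed_vector \<Rightarrow>\<^sub>L 'h) \<Rightarrow> bool" where
  "C0_semigroup S \<longleftrightarrow>
     S 0 = id_blinfun \<and>
     (\<forall>s\<ge>0. \<forall>t\<ge>0. S (s + t) = S s o\<^sub>L S t) \<and>
     (\<forall>x. continuous_on {0..} (\<lambda>t. S t x))"

definition Lambda_norm ::
  "'w measure \<Rightarrow> real \<Rightarrow> real \<Rightarrow> real \<Rightarrow> real \<Rightarrow> (real \<Rightarrow> 'h \<Rightarrow>\<^sub>L 'h) \<Rightarrow> real
    \<Rightarrow> ('w \<times> real \<Rightarrow> 'u::{real_inner,second_countable_topology} \<Rightarrow>\<^sub>L 'h::real_inner) \<Rightarrow> ennreal"
  where
  "Lambda_norm P T p q r S \<beta> \<Phi> =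
     epowr (\<integral>\<^sup>+t. epowr (\<integral>\<^sup>+s. ennreal ((t - s) powr (- \<beta> * q)) *
                epowr (\<integral>\<^sup>+\<omega>. epowr (hs_enorm (S (t - s) o\<^sub>L \<Phi> (\<omega>, s))) p \<partial>P) (q / p)
              \<partial>restrict_space lborel {0..t}) (r / q)
            \<partial>restrict_space lborel {0..T}) (1 / r)"

definition Lambda_space ::
  "'w measure \<Rightarrow> (real \<Rightarrow> 'w measure) \<Rightarrow> real \<Rightarrow> real \<Rightarrow> real \<Rightarrow> real \<Rightarrow> (real \<Rightarrow> 'h \<Rightarrow>\<^sub>L 'h) \<Rightarrow> real
    \<Rightarrow> ('w \<times> real, 'u::{real_inner,second_countable_topology} \<Rightarrow>\<^sub>L 'h::real_inner) class_space"
  where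
  "Lambda_space P F T p q r S \<beta> =
     \<lparr> reps = {\<Phi>. (\<forall>u. (\<lambda>x. blinfun_apply (\<Phi> x) u) \<in> borel_measurable (predictable_algebra F T)) \<and>
          Lambda_norm P T p q r S \<beta> \<Phi> < \<infinity>},
       same = (\<lambda>\<Phi>\<^sub>1 \<Phi>\<^sub>2. Lambda_norm P T p q r S \<beta> (\<lambda>x. \<Phi>\<^sub>1 x - \<Phi>\<^sub>2 x) = 0),
       class_norm = (\<lambda>\<Phi>. enn2real (Lambda_norm P T p q r S \<beta> \<Phi>)) \<rparr>"

text \<open>The process \<open>1\<^bsub>[0,t)\<^esub>(\<cdot>) S(t - \<cdot>) \<Phi>\<close>.  For \<open>\<Phi>\<close> in the space above and \<open>\<beta> > 1/r\<close>, the operator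
  \<open>S(t - s) \<Phi>\<^sub>s(\<omega>)\<close> is Hilbert--Schmidt for almost all \<open>(\<omega>,s)\<close> with \<open>s < t\<close>; the
  representative is 0 on the exceptional null set.\<close>

definition convolution_integrand ::
  "(real \<Rightarrow> 'h \<Rightarrow>\<^sub>L 'h) \<Rightarrow> real
    \<Rightarrow> ('w \<times> real \<Rightarrow> 'u::{real_inner,second_countable_topology} \<Rightarrow>\<^sub>L 'h::real_inner)
    \<Rightarrow> 'w \<times> real \<Rightarrow> ('u, 'h) hs_op" where
  "convolution_integrand S t \<Phi> =
     (\<lambda>(\<omega>, s). if s \<in> {0..<t} then to_hs (S (t - s) o\<^sub>L \<Phi> (\<omega>, s)) else 0)"

text \<open>
  A constant depending only on \<open>\<beta>\<close>, \<open>r\<close>, \<open>T\<close>, \<open>M\<close> and the operator norm \<open>N\<close>.  It is given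
  explicitly because an existentially quantified constant could still depend on the types of
  \<open>\<Omega>\<close>, \<open>U\<close> and \<open>H\<close> (e.g. on the dimension of \<open>H\<close>), over which one cannot quantify inside a formula.
  The value is the one of the factorization method: \<open>sin (\<pi> \<beta>) / \<pi>\<close> is the reciprocal of the
  integral of \<open>(t - s)\<^bsup>\<beta> - 1\<^esup> (s - u)\<^bsup>- \<beta>\<^esup>\<close> over \<open>s\<close> from \<open>u\<close> to \<open>t\<close>, and the last two factors are
  the norm of \<open>s\<^bsup>\<beta> - 1\<^esup>\<close> in \<open>L\<^bsup>r/(r - 1)\<^esup>(0,T)\<close>.
\<close>

definition convolution_const :: "real \<Rightarrow> real \<Rightarrow> real \<Rightarrow> real \<Rightarrow> real \<Rightarrow> real" where
  "convolution_const \<beta> r T M N =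
     sin (pi * \<beta>) / pi * M * N *
       (T powr (\<beta> - 1 / r) * ((r - 1) / (\<beta> * r - 1)) powr ((r - 1) / r))"

end

theory Submission
  imports Defs
begin

text \<open>
  The factorization method.  By the Beta integral, \<open>1\<^bsub>[0,t)\<^esub>(u) S(t - u) \<Phi>\<^sub>u\<close> is \<open>sin (\<pi> \<beta>) / \<pi>\<close> times the
  integral of \<open>(t - s)\<^bsup>\<beta> - 1\<^esup> S(t - s) G\<^sub>s(u)\<close> over \<open>s \<in> [0,t)\<close>, where
  \<open>G\<^sub>s(u) = 1\<^bsub>[0,s)\<^esub>(u) (s - u)\<^bsup>- \<beta>\<^esup> S(s - u) \<Phi>\<^sub>u\<close>, and the norm of \<open>\<Phi>\<close> is the \<open>L\<^sup>r\<close>-norm of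
  \<open>s \<mapsto> |G\<^sub>s|\<^bsub>p,q\<^esub>\<close>.  Formally \<open>C(\<Phi>)\<^sub>t\<close> is therefore \<open>sin (\<pi> \<beta>) / \<pi>\<close> times the integral of
  \<open>(t - s)\<^bsup>\<beta> - 1\<^esup> S(t - s) (I G\<^sub>s)\<^sub>t\<close>.  The path of \<open>I G\<^sub>s\<close> is evaluated at \<open>t\<close> and not at \<open>s\<close>, because
  nothing is known about its behaviour after time \<open>s\<close>.  If \<open>G\<close> is a step function in \<open>s\<close>, this is a
  finite sum of bounded operators applied to paths of \<open>I\<close>: it has continuous paths, it agrees with
  the integral because \<open>I\<close> commutes with bounded operators, and Hoelder's inequality in \<open>s\<close> bounds its
  supremum norm.  Step functions are dense, so the general case follows by completeness.
\<close>

section \<open>Lebesgue norms of extended nonnegative functions\<close>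

text \<open>\<open>I\<close> acts on classes, one s at a time, and for a general family
  \<open>G\<close> gives no jointly measurable choice of s \<mapsto> \<open>I (G s)\<close>; an
  integral of its paths over s has no meaning yet. Rectangles avoid this: for
  \<open>G s = indicator {..a} s *\<^sub>R \<Psi>\<close> the integral over s collapses to one
  bounded operator \<open>Rop a t\<close> on H, defined pointwise because the semigroup is only
  strongly continuous. The interchange of \<open>I\<close> with the integral over s thereby becomes
  an instance of the commutation hypothesis. The rest is estimates. Integrals with values in L^{p,q}
  are replaced by integrals of functions with values in [0,infinity], with Minkowski's integral
  inequality in place of the norm inequality for vector-valued integrals; such values also
  accommodate operators that are not Hilbert--Schmidt. The exponent r occurs both in the path norm
  and in the norm of \<Phi>, so Tonelli exchanges \<omega> and s. Linearity and uniqueness come from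
  the fact that continuous processes which agree a.e. at each time are indistinguishable.\<close>

lemma epowr_top [simp]: "epowr \<top> a = \<top>"
  by (simp add: epowr_def)

lemma epowr_0 [simp]: "epowr 0 a = 0"
  by (simp add: epowr_def)

lemma epowr_ennreal: "0 \<le> x \<Longrightarrow> epowr (ennreal x) a = ennreal (x powr a)"
  by (simp add: epowr_def)

lemma epowr_one [simp]: "epowr x 1 = x"
  by (cases x) (simp_all add: epowr_ennreal)

lemma epowr_1_left [simp]: "epowr 1 a = 1"
  using epowr_ennreal[of 1 a] by simp

lemma epowr_mono: "x \<le> y \<Longrightarrow> 0 \<le> a \<Longrightarrow> epowr x a \<le> epowr y a"
  by (cases x; cases y) (auto simp: epowr_ennreal top_unique powr_mono2 ennreal_leI)

lemma epowr_epowr: "epowr (epowr x a) b = epowr x (a * b)"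
  by (cases x) (simp_all add: epowr_ennreal powr_powr)

lemma epowr_inverse_cancel:
  assumes "a \<noteq> 0"
  shows "epowr (epowr x a) (1 / a) = x" "epowr (epowr x (1 / a)) a = x"
  using assms by (simp_all add: epowr_epowr)

lemma epowr_eq_0_iff [simp]: "epowr x a = 0 \<longleftrightarrow> x = 0"
  by (cases x) (auto simp: epowr_ennreal ennreal_eq_0_iff powr_def)

lemma epowr_eq_top_iff [simp]: "epowr x a = \<top> \<longleftrightarrow> x = \<top>"
  by (cases x) (auto simp: epowr_ennreal)

lemma epowr_less_top_iff [simp]: "epowr x a < \<top> \<longleftrightarrow> x < \<top>"
  by (simp flip: less_top)

lemma epowr_mult: "epowr (x * y) a = epowr x a * epowr y a"
proof (cases x)
  case (real r)
  show ?thesis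
  proof (cases y)
    case (real s)
    then show ?thesis using \<open>x = ennreal r\<close> \<open>0 \<le> r\<close>
      by (simp add: epowr_ennreal powr_mult flip: ennreal_mult)
  next
    case top
    show ?thesis by (cases "x = 0") (simp_all add: top ennreal_mult_top)
  qed
next
  case top
  then show ?thesis by (cases "y = 0") (simp_all add: ennreal_top_mult)
qed

lemma epowr_add: "epowr x (a + b) = epowr x a * epowr x b"
  by (cases x) (simp_all add: epowr_ennreal powr_add flip: ennreal_mult)

lemma epowr_le_iff: "0 < a \<Longrightarrow> epowr x a \<le> epowr y a \<longleftrightarrow> x \<le> y"
  using epowr_mono[of x y a] epowr_mono[of "epowr x a" "epowr y a" "1 / a"]
  by (auto simp: epowr_inverse_cancel)

lemma measurable_epowr [measurable (raw)]:
  assumes [measurable]: "f \<in> borel_measurable M"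
  shows "(\<lambda>x. epowr (f x) a) \<in> borel_measurable M"
  unfolding epowr_def by measurable

text \<open>The power is strictly increasing, so the values below e are exactly those of arguments
  below e^(1/a).\<close>

lemma epowr_tendsto_0:
  assumes f: "(f \<longlongrightarrow> 0) F" and a: "0 < a"
  shows "((\<lambda>x. epowr (f x) a) \<longlongrightarrow> 0) F"
proof (rule order_tendstoI)
  fix e :: ennreal assume e: "0 < e"
  then have "eventually (\<lambda>x. f x < epowr e (1 / a)) F"
    using f by (intro order_tendstoD) (auto simp: less_le)
  then show "eventually (\<lambda>x. epowr (f x) a < e) F"
  proof eventually_elim
    case (elim x)
    then show ?case
      using epowr_le_iff[OF a, of "epowr e (1 / a)" "f x"] a
      by (simp add: epowr_inverse_cancel not_le[symmetric])
  qed
qed simp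

text \<open>For a > 0 the power is an order isomorphism of [0,infinity], with inverse exponent 1/a,
  and so preserves suprema.\<close>

lemma epowr_SUP:
  assumes "0 < a"
  shows "epowr (SUP i\<in>J. f i) a = (SUP i\<in>J. epowr (f i) a)"
proof (rule antisym)
  have "(SUP i\<in>J. f i) \<le> epowr (SUP i\<in>J. epowr (f i) a) (1 / a)"
  proof (rule SUP_least)
    fix i assume "i \<in> J"
    then have "epowr (epowr (f i) a) (1 / a) \<le> epowr (SUP i\<in>J. epowr (f i) a) (1 / a)"
      using assms by (intro epowr_mono SUP_upper) auto
    then show "f i \<le> epowr (SUP i\<in>J. epowr (f i) a) (1 / a)"
      using assms by (simp add: epowr_inverse_cancel)
  qed
  then have "epowr (SUP i\<in>J. f i) a \<le> epowr (epowr (SUP i\<in>J. epowr (f i) a) (1 / a)) a"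
    using assms by (intro epowr_mono) auto
  then show "epowr (SUP i\<in>J. f i) a \<le> (SUP i\<in>J. epowr (f i) a)"
    using assms by (simp add: epowr_inverse_cancel)
qed (use assms in \<open>auto intro!: SUP_least epowr_mono SUP_upper\<close>)

section \<open>The L^p norm on [0,infinity]-valued functions; inequalities of Young, Hoelder and
  Minkowski\<close>

definition lpn :: "'a measure \<Rightarrow> real \<Rightarrow> ('a \<Rightarrow> ennreal) \<Rightarrow> ennreal" where
  "lpn M p f = epowr (\<integral>\<^sup>+x. epowr (f x) p \<partial>M) (1 / p)"

lemma epowr_lpn: "p \<noteq> 0 \<Longrightarrow> epowr (lpn M p f) p = (\<integral>\<^sup>+x. epowr (f x) p \<partial>M)"
  by (simp add: lpn_def epowr_inverse_cancel)

lemma lpn_mono_AE: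
  assumes "AE x in M. f x \<le> g x" "0 < p"
  shows "lpn M p f \<le> lpn M p g"
  unfolding lpn_def using assms
  by (intro epowr_mono nn_integral_mono_AE) (auto elim!: eventually_mono intro: epowr_mono)

lemma lpn_mono:
  assumes "\<And>x. x \<in> space M \<Longrightarrow> f x \<le> g x" "0 < p"
  shows "lpn M p f \<le> lpn M p g"
  using assms by (intro lpn_mono_AE) auto

lemma lpn_cong_AE:
  assumes "AE x in M. f x = g x"
  shows "lpn M p f = lpn M p g"
proof -
  have "(\<integral>\<^sup>+x. epowr (f x) p \<partial>M) = (\<integral>\<^sup>+x. epowr (g x) p \<partial>M)"
    using assms by (intro nn_integral_cong_AE) (auto elim!: eventually_mono)
  then show ?thesis by (simp add: lpn_def)
qed

lemma lpn_cong:
  assumes "\<And>x. x \<in> space M \<Longrightarrow> f x = g x"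
  shows "lpn M p f = lpn M p g"
  using assms by (intro lpn_cong_AE) auto

lemma lpn_0 [simp]: "lpn M p (\<lambda>x. 0) = 0"
  by (simp add: lpn_def)

lemma lpn_cmult:
  assumes "f \<in> borel_measurable M" "p \<noteq> 0"
  shows "lpn M p (\<lambda>x. c * f x) = c * lpn M p f"
  using assms by (simp add: lpn_def epowr_mult nn_integral_cmult epowr_inverse_cancel)

lemma lpn_eq_0_iff:
  assumes "f \<in> borel_measurable M"
  shows "lpn M p f = 0 \<longleftrightarrow> (AE x in M. f x = 0)"
  using assms by (simp add: lpn_def nn_integral_0_iff_AE)

lemma lpn_finite_AE:
  assumes "f \<in> borel_measurable M" "lpn M p f < \<top>"
  shows "AE x in M. f x < \<top>"
  using nn_integral_PInf_AE[of "\<lambda>x. epowr (f x) p" M] assms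
  by (simp add: lpn_def less_top)

lemma measurable_lpn:
  assumes "sigma_finite_measure N" "(\<lambda>(x, y). f x y) \<in> borel_measurable (M \<Otimes>\<^sub>M N)"
  shows "(\<lambda>x. lpn N p (f x)) \<in> borel_measurable M"
proof -
  interpret sigma_finite_measure N by fact
  have [measurable]: "(\<lambda>x. \<integral>\<^sup>+y. epowr (f x y) p \<partial>N) \<in> borel_measurable M"
    using assms(2) by (intro borel_measurable_nn_integral) (simp add: case_prod_beta')
  show ?thesis unfolding lpn_def by measurable
qed

lemma young_ennreal:
  assumes pq: "1 < p" "1 < q" "1 / p + 1 / q = 1"
  shows "u * v \<le> ennreal (1 / p) * epowr u p + ennreal (1 / q) * epowr v q"
proof (cases "u = 0 \<or> v = 0 \<or> u = \<top> \<or> v = \<top>")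
  case True
  then show ?thesis using pq by (auto simp: ennreal_mult_top)
next
  case False
  then obtain a b where "u = ennreal a" "v = ennreal b" "0 \<le> a" "0 \<le> b"
    by (cases u; cases v) auto
  then show ?thesis using Youngs_inequality[OF pq, of a b] pq
    by (simp add: epowr_ennreal field_simps flip: ennreal_mult ennreal_plus)
qed

lemma Hoelder:
  assumes pq: "1 < p" "1 < q" "1 / p + 1 / q = 1"
    and [measurable]: "f \<in> borel_measurable M" "g \<in> borel_measurable M"
  shows "(\<integral>\<^sup>+x. f x * g x \<partial>M) \<le> lpn M p f * lpn M q g"
proof (cases "lpn M p f = 0 \<or> lpn M q g = 0")
  case True
  then have "AE x in M. f x * g x = 0"
    by (auto simp: lpn_eq_0_iff elim!: eventually_mono)
  then have "(\<integral>\<^sup>+x. f x * g x \<partial>M) = (\<integral>\<^sup>+x. 0 \<partial>M)" by (rule nn_integral_cong_AE)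
  then show ?thesis by simp
next
  case False
  show ?thesis
  proof (cases "lpn M p f = \<top> \<or> lpn M q g = \<top>")
    case True
    then show ?thesis using False by (auto simp: ennreal_mult_top ennreal_top_mult)
  next
    case fin: False
    \<comment> \<open>Both factors are scaled to norm 1; Young's inequality, integrated, then gives
      1/p + 1/q = 1. The norms 0 and infinity were split off because \<open>inverse\<close> does not
      normalize them.\<close>
    define a b where "a = lpn M p f" and "b = lpn M q g"
    have ab: "a \<noteq> 0" "b \<noteq> 0" "a \<noteq> \<top>" "b \<noteq> \<top>" using False fin by (auto simp: a_def b_def)
    have one: "a * inverse a = 1" "b * inverse b = 1"
      using ab ennreal_divide_self[of a] ennreal_divide_self[of b]
      by (simp_all add: divide_ennreal_def less_top)
    have norm1: "(\<integral>\<^sup>+x. epowr (inverse a * f x) p \<partial>M) = 1"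
      using pq one epowr_lpn[of p M "\<lambda>x. inverse a * f x"] lpn_cmult[of f M p "inverse a"]
      by (simp add: a_def mult.commute)
    have norm2: "(\<integral>\<^sup>+x. epowr (inverse b * g x) q \<partial>M) = 1"
      using pq one epowr_lpn[of q M "\<lambda>x. inverse b * g x"] lpn_cmult[of g M q "inverse b"]
      by (simp add: b_def mult.commute)
    have "(\<integral>\<^sup>+x. f x * g x \<partial>M) = (\<integral>\<^sup>+x. (a * b) * ((inverse a * f x) * (inverse b * g x)) \<partial>M)"
    proof (rule nn_integral_cong)
      fix x
      have "(a * b) * ((inverse a * f x) * (inverse b * g x))
          = (a * inverse a) * (b * inverse b) * (f x * g x)" by (simp add: mult_ac)
      then show "f x * g x = (a * b) * ((inverse a * f x) * (inverse b * g x))" by (simp add: one)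
    qed
    also have "\<dots> = (a * b) * (\<integral>\<^sup>+x. (inverse a * f x) * (inverse b * g x) \<partial>M)"
      by (rule nn_integral_cmult) simp
    also have "(\<integral>\<^sup>+x. (inverse a * f x) * (inverse b * g x) \<partial>M)
        \<le> (\<integral>\<^sup>+x. ennreal (1 / p) * epowr (inverse a * f x) p
              + ennreal (1 / q) * epowr (inverse b * g x) q \<partial>M)"
      by (intro nn_integral_mono young_ennreal pq)
    also have "\<dots> = ennreal (1 / p) + ennreal (1 / q)"
      by (simp add: nn_integral_add nn_integral_cmult norm1 norm2)
    also have "\<dots> = 1" using pq by (simp flip: ennreal_plus)
    finally show ?thesis by (simp add: a_def b_def mult_left_mono)
  qed
qed

text \<open>Divides y = y^(1/p) y^(1 - 1/p) by its second factor. Finiteness of \<open>y\<close> is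
  essential: at infinity the hypothesis holds for every R > 0.\<close>

lemma le_of_le_mult_epowr:
  assumes le: "y \<le> R * epowr y (1 - 1 / p)" and y: "y < \<top>" and p: "0 < p"
  shows "epowr y (1 / p) \<le> R"
proof (cases "y = 0 \<or> R = \<top>")
  case False
  then obtain a b where ab: "y = ennreal a" "R = ennreal b" "0 < a" "0 \<le> b"
    using y by (cases y; cases R) auto
  have "a powr (1 / p) * a powr (1 - 1 / p) = a" using ab by (simp flip: powr_add)
  moreover have "a \<le> b * a powr (1 - 1 / p)"
    using le ab by (simp add: epowr_ennreal flip: ennreal_mult)
  ultimately have "a powr (1 / p) * a powr (1 - 1 / p) \<le> b * a powr (1 - 1 / p)" by simp
  then have "a powr (1 / p) \<le> b" using ab by simp
  then show ?thesis using ab by (simp add: epowr_ennreal ennreal_leI)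
qed auto

text \<open>With F the integral over y, write F^p = F F^(p-1), let Tonelli move the integral over y
  to the outside, and apply Hoelder's inequality in x. This bounds the p-th power of the norm by R
  times its (p-1)-st power.\<close>

lemma Minkowski_integral:
  assumes "sigma_finite_measure M" "sigma_finite_measure N" and p: "1 \<le> p"
    and f[measurable]: "(\<lambda>(x, y). f x y) \<in> borel_measurable (M \<Otimes>\<^sub>M N)"
  shows "lpn M p (\<lambda>x. \<integral>\<^sup>+y. f x y \<partial>N) \<le> (\<integral>\<^sup>+y. lpn M p (\<lambda>x. f x y) \<partial>N)"
proof -
  interpret M: sigma_finite_measure M by fact
  interpret N: sigma_finite_measure N by fact
  interpret pair_sigma_finite M N ..
  have f'[measurable]: "(\<lambda>(y, x). f x y) \<in> borel_measurable (N \<Otimes>\<^sub>M M)"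
    using f by (subst measurable_pair_swap_iff) (simp add: case_prod_beta')
  define F where "F x = (\<integral>\<^sup>+y. f x y \<partial>N)" for x
  define R where "R = (\<integral>\<^sup>+y. lpn M p (\<lambda>x. f x y) \<partial>N)"
  have F[measurable]: "F \<in> borel_measurable M"
    unfolding F_def by (intro N.borel_measurable_nn_integral) simp
  have Rm[measurable]: "(\<lambda>y. lpn M p (\<lambda>x. f x y)) \<in> borel_measurable N"
    by (rule measurable_lpn) (use assms f' in auto)
  show ?thesis
  proof (cases "p = 1")
    case True
    then show ?thesis using Fubini'[of f] by (simp add: lpn_def)
  next
    case False
    then have p1: "1 < p" using p by simp
    \<comment> \<open>The conjugate exponent: (p - 1) q = p turns the L^q norm of h^(p-1) into a
      power of the integral of h^p.\<close>
    define q where "q = p / (p - 1)"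
    have q: "1 < q" "1 / p + 1 / q = 1" "(p - 1) * q = p" "1 / q = 1 - 1 / p"
      using p1 by (auto simp: q_def field_simps)
    obtain A :: "nat \<Rightarrow> 'a set" where A: "range A \<subseteq> sets M" "(\<Union>i. A i) = space M"
        "\<And>i. emeasure M (A i) \<noteq> \<infinity>" "incseq A"
      using M.sigma_finite_incseq by metis
    have A'[measurable]: "A n \<in> sets M" for n using A(1) by auto
    \<comment> \<open>The truncations have finite norm, so that \<open>\<parallel>h n\<parallel>\<^sup>p \<le> R \<parallel>h n\<parallel>\<^bsup>p - 1\<^esup>\<close> can be divided.\<close>
    define h where "h n x = min (F x) (of_nat n) * indicator (A n) x" for n x
    have hm[measurable]: "h n \<in> borel_measurable M" for n unfolding h_def by simp
    have hle: "h n x \<le> F x" for n x by (simp add: h_def indicator_def)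
    have main: "lpn M p (h n) \<le> R" for n
    proof -
      define y where "y = (\<integral>\<^sup>+x. epowr (h n x) p \<partial>M)"
      have "y \<le> (\<integral>\<^sup>+x. epowr (of_nat n) p * indicator (A n) x \<partial>M)"
        unfolding y_def using p
        by (intro nn_integral_mono) (auto simp: h_def indicator_def intro!: epowr_mono)
      also have "\<dots> = epowr (of_nat n) p * emeasure M (A n)"
        by (rule nn_integral_cmult_indicator) simp
      also have "\<dots> < \<top>" using A(3)[of n]
        by (simp add: ennreal_mult_less_top less_top of_nat_less_top)
      finally have y: "y < \<top>" .
      have "y = (\<integral>\<^sup>+x. h n x * epowr (h n x) (p - 1) \<partial>M)"
        unfolding y_def using epowr_add[of _ 1 "p - 1"] by simp
      also have "\<dots> \<le> (\<integral>\<^sup>+x. F x * epowr (h n x) (p - 1) \<partial>M)"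
        by (intro nn_integral_mono mult_right_mono hle) simp
      also have "\<dots> = (\<integral>\<^sup>+x. (\<integral>\<^sup>+y. f x y * epowr (h n x) (p - 1) \<partial>N) \<partial>M)"
        unfolding F_def by (intro nn_integral_cong) (simp add: nn_integral_multc)
      also have "\<dots> = (\<integral>\<^sup>+y. (\<integral>\<^sup>+x. f x y * epowr (h n x) (p - 1) \<partial>M) \<partial>N)"
        by (rule Fubini'[symmetric]) simp
      also have "\<dots> \<le> (\<integral>\<^sup>+y. lpn M p (\<lambda>x. f x y) * lpn M q (\<lambda>x. epowr (h n x) (p - 1)) \<partial>N)"
        by (intro nn_integral_mono Hoelder p1 q) auto
      also have "\<dots> = R * lpn M q (\<lambda>x. epowr (h n x) (p - 1))"
        unfolding R_def by (simp add: nn_integral_multc)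
      also have "lpn M q (\<lambda>x. epowr (h n x) (p - 1)) = epowr y (1 - 1 / p)"
        unfolding lpn_def epowr_epowr q y_def ..
      finally show ?thesis
        unfolding lpn_def y_def[symmetric] using y p by (intro le_of_le_mult_epowr) auto
    qed
    have inc: "incseq h"
    proof (intro incseq_SucI le_funI)
      fix n x
      have "A n \<subseteq> A (Suc n)" using A(4) by (simp add: incseq_Suc_iff)
      moreover have "min (F x) (of_nat n) \<le> min (F x) (of_nat (Suc n))"
        by (rule min.mono) (auto intro: of_nat_mono)
      ultimately show "h n x \<le> h (Suc n) x"
        by (auto simp: h_def indicator_def)
    qed
    have sup: "(SUP n. h n x) = F x" if x: "x \<in> space M" for x
    proof (rule antisym)
      show "(SUP n. h n x) \<le> F x" by (intro SUP_least hle)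
      obtain m where m: "x \<in> A m" using x A(2) by auto
      show "F x \<le> (SUP n. h n x)"
      proof (rule ccontr)
        assume "\<not> F x \<le> (SUP n. h n x)"
        then have less: "(SUP n. h n x) < F x" by simp
        then have "(SUP n. h n x) < \<top>" by (rule less_le_trans) simp
        then obtain k where k: "(SUP n. h n x) < of_nat k"
          using ennreal_Ex_less_of_nat less_top by blast
        define n where "n = max k m"
        have "x \<in> A n" using m incseqD[OF A(4), of m n] by (auto simp: n_def)
        then have "min (F x) (of_nat n) = h n x" by (simp add: h_def)
        also have "\<dots> \<le> (SUP n. h n x)" by (rule SUP_upper) simp
        finally have "of_nat n \<le> (SUP n. h n x)" using less by (auto simp: min_le_iff_disj not_le[symmetric])
        moreover have "(of_nat k :: ennreal) \<le> of_nat n" by (rule of_nat_mono) (simp add: n_def)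
        ultimately show False using k by (meson leD order_trans)
      qed
    qed
    \<comment> \<open>The truncations increase to F, so monotone convergence carries the common
      bound R over to F.\<close>
    have "(\<integral>\<^sup>+x. epowr (F x) p \<partial>M) = (\<integral>\<^sup>+x. (SUP n. epowr (h n x) p) \<partial>M)"
      using p by (intro nn_integral_cong) (simp add: sup[symmetric] epowr_SUP)
    also have "\<dots> = (SUP n. \<integral>\<^sup>+x. epowr (h n x) p \<partial>M)"
    proof (rule nn_integral_monotone_convergence_SUP)
      show "incseq (\<lambda>n x. epowr (h n x) p)"
        using inc p by (auto simp: incseq_def le_fun_def intro!: epowr_mono)
    qed simp
    also have "\<dots> \<le> epowr R p"
    proof (rule SUP_least)
      fix n
      have "epowr (lpn M p (h n)) p \<le> epowr R p" using main p by (intro epowr_mono) auto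
      then show "(\<integral>\<^sup>+x. epowr (h n x) p \<partial>M) \<le> epowr R p"
        using p by (simp add: epowr_lpn)
    qed
    finally have "epowr (\<integral>\<^sup>+x. epowr (F x) p \<partial>M) (1 / p) \<le> epowr (epowr R p) (1 / p)"
      using p by (intro epowr_mono) auto
    then show ?thesis using p by (simp add: F_def R_def lpn_def epowr_inverse_cancel)
  qed
qed


text \<open>Minkowski's integral inequality for the counting measure on a two-element type.\<close>

lemma lpn_add:
  assumes "sigma_finite_measure M" "1 \<le> p"
    and [measurable]: "f \<in> borel_measurable M" "g \<in> borel_measurable M"
  shows "lpn M p (\<lambda>x. f x + g x) \<le> lpn M p f + lpn M p g"
proof -
  have "lpn M p (\<lambda>x. \<integral>\<^sup>+b. (if b then f x else g x) \<partial>count_space UNIV)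
      \<le> (\<integral>\<^sup>+b. lpn M p (\<lambda>x. if b then f x else g x) \<partial>count_space UNIV)"
    using assms by (intro Minkowski_integral sigma_finite_measure_count_space) measurable
  then show ?thesis by (simp add: nn_integral_count_space_finite UNIV_bool add.commute)
qed

text \<open>Minkowski's integral inequality for the counting measure on the naturals. It later sums
  the distances between consecutive approximations.\<close>

lemma lpn_suminf:
  assumes "sigma_finite_measure M" "1 \<le> p" and [measurable]: "\<And>n::nat. f n \<in> borel_measurable M"
  shows "lpn M p (\<lambda>x. \<Sum>n. f n x) \<le> (\<Sum>n. lpn M p (f n))"
proof -
  have "(\<lambda>z. f (snd z) (fst z)) \<in> borel_measurable (M \<Otimes>\<^sub>M count_space UNIV)"
    by (rule measurable_compose_countable[where f = "\<lambda>n z. f n (fst z)"]) measurable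
  then have "lpn M p (\<lambda>x. \<integral>\<^sup>+n. f n x \<partial>count_space UNIV)
      \<le> (\<integral>\<^sup>+n. lpn M p (\<lambda>x. f n x) \<partial>count_space UNIV)"
    using assms by (intro Minkowski_integral sigma_finite_measure_count_space)
      (auto simp: case_prod_beta')
  then show ?thesis by (simp add: nn_integral_count_space_nat)
qed

lemma lpn_dominated_0:
  assumes p: "0 < p" and [measurable]: "\<And>n. f n \<in> borel_measurable M" "g \<in> borel_measurable M"
    and le: "\<And>n. AE x in M. f n x \<le> g x" and g: "lpn M p g < \<top>"
    and lim: "AE x in M. (\<lambda>n. f n x) \<longlonglongrightarrow> 0"
  shows "(\<lambda>n. lpn M p (f n)) \<longlonglongrightarrow> 0"
proof -
  have "(\<lambda>n. \<integral>\<^sup>+x. epowr (f n x) p \<partial>M) \<longlonglongrightarrow> (\<integral>\<^sup>+x. 0 \<partial>M)"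
  proof (rule nn_integral_dominated_convergence[where w = "\<lambda>x. epowr (g x) p"])
    show "AE x in M. epowr (f n x) p \<le> epowr (g x) p" for n
      using le[of n] p by (auto elim!: eventually_mono intro: epowr_mono)
    show "(\<integral>\<^sup>+x. epowr (g x) p \<partial>M) < \<infinity>" using g by (simp add: lpn_def)
    show "AE x in M. (\<lambda>n. epowr (f n x) p) \<longlonglongrightarrow> 0"
      using lim p by (auto elim!: eventually_mono intro: epowr_tendsto_0)
  qed simp_all
  then show ?thesis using p unfolding lpn_def by (intro epowr_tendsto_0) simp_all
qed

text \<open>The bounds \<open>B n\<close> are meant to be a fixed norm plus an approximation error,
  so they converge. For c > b the norms are eventually at most c, and Fatou's lemma is applied to
  the p-th powers.\<close>

lemma lpn_Fatou:
  assumes p: "0 < p" and [measurable]: "\<And>n. f n \<in> borel_measurable M"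
    and g: "AE x in M. g x \<le> liminf (\<lambda>n. f n x)"
    and le: "\<And>n. lpn M p (f n) \<le> B n" and B: "B \<longlonglongrightarrow> b"
  shows "lpn M p g \<le> b"
proof (rule dense_ge)
  fix c assume c: "b < c"
  have "(\<integral>\<^sup>+x. epowr (g x) p \<partial>M) \<le> (\<integral>\<^sup>+x. liminf (\<lambda>n. epowr (f n x) p) \<partial>M)"
  proof (rule nn_integral_mono_AE, use g in eventually_elim)
    case (elim x)
    show ?case
    proof (rule le_Liminf_iff[THEN iffD2], intro allI impI)
      fix y assume y: "y < epowr (g x) p"
      \<comment> \<open>Lower semicontinuity of the power: y^(1/p) lies below g x, hence eventually
        below \<open>f n x\<close>.\<close>
      then have "epowr y (1 / p) < g x"
        using p epowr_le_iff[OF p, of "g x" "epowr y (1 / p)"]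
        by (simp add: epowr_inverse_cancel not_le[symmetric])
      then have "eventually (\<lambda>n. epowr y (1 / p) < f n x) sequentially"
        using elim by (intro less_LiminfD) (rule less_le_trans)
      then show "eventually (\<lambda>n. y < epowr (f n x) p) sequentially"
      proof eventually_elim
        case (elim n)
        then show ?case
          using p epowr_le_iff[OF p, of "f n x" "epowr y (1 / p)"]
          by (simp add: epowr_inverse_cancel not_le[symmetric])
      qed
    qed
  qed
  also have "\<dots> \<le> liminf (\<lambda>n. \<integral>\<^sup>+x. epowr (f n x) p \<partial>M)"
    by (rule nn_integral_liminf) simp
  also have "\<dots> \<le> liminf (\<lambda>n. epowr c p)"
  proof (rule Liminf_mono)
    show "\<forall>\<^sub>F n in sequentially. (\<integral>\<^sup>+x. epowr (f n x) p \<partial>M) \<le> epowr c p"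
      using order_tendstoD(2)[OF B c]
    proof eventually_elim
      case (elim n)
      then have "lpn M p (f n) \<le> c" using le[of n] by simp
      then show ?case using epowr_mono[of "lpn M p (f n)" c p] p by (simp add: epowr_lpn)
    qed
  qed
  also have "\<dots> = epowr c p" by (rule lim_imp_Liminf) simp_all
  finally show "lpn M p g \<le> c"
    using epowr_mono[of "\<integral>\<^sup>+x. epowr (g x) p \<partial>M" "epowr c p" "1 / p"] p
    by (simp add: lpn_def epowr_inverse_cancel)
qed

text \<open>With the same exponent in both variables this is Tonelli for f^p. It lets the L^r norm
  in \<omega> pass under the L^r norm in the intermediate time s.\<close>

lemma lpn_swap:
  assumes "sigma_finite_measure M" "sigma_finite_measure N" and p: "0 < p"
    and f: "(\<lambda>(x, y). f x y) \<in> borel_measurable (M \<Otimes>\<^sub>M N)"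
  shows "lpn N p (\<lambda>y. lpn M p (\<lambda>x. f x y)) = lpn M p (\<lambda>x. lpn N p (f x))"
proof -
  interpret M: sigma_finite_measure M by fact
  interpret N: sigma_finite_measure N by fact
  interpret pair_sigma_finite M N ..
  have "(\<lambda>(x, y). epowr (f x y) p) \<in> borel_measurable (M \<Otimes>\<^sub>M N)"
    using measurable_epowr[OF f, of p] by (simp add: case_prod_beta')
  from Fubini'[OF this] show ?thesis
    using p by (simp add: lpn_def epowr_inverse_cancel)
qed

text \<open>\<open>Q\<close> need not describe a measurable set, so the quantifiers are exchanged
  for the complement of a measurable null set \<open>Z\<close> that contains all exceptions.\<close>

lemma AE_pair_swapD:
  assumes "sigma_finite_measure M" "sigma_finite_measure N" "AE z in M \<Otimes>\<^sub>M N. Q z"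
  shows "AE y in N. AE x in M. Q (x, y)"
proof -
  interpret M: sigma_finite_measure M by fact
  interpret N: sigma_finite_measure N by fact
  interpret pair_sigma_finite M N ..
  obtain Z where Z: "Z \<in> null_sets (M \<Otimes>\<^sub>M N)" "{z \<in> space (M \<Otimes>\<^sub>M N). \<not> Q z} \<subseteq> Z"
    using assms(3) by (auto simp: eventually_ae_filter)
  have [measurable]: "Z \<in> sets (M \<Otimes>\<^sub>M N)" using Z by auto
  have "AE z in M \<Otimes>\<^sub>M N. z \<notin> Z" using Z(1) by (rule AE_not_in)
  then have "AE x in M. AE y in N. (x, y) \<notin> Z" by (rule AE_pair)
  then have "AE y in N. AE x in M. (x, y) \<notin> Z"
    by (subst (asm) AE_commute) measurable
  then show ?thesis
    using AE_space
  proof eventually_elim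
    case (elim y)
    from elim(1) AE_space show ?case
    proof eventually_elim
      case (elim x)
      then show ?case using Z(2) \<open>y \<in> space N\<close> by (auto simp: space_pair_measure)
    qed
  qed
qed

section \<open>Mixed norms: L^p in \<omega> inside, L^q in time outside\<close>

definition lpn2 :: "'w measure \<Rightarrow> real \<Rightarrow> 'u measure \<Rightarrow> real \<Rightarrow> ('w \<times> 'u \<Rightarrow> ennreal) \<Rightarrow> ennreal" where
  "lpn2 P p L q f = lpn L q (\<lambda>u. lpn P p (\<lambda>\<omega>. f (\<omega>, u)))"

locale mixed_norm =
  fst: sigma_finite_measure P + snd: sigma_finite_measure L
  for P :: "'w measure" and L :: "'u measure" +
  fixes p q :: real
  assumes p: "1 \<le> p" and q: "1 \<le> q"
begin

sublocale pair_sigma_finite P L ..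

lemma pos: "0 < p" "0 < q" "p \<noteq> 0" "q \<noteq> 0"
  using p q by auto

lemma measurable_slice:
  assumes [measurable]: "f \<in> borel_measurable (P \<Otimes>\<^sub>M L)" "u \<in> space L"
  shows "(\<lambda>\<omega>. f (\<omega>, u)) \<in> borel_measurable P"
  by measurable

lemma measurable_inner:
  assumes f: "f \<in> borel_measurable (P \<Otimes>\<^sub>M L)"
  shows "(\<lambda>u. lpn P p (\<lambda>\<omega>. f (\<omega>, u))) \<in> borel_measurable L"
proof (rule measurable_lpn[OF fst.sigma_finite_measure_axioms])
  show "(\<lambda>(u, \<omega>). f (\<omega>, u)) \<in> borel_measurable (L \<Otimes>\<^sub>M P)"
    using f by (subst measurable_pair_swap_iff) simp
qed

lemma lpn2_mono_AE:
  assumes "AE z in P \<Otimes>\<^sub>M L. f z \<le> g z"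
  shows "lpn2 P p L q f \<le> lpn2 P p L q g"
proof -
  have "AE u in L. AE \<omega> in P. f (\<omega>, u) \<le> g (\<omega>, u)"
    using assms by (rule AE_pair_swapD[OF fst.sigma_finite_measure_axioms snd.sigma_finite_measure_axioms])
  then have "AE u in L. lpn P p (\<lambda>\<omega>. f (\<omega>, u)) \<le> lpn P p (\<lambda>\<omega>. g (\<omega>, u))"
    using pos by (auto elim!: eventually_mono intro: lpn_mono_AE)
  then show ?thesis unfolding lpn2_def using pos by (intro lpn_mono_AE)
qed

lemma lpn2_mono:
  assumes "\<And>z. z \<in> space (P \<Otimes>\<^sub>M L) \<Longrightarrow> f z \<le> g z"
  shows "lpn2 P p L q f \<le> lpn2 P p L q g"
  using assms by (intro lpn2_mono_AE) auto

lemma lpn2_cong_AE: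
  assumes "AE z in P \<Otimes>\<^sub>M L. f z = g z"
  shows "lpn2 P p L q f = lpn2 P p L q g"
  using assms by (intro antisym lpn2_mono_AE) auto

lemma lpn2_cmult:
  assumes "f \<in> borel_measurable (P \<Otimes>\<^sub>M L)"
  shows "lpn2 P p L q (\<lambda>z. c * f z) = c * lpn2 P p L q f"
proof -
  have "lpn2 P p L q (\<lambda>z. c * f z) = lpn L q (\<lambda>u. c * lpn P p (\<lambda>\<omega>. f (\<omega>, u)))"
    unfolding lpn2_def using assms pos by (intro lpn_cong lpn_cmult measurable_slice) auto
  also have "\<dots> = c * lpn2 P p L q f"
    unfolding lpn2_def using assms pos by (intro lpn_cmult measurable_inner) auto
  finally show ?thesis .
qed

lemma lpn2_add:
  assumes "f \<in> borel_measurable (P \<Otimes>\<^sub>M L)" "g \<in> borel_measurable (P \<Otimes>\<^sub>M L)"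
  shows "lpn2 P p L q (\<lambda>z. f z + g z) \<le> lpn2 P p L q f + lpn2 P p L q g"
proof -
  have "lpn2 P p L q (\<lambda>z. f z + g z)
      \<le> lpn L q (\<lambda>u. lpn P p (\<lambda>\<omega>. f (\<omega>, u)) + lpn P p (\<lambda>\<omega>. g (\<omega>, u)))"
    unfolding lpn2_def using assms pos p
    by (intro lpn_mono lpn_add measurable_slice fst.sigma_finite_measure_axioms) auto
  also have "\<dots> \<le> lpn2 P p L q f + lpn2 P p L q g"
    unfolding lpn2_def using assms q
    by (intro lpn_add measurable_inner snd.sigma_finite_measure_axioms) auto
  finally show ?thesis .
qed

lemma lpn2_finite_inner:
  assumes "f \<in> borel_measurable (P \<Otimes>\<^sub>M L)" "lpn2 P p L q f < \<top>"
  shows "AE u in L. lpn P p (\<lambda>\<omega>. f (\<omega>, u)) < \<top>"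
  using assms unfolding lpn2_def by (intro lpn_finite_AE measurable_inner)

text \<open>Dominated convergence twice: a finite mixed norm of g makes its inner norm finite for
  a.e. u, which is what the inner application needs.\<close>

lemma lpn2_dominated_0:
  assumes [measurable]: "\<And>n. f n \<in> borel_measurable (P \<Otimes>\<^sub>M L)" "g \<in> borel_measurable (P \<Otimes>\<^sub>M L)"
    and le: "\<And>n z. z \<in> space (P \<Otimes>\<^sub>M L) \<Longrightarrow> f n z \<le> g z" and g: "lpn2 P p L q g < \<top>"
    and lim: "\<And>z. z \<in> space (P \<Otimes>\<^sub>M L) \<Longrightarrow> (\<lambda>n. f n z) \<longlonglongrightarrow> 0"
  shows "(\<lambda>n. lpn2 P p L q (f n)) \<longlonglongrightarrow> 0"
  unfolding lpn2_def
proof (rule lpn_dominated_0[where g = "\<lambda>u. lpn P p (\<lambda>\<omega>. g (\<omega>, u))"])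
  show "AE u in L. lpn P p (\<lambda>\<omega>. f n (\<omega>, u)) \<le> lpn P p (\<lambda>\<omega>. g (\<omega>, u))" for n
    using le pos by (auto intro!: AE_I2 lpn_mono simp: space_pair_measure)
  show "AE u in L. (\<lambda>n. lpn P p (\<lambda>\<omega>. f n (\<omega>, u))) \<longlonglongrightarrow> 0"
    using lpn2_finite_inner[OF assms(2) g] AE_space
  proof eventually_elim
    case (elim u)
    then show ?case using le lim pos
      by (intro lpn_dominated_0[where g = "\<lambda>\<omega>. g (\<omega>, u)"])
        (auto simp: space_pair_measure intro!: measurable_slice AE_I2)
  qed
  show "lpn L q (\<lambda>u. lpn P p (\<lambda>\<omega>. g (\<omega>, u))) < \<top>" using g by (simp add: lpn2_def)
qed (use pos in \<open>auto intro!: measurable_inner\<close>)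

text \<open>Minkowski's integral inequality in the inner and then in the outer variable. It stands
  in for the norm inequality of integrals with values in L^{p,q}.\<close>

lemma lpn2_Minkowski_integral:
  assumes N: "sigma_finite_measure N"
    and f: "(\<lambda>(s, z). f s z) \<in> borel_measurable (N \<Otimes>\<^sub>M (P \<Otimes>\<^sub>M L))"
  shows "lpn2 P p L q (\<lambda>z. \<integral>\<^sup>+s. f s z \<partial>N) \<le> (\<integral>\<^sup>+s. lpn2 P p L q (f s) \<partial>N)"
proof -
  interpret N: sigma_finite_measure N by fact
  have f': "(\<lambda>x. f (fst x) (snd x)) \<in> borel_measurable (N \<Otimes>\<^sub>M (P \<Otimes>\<^sub>M L))"
    using f by (simp add: case_prod_beta')
  note fc = measurable_compose[OF _ f']
  have "(\<lambda>x. f (fst x) (snd (snd x), fst (snd x))) \<in> borel_measurable (N \<Otimes>\<^sub>M (L \<Otimes>\<^sub>M P))"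
    using fc[of "\<lambda>x. (fst x, snd (snd x), fst (snd x))"] by simp
  then have 1: "(\<lambda>(s, u, \<omega>). f s (\<omega>, u)) \<in> borel_measurable (N \<Otimes>\<^sub>M (L \<Otimes>\<^sub>M P))"
    by (simp add: case_prod_beta')
  have "(\<lambda>y. f (snd (fst y)) (snd y, fst (fst y))) \<in> borel_measurable ((L \<Otimes>\<^sub>M N) \<Otimes>\<^sub>M P)"
    using fc[of "\<lambda>y. (snd (fst y), snd y, fst (fst y))"] by simp
  then have 2: "(\<lambda>(u, s). lpn P p (\<lambda>\<omega>. f s (\<omega>, u))) \<in> borel_measurable (L \<Otimes>\<^sub>M N)"
    unfolding case_prod_beta'
    by (intro measurable_lpn fst.sigma_finite_measure_axioms) (simp add: case_prod_beta')
  have "lpn2 P p L q (\<lambda>z. \<integral>\<^sup>+s. f s z \<partial>N)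
      \<le> lpn L q (\<lambda>u. \<integral>\<^sup>+s. lpn P p (\<lambda>\<omega>. f s (\<omega>, u)) \<partial>N)"
    unfolding lpn2_def
  proof (rule lpn_mono)
    fix u assume [measurable]: "u \<in> space L"
    have "(\<lambda>x. f (snd x) (fst x, u)) \<in> borel_measurable (P \<Otimes>\<^sub>M N)"
      using fc[of "\<lambda>x. (snd x, fst x, u)"] by simp
    then show "lpn P p (\<lambda>\<omega>. \<integral>\<^sup>+s. f s (\<omega>, u) \<partial>N) \<le> (\<integral>\<^sup>+s. lpn P p (\<lambda>\<omega>. f s (\<omega>, u)) \<partial>N)"
      using p by (intro Minkowski_integral fst.sigma_finite_measure_axioms N) (auto simp: case_prod_beta')
  qed (use pos in auto)
  also have "\<dots> \<le> (\<integral>\<^sup>+s. lpn2 P p L q (f s) \<partial>N)"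
    unfolding lpn2_def using q 2
    by (intro Minkowski_integral snd.sigma_finite_measure_axioms N) auto
  finally show ?thesis .
qed

lemma measurable_lpn2:
  assumes f: "(\<lambda>(s, z). f s z) \<in> borel_measurable (N \<Otimes>\<^sub>M (P \<Otimes>\<^sub>M L))"
  shows "(\<lambda>s. lpn2 P p L q (f s)) \<in> borel_measurable N"
proof -
  have f': "(\<lambda>x. f (fst x) (snd x)) \<in> borel_measurable (N \<Otimes>\<^sub>M (P \<Otimes>\<^sub>M L))"
    using f by (simp add: case_prod_beta')
  note fc = measurable_compose[OF _ f']
  have "(\<lambda>y. f (fst (fst y)) (snd y, snd (fst y))) \<in> borel_measurable ((N \<Otimes>\<^sub>M L) \<Otimes>\<^sub>M P)"
    using fc[of "\<lambda>y. (fst (fst y), snd y, snd (fst y))"] by simp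
  then have "(\<lambda>(s, u). lpn P p (\<lambda>\<omega>. f s (\<omega>, u))) \<in> borel_measurable (N \<Otimes>\<^sub>M L)"
    unfolding case_prod_beta'
    by (intro measurable_lpn fst.sigma_finite_measure_axioms) (simp add: case_prod_beta')
  then show ?thesis
    unfolding lpn2_def by (intro measurable_lpn snd.sigma_finite_measure_axioms)
qed

lemma lpn2_eq_0_iff:
  assumes [measurable]: "f \<in> borel_measurable (P \<Otimes>\<^sub>M L)"
  shows "lpn2 P p L q f = 0 \<longleftrightarrow> (AE z in P \<Otimes>\<^sub>M L. f z = 0)"
proof
  assume "lpn2 P p L q f = 0"
  then have "AE u in L. lpn P p (\<lambda>\<omega>. f (\<omega>, u)) = 0"
    using measurable_inner by (simp add: lpn2_def lpn_eq_0_iff)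
  then have "AE u in L. AE \<omega> in P. f (\<omega>, u) = 0"
    using AE_space by eventually_elim (simp add: lpn_eq_0_iff)
  then have "AE \<omega> in P. AE u in L. f (\<omega>, u) = 0"
    by (subst AE_commute) measurable
  then show "AE z in P \<Otimes>\<^sub>M L. f z = 0"
    by (intro AE_pair_measure) auto
next
  assume "AE z in P \<Otimes>\<^sub>M L. f z = 0"
  then have "lpn2 P p L q f = lpn2 P p L q (\<lambda>_. 0)" by (intro lpn2_cong_AE)
  then show "lpn2 P p L q f = 0" by (simp add: lpn2_def)
qed

end

section \<open>Hilbert--Schmidt operators as a separable Banach space\<close>

text \<open>Distinct orthonormal vectors have distance sqrt 2, so balls of radius 1/2 around them
  are disjoint, and a second countable space contains only countably many disjoint nonempty open
  sets.\<close>

lemma countable_hs_basis: "countable (hs_basis :: 'a::{real_inner,second_countable_topology} set)"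
proof -
  let ?B = "hs_basis :: 'a set"
  have B: "pairwise orthogonal ?B" "\<And>b. b \<in> ?B \<Longrightarrow> norm b = 1"
    using orthonormal_basis_hs_basis by (auto simp: orthonormal_basis_def)
  have far: "1 < dist a b" if "a \<in> ?B" "b \<in> ?B" "a \<noteq> b" for a b
  proof -
    have "a \<bullet> b = 0" using B(1) that by (auto simp: pairwise_def orthogonal_def)
    moreover have "a \<bullet> a = 1" "b \<bullet> b = 1" using B(2) that by (simp_all flip: norm_eq_1)
    ultimately have "(norm (a - b))\<^sup>2 = 2"
      by (simp add: power2_norm_eq_inner inner_diff_left inner_diff_right inner_commute)
    then have "1\<^sup>2 < (norm (a - b))\<^sup>2" by simp
    then show ?thesis using power2_less_imp_less[of 1 "norm (a - b)"] by (simp add: dist_norm)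
  qed
  have dj: "disjoint_family_on (\<lambda>b. ball b (1/2)) ?B"
    unfolding disjoint_family_on_def
  proof (intro ballI impI)
    fix a b assume *: "a \<in> ?B" "b \<in> ?B" "a \<noteq> b"
    show "ball a (1/2) \<inter> ball b (1/2) = {}"
    proof (rule ccontr)
      assume "ball a (1/2) \<inter> ball b (1/2) \<noteq> {}"
      then obtain x where "dist a x < 1/2" "dist b x < 1/2" by auto
      then have "dist a b < 1" using dist_triangle3[of a b x] by (simp add: dist_commute)
      then show False using far[OF *] by simp
    qed
  qed
  have inj: "inj_on (\<lambda>b. ball b (1/2)) ?B"
  proof (rule inj_onI)
    fix a b assume *: "a \<in> ?B" "b \<in> ?B" "ball a (1/2) = ball b (1/2)"
    show "a = b"
    proof (rule ccontr)
      assume "a \<noteq> b"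
      with dj * have "ball a (1/2) \<inter> ball b (1/2) = {}" unfolding disjoint_family_on_def by blast
      then show False using *(3) centre_in_ball[of b "1/2"] by auto
    qed
  qed
  have "countable ((\<lambda>b. ball b (1/2)) ` ?B)"
  proof (rule countable_disjoint_open_subsets)
    show "\<And>S. S \<in> (\<lambda>b. ball b (1/2)) ` ?B \<Longrightarrow> open S" by auto
    show "disjoint ((\<lambda>b. ball b (1/2)) ` ?B)"
      using dj by (rule disjoint_family_on_disjoint_image)
  qed
  then show ?thesis using inj by (rule countable_image_inj_on)
qed

text \<open>Cauchy--Schwarz on the coefficients settles finite combinations of basis vectors; the
  estimate is a closed condition and extends to the closure of the span. It makes evaluation at a
  vector continuous for the Hilbert--Schmidt norm.\<close>

lemma norm_le_hs_norm:
  fixes A :: "'u::{real_inner,second_countable_topology} \<Rightarrow>\<^sub>L 'h::real_inner"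
  assumes A: "hilbert_schmidt A"
  shows "norm A \<le> hs_norm A"
proof -
  have B: "pairwise orthogonal (hs_basis :: 'u set)" "\<And>b::'u. b \<in> hs_basis \<Longrightarrow> norm b = 1"
    using orthonormal_basis_hs_basis by (auto simp: orthonormal_basis_def)
  have "norm (A x) \<le> hs_norm A * norm x" if x: "x \<in> span hs_basis" for x
  proof -
    obtain G c where G: "finite G" "G \<subseteq> hs_basis" and xe: "x = (\<Sum>a\<in>G. c a *\<^sub>R a)"
      using x by (auto simp: span_explicit)
    have "(norm x)\<^sup>2 = (\<Sum>a\<in>G. (norm (c a *\<^sub>R a))\<^sup>2)"
      unfolding xe using G B
      by (intro norm_sum_Pythagorean) (auto simp: pairwise_def orthogonal_def subset_iff)
    also have "\<dots> = (\<Sum>a\<in>G. (c a)\<^sup>2)"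
      using G B by (intro sum.cong) (auto simp: subset_iff power_mult_distrib)
    finally have "L2_set c G = sqrt ((norm x)\<^sup>2)" by (simp add: L2_set_def)
    then have nx: "L2_set c G = norm x" by simp
    have "A x = (\<Sum>a\<in>G. c a *\<^sub>R A a)"
      by (simp add: xe blinfun.sum_right blinfun.scaleR_right)
    then have "norm (A x) \<le> (\<Sum>a\<in>G. \<bar>c a\<bar> * \<bar>norm (A a)\<bar>)"
      using norm_sum[of "\<lambda>a. c a *\<^sub>R A a" G] by simp
    also have "\<dots> \<le> L2_set c G * L2_set (\<lambda>a. norm (A a)) G" by (rule L2_set_mult_ineq)
    also have "\<dots> \<le> norm x * hs_norm A"
      using hs_finite_le[OF A G] by (simp add: nx mult_left_mono)
    finally show ?thesis by (simp add: mult.commute)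
  qed
  then have "span hs_basis \<subseteq> {x. norm (A x) \<le> hs_norm A * norm x}" by auto
  moreover have "closed {x. norm (A x) \<le> hs_norm A * norm x}"
    by (intro closed_Collect_le continuous_intros)
  ultimately have "closure (span hs_basis) \<subseteq> {x. norm (A x) \<le> hs_norm A * norm x}"
    by (rule closure_minimal)
  then have "\<And>x. norm (A x) \<le> hs_norm A * norm x"
    using orthonormal_basis_hs_basis by (auto simp: orthonormal_basis_def)
  then show ?thesis
    by (rule norm_blinfun_bound[rotated]) (simp add: hs_norm_def infsum_nonneg)
qed

section \<open>Completeness and separability of the space of Hilbert--Schmidt operators\<close>

lemma bounded_linear_blinfun_of_hs: "bounded_linear blinfun_of_hs"
proof (rule bounded_linear_intro[where K = 1])
  show "blinfun_of_hs (x + y) = blinfun_of_hs x + blinfun_of_hs y" for x y :: "('a, 'b) hs_op"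
    by transfer simp
  show "blinfun_of_hs (r *\<^sub>R x) = r *\<^sub>R blinfun_of_hs x" for r and x :: "('a, 'b) hs_op"
    by transfer simp
  show "norm (blinfun_of_hs x) \<le> norm x * 1" for x :: "('a, 'b) hs_op"
    by transfer (simp add: norm_le_hs_norm)
qed

lemma bounded_linear_hs_apply: "bounded_linear (\<lambda>A. blinfun_of_hs A u)"
  by (rule bounded_linear_compose[OF blinfun.bounded_linear_left bounded_linear_blinfun_of_hs])

lemma hs_op_eqI: "(\<And>u. blinfun_of_hs A u = blinfun_of_hs B u) \<Longrightarrow> A = B"
  by (simp add: blinfun_of_hs_inject[symmetric] blinfun_eqI)

text \<open>The norm is a supremum over finite parts of the basis, so closed conditions on finitely
  many values pass to it. Completeness uses this along limits; measurability uses that a countable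
  basis has only countably many finite subsets.\<close>

lemma norm_hs_le_iff:
  fixes A :: "('u::{real_inner,second_countable_topology}, 'h::real_inner) hs_op"
  shows "norm A \<le> c \<longleftrightarrow>
    (\<forall>G\<in>{G. finite G \<and> G \<subseteq> hs_basis}. L2_set (\<lambda>e. norm (blinfun_of_hs A e)) G \<le> c)"
proof
  assume "norm A \<le> c"
  then show "\<forall>G\<in>{G. finite G \<and> G \<subseteq> hs_basis}. L2_set (\<lambda>e. norm (blinfun_of_hs A e)) G \<le> c"
    using hs_finite_le[of "blinfun_of_hs A"] blinfun_of_hs[of A]
    by (auto simp: norm_hs_op.rep_eq intro: order_trans)
next
  assume "\<forall>G\<in>{G. finite G \<and> G \<subseteq> hs_basis}. L2_set (\<lambda>e. norm (blinfun_of_hs A e)) G \<le> c"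
  then show "norm A \<le> c"
    unfolding norm_hs_op.rep_eq by (intro hs_boundI(2)) blast
qed

text \<open>A limit A exists in the operator norm. Over a finite \<open>G\<close> the partial sums
  of X m - X n converge to those of X m - A, so the Cauchy bound survives; with bound 1 it shows
  that A is Hilbert--Schmidt, with bound e/2 that X converges to A.\<close>

instance hs_op :: ("{real_inner,second_countable_topology}", "{real_inner,banach}") banach
proof
  fix X :: "nat \<Rightarrow> ('a, 'b) hs_op" assume X: "Cauchy X"
  then have "Cauchy (\<lambda>n. blinfun_of_hs (X n))"
    by (rule bounded_linear.Cauchy[OF bounded_linear_blinfun_of_hs])
  then obtain A where A: "(\<lambda>n. blinfun_of_hs (X n)) \<longlonglongrightarrow> A"
    using Cauchy_convergent convergent_def by blast
  have bound: "hilbert_schmidt (blinfun_of_hs (X m) - A) \<and> hs_norm (blinfun_of_hs (X m) - A) \<le> e"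
    if N: "\<forall>m\<ge>N. \<forall>n\<ge>N. dist (X m) (X n) < e" and m: "m \<ge> N" for N m e
  proof -
    have "L2_set (\<lambda>b. norm ((blinfun_of_hs (X m) - A) b)) G \<le> e"
      if G: "finite G" "G \<subseteq> hs_basis" for G
    proof (rule tendsto_upperbound)
      show "(\<lambda>n. L2_set (\<lambda>b. norm ((blinfun_of_hs (X m) - blinfun_of_hs (X n)) b)) G)
          \<longlonglongrightarrow> L2_set (\<lambda>b. norm ((blinfun_of_hs (X m) - A) b)) G"
        unfolding L2_set_def using A by (intro tendsto_intros)
      show "\<forall>\<^sub>F n in sequentially.
          L2_set (\<lambda>b. norm ((blinfun_of_hs (X m) - blinfun_of_hs (X n)) b)) G \<le> e"
        using eventually_ge_at_top[of N]
      proof eventually_elim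
        case (elim n)
        have "norm (X m - X n) \<le> e" using N m elim by (auto simp: dist_norm less_imp_le)
        then show ?case using G by (auto simp: norm_hs_le_iff minus_hs_op.rep_eq)
      qed
    qed simp
    then show ?thesis using hs_boundI[of "blinfun_of_hs (X m) - A" e] by auto
  qed
  obtain N where "\<forall>m\<ge>N. \<forall>n\<ge>N. dist (X m) (X n) < 1" using X unfolding Cauchy_def by (meson zero_less_one)
  then have "hilbert_schmidt (blinfun_of_hs (X N) - A)" using bound by blast
  then have "hilbert_schmidt (A - blinfun_of_hs (X N))"
    using hs_scaleR(1)[of "blinfun_of_hs (X N) - A" "-1"] by simp
  from hs_add(1)[OF this] have hsA: "hilbert_schmidt A"
    using blinfun_of_hs[of "X N"] by fastforce
  have "X \<longlonglongrightarrow> Hs_op A"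
  proof (rule metric_LIMSEQ_I)
    fix e :: real assume "0 < e"
    then obtain N where N: "\<forall>m\<ge>N. \<forall>n\<ge>N. dist (X m) (X n) < e / 2"
      using X unfolding Cauchy_def by (meson half_gt_zero)
    have "dist (X m) (Hs_op A) < e" if "m \<ge> N" for m
    proof -
      have "norm (X m - Hs_op A) \<le> e / 2"
        using bound[OF N that] hsA by (simp add: norm_hs_op.rep_eq minus_hs_op.rep_eq Hs_op_inverse)
      then show ?thesis using \<open>0 < e\<close> by (simp add: dist_norm)
    qed
    then show "\<exists>N. \<forall>m\<ge>N. dist (X m) (Hs_op A) < e" by blast
  qed
  then show "convergent X" by (auto simp: convergent_def)
qed

text \<open>The operator u \<mapsto> <e,u> h. \<open>to_hs\<close> postpones the proof that it is
  Hilbert--Schmidt to the case where e is a basis vector.\<close>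

definition rank_one :: "'u::{real_inner,second_countable_topology} \<Rightarrow> 'h::real_inner \<Rightarrow> ('u, 'h) hs_op" where
  "rank_one e h = to_hs (blinfun_scaleR_left h o\<^sub>L blinfun_inner_left e)"

lemma blinfun_of_rank_one:
  assumes e: "e \<in> hs_basis" and b: "b \<in> hs_basis"
  shows "blinfun_of_hs (rank_one e h) b = (if b = e then h else 0)"
    and norm_rank_one_le: "norm (rank_one e h) \<le> norm h"
proof -
  let ?A = "blinfun_scaleR_left h o\<^sub>L blinfun_inner_left e"
  have val: "?A b = (if b = e then h else 0)" if "b \<in> hs_basis" for b
    using orthonormal_basis_hs_basis e that
    by (auto simp: orthonormal_basis_def pairwise_def orthogonal_def norm_eq_1)
  have "L2_set (\<lambda>b. norm (?A b)) G \<le> norm h" if G: "finite G" "G \<subseteq> hs_basis" for G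
  proof -
    have "(\<Sum>b\<in>G. (norm (?A b))\<^sup>2) = (\<Sum>b\<in>G. if b = e then (norm h)\<^sup>2 else 0)"
      using G by (intro sum.cong) (auto simp del: blinfun_apply_blinfun_compose simp: val subset_iff)
    also have "\<dots> \<le> (norm h)\<^sup>2" using G by (simp add: sum.delta)
    finally show ?thesis by (simp add: L2_set_def real_le_lsqrt)
  qed
  note hs = hs_boundI[OF this]
  then have r: "blinfun_of_hs (rank_one e h) = ?A"
    by (simp add: rank_one_def to_hs_def Hs_op_inverse hs(1))
  show "blinfun_of_hs (rank_one e h) b = (if b = e then h else 0)"
    unfolding r by (rule val[OF b])
  show "norm (rank_one e h) \<le> norm h"
    unfolding norm_hs_op.rep_eq r by (rule hs(2))
qed

lemma rank_one_diff:
  assumes "e \<in> hs_basis"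
  shows "norm (rank_one e h - rank_one e k) \<le> norm (h - k)"
  unfolding norm_hs_le_iff
proof
  fix G :: "'a set" assume G: "G \<in> {G. finite G \<and> G \<subseteq> hs_basis}"
  have "L2_set (\<lambda>b. norm (blinfun_of_hs (rank_one e h - rank_one e k) b)) G
      = L2_set (\<lambda>b. norm (blinfun_of_hs (rank_one e (h - k)) b)) G"
    using G assms by (intro L2_set_cong)
      (auto simp: minus_hs_op.rep_eq blinfun.diff_left blinfun_of_rank_one subset_iff)
  also have "\<dots> \<le> norm (h - k)"
    using norm_rank_one_le[OF assms assms, of "h - k"] G by (simp add: norm_hs_le_iff)
  finally show "L2_set (\<lambda>b. norm (blinfun_of_hs (rank_one e h - rank_one e k) b)) G \<le> norm (h - k)" .
qed

text \<open>The squared norms |A b|^2 are summable, so some finite \<open>G\<close> leaves a tail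
  below e^2, and this tail is the squared error.\<close>

lemma hs_finite_rank_approx:
  fixes A :: "('u::{real_inner,second_countable_topology}, 'h::real_inner) hs_op"
  assumes e: "0 < e"
  obtains G where "finite G" "G \<subseteq> hs_basis"
    "norm (A - (\<Sum>b\<in>G. rank_one b (blinfun_of_hs A b))) \<le> e"
proof -
  let ?f = "\<lambda>b. (norm (blinfun_of_hs A b))\<^sup>2"
  have sm: "?f summable_on hs_basis"
    using blinfun_of_hs[of A] by (simp add: hilbert_schmidt_def)
  have "\<exists>G. finite G \<and> G \<subseteq> hs_basis \<and> infsum ?f hs_basis - e\<^sup>2 < sum ?f G"
  proof (rule ccontr)
    assume "\<not> ?thesis"
    then have "infsum ?f hs_basis \<le> infsum ?f hs_basis - e\<^sup>2"
      using sm by (intro infsum_le_finite_sums) (auto simp: not_less)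
    then show False using e by simp
  qed
  then obtain G where G: "finite G" "G \<subseteq> hs_basis" "infsum ?f hs_basis - e\<^sup>2 < sum ?f G" by blast
  let ?R = "\<Sum>b\<in>G. rank_one b (blinfun_of_hs A b)"
  have val: "blinfun_of_hs ?R b = (if b \<in> G then blinfun_of_hs A b else 0)" if "b \<in> hs_basis" for b
  proof -
    have "blinfun_of_hs ?R b = (\<Sum>a\<in>G. blinfun_of_hs (rank_one a (blinfun_of_hs A a)) b)"
      by (rule linear_sum[OF bounded_linear.linear[OF bounded_linear_hs_apply]])
    also have "\<dots> = (\<Sum>a\<in>G. if b = a then blinfun_of_hs A a else 0)"
      using G that by (intro sum.cong) (auto simp: blinfun_of_rank_one subset_iff)
    finally show ?thesis using G by simp
  qed
  have "norm (A - ?R) \<le> e"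
    unfolding norm_hs_le_iff
  proof
    fix F assume "F \<in> {G. finite G \<and> G \<subseteq> (hs_basis :: 'u set)}"
    then have F: "finite F" "F \<subseteq> hs_basis" by auto
    have "(\<Sum>b\<in>F. (norm (blinfun_of_hs (A - ?R) b))\<^sup>2) = (\<Sum>b\<in>F. if b \<in> G then 0 else ?f b)"
      using F by (intro sum.cong) (auto simp: minus_hs_op.rep_eq blinfun.diff_left val subset_iff)
    also have "\<dots> = sum ?f (F - G)"
      using F by (simp add: sum.If_cases Diff_eq)
    also have "\<dots> = sum ?f (F \<union> G) - sum ?f G"
      using F G by (simp add: sum_Un_eq[symmetric] sum_diff[symmetric] Un_Diff)
    also have "sum ?f (F \<union> G) \<le> infsum ?f hs_basis"
      using F G sm by (intro finite_sum_le_infsum) auto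
    finally have "(\<Sum>b\<in>F. (norm (blinfun_of_hs (A - ?R) b))\<^sup>2) \<le> e\<^sup>2" using G by simp
    then show "L2_set (\<lambda>b. norm (blinfun_of_hs (A - ?R) b)) F \<le> e"
      using e by (simp add: L2_set_def real_le_lsqrt)
  qed
  then show ?thesis using that G by blast
qed

lemma ex_countable_basisI:
  fixes D :: "'a::metric_space set"
  assumes D: "countable D" "\<And>x e. 0 < e \<Longrightarrow> \<exists>d\<in>D. dist d x < e"
  shows "\<exists>B::'a set set. countable B \<and> open = generate_topology B"
proof -
  define B where "B = (\<lambda>(d, n). ball d (1 / real (Suc n))) ` (D \<times> UNIV)"
  have "topological_basis B"
  proof (rule topological_basisI)
    fix U :: "'a set" and x assume "open U" "x \<in> U"
    then obtain e where e: "0 < e" "ball x e \<subseteq> U" using openE by blast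
    obtain n where n: "1 / real (Suc n) < e / 2" using nat_approx_posE[of "e / 2"] e by auto
    obtain d where d: "d \<in> D" "dist d x < 1 / real (Suc n)" using D(2)[of "1 / real (Suc n)" x] by auto
    have "ball d (1 / real (Suc n)) \<subseteq> ball x e"
    proof
      fix y assume "y \<in> ball d (1 / real (Suc n))"
      then show "y \<in> ball x e" using d n dist_triangle[of x y d] by (simp add: dist_commute)
    qed
    then show "\<exists>V\<in>B. x \<in> V \<and> V \<subseteq> U" using d e by (auto simp: B_def)
  qed (auto simp: B_def)
  moreover have "countable B" using D(1) by (simp add: B_def)
  ultimately show ?thesis
    using topological_basis_imp_subbasis by blast
qed

text \<open>Finite sums of rank-one operators, with basis vectors and with values in a countable
  dense set, are dense; lists index them countably. Measurability of sums, Bochner integrals and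
  approximation by simple functions rest on this instance.\<close>

instance hs_op :: ("{real_inner,second_countable_topology}", "{real_inner,second_countable_topology}")
  second_countable_topology
proof
  obtain C :: "'b set" where C: "countable C" "\<And>X. open X \<Longrightarrow> X \<noteq> {} \<Longrightarrow> \<exists>d\<in>C. d \<in> X"
    using countable_dense_exists by blast
  define r where "r l = sum_list (map (\<lambda>(e, h). rank_one e h) l)" for l :: "('a \<times> 'b) list"
  define D where "D = r ` lists (hs_basis \<times> C)"
  define K where "K = {A. \<forall>e>0. \<exists>d\<in>D. dist d A < e}"
  have K0: "0 \<in> K"
    by (force simp: K_def D_def r_def intro: bexI[of _ "[]"])
  have K_add: "A + A' \<in> K" if "A \<in> K" "A' \<in> K" for A A'
    unfolding K_def mem_Collect_eq
  proof (intro allI impI)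
    fix e :: real assume "0 < e"
    then have e2: "0 < e / 2" by simp
    obtain l where l: "l \<in> lists (hs_basis \<times> C)" "dist (r l) A < e / 2"
      using \<open>A \<in> K\<close> e2 unfolding K_def D_def by blast
    obtain l' where l': "l' \<in> lists (hs_basis \<times> C)" "dist (r l') A' < e / 2"
      using \<open>A' \<in> K\<close> e2 unfolding K_def D_def by blast
    have "r (l @ l') = r l + r l'" by (simp add: r_def)
    then have "dist (r (l @ l')) (A + A') < e"
      using dist_triangle_add[of "r l" "r l'" A A'] l l' by simp
    moreover have "l @ l' \<in> lists (hs_basis \<times> C)" using l l' by auto
    ultimately show "\<exists>d\<in>D. dist d (A + A') < e" unfolding D_def by blast
  qed
  have K_rank: "rank_one b h \<in> K" if b: "b \<in> hs_basis" for b h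
    unfolding K_def mem_Collect_eq
  proof (intro allI impI)
    fix e :: real assume "0 < e"
    then obtain k where k: "k \<in> C" "dist h k < e" using C(2)[of "ball h e"] by auto
    have "dist (r [(b, k)]) (rank_one b h) < e"
      using rank_one_diff[OF b, of k h] k by (simp add: r_def dist_norm norm_minus_commute)
    moreover have "[(b, k)] \<in> lists (hs_basis \<times> C)" using b k by auto
    ultimately show "\<exists>d\<in>D. dist d (rank_one b h) < e" unfolding D_def by blast
  qed
  have K_sum: "(\<Sum>b\<in>G. rank_one b (f b)) \<in> K" if "finite G" "G \<subseteq> hs_basis" for G f
    using that by (induction G rule: finite_induct) (auto intro: K0 K_add K_rank)
  have dense: "\<exists>d\<in>D. dist d A < e" if "0 < e" for A and e :: real
  proof -
    obtain G where G: "finite G" "G \<subseteq> hs_basis"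
      "norm (A - (\<Sum>b\<in>G. rank_one b (blinfun_of_hs A b))) \<le> e / 2"
      using hs_finite_rank_approx[of "e / 2" A] \<open>0 < e\<close> by auto
    obtain d where d: "d \<in> D" "dist d (\<Sum>b\<in>G. rank_one b (blinfun_of_hs A b)) < e / 2"
      using K_sum[OF G(1,2), of "blinfun_of_hs A"] \<open>0 < e\<close>
      unfolding K_def mem_Collect_eq by (meson half_gt_zero)
    have "dist d A < e"
      using dist_triangle[of d A "\<Sum>b\<in>G. rank_one b (blinfun_of_hs A b)"] d G(3)
      by (simp add: dist_norm norm_minus_commute)
    then show ?thesis using d by blast
  qed
  have "countable D"
    unfolding D_def using C(1) countable_hs_basis
    by (intro countable_image countable_lists countable_SIGMA)
  then show "\<exists>B::('a, 'b) hs_op set set. countable B \<and> open = generate_topology B"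
    using dense by (rule ex_countable_basisI)
qed

text \<open>An open set is a countable union of balls, so the distances to fixed points
  decide.\<close>

lemma borel_measurable_distI:
  fixes f :: "'a \<Rightarrow> 'b::{metric_space, second_countable_topology}"
  assumes f: "\<And>a. (\<lambda>x. dist (f x) a) \<in> borel_measurable M"
  shows "f \<in> borel_measurable M"
proof (rule borel_measurableI)
  fix U :: "'b set" assume "open U"
  obtain D :: "'b set" where D: "topological_basis (case_prod ball ` (D \<times> (\<rat> \<inter> {0<..})))" "countable D"
    by (rule balls_countable_basis)
  obtain V where V: "V \<subseteq> case_prod ball ` (D \<times> (\<rat> \<inter> {0<..}))" "\<Union>V = U"
    using \<open>open U\<close> D(1) by (auto simp: topological_basis_def)
  have "countable V"
    by (rule countable_subset[OF V(1)]) (use D(2) countable_rat in auto)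
  moreover have "f -` B \<inter> space M \<in> sets M" if "B \<in> V" for B
  proof -
    obtain d e where "B = ball d e" using V(1) \<open>B \<in> V\<close> by auto
    then have "f -` B \<inter> space M = {x \<in> space M. dist (f x) d < e}" by (auto simp: dist_commute)
    then show ?thesis using f[of d] by simp
  qed
  ultimately have "(\<Union>B\<in>V. f -` B \<inter> space M) \<in> sets M" by (intro sets.countable_UN') auto
  then show "f -` U \<inter> space M \<in> sets M" using V(2) by (simp add: vimage_Union flip: V(2))
qed

section \<open>Measurability with respect to the Hilbert--Schmidt norm\<close>

lemma countable_finite_subsets_hs_basis:
  "countable {G. finite G \<and> G \<subseteq> (hs_basis :: 'a::{real_inner,second_countable_topology} set)}"
  by (rule countable_Collect_finite_subset[OF countable_hs_basis])

text \<open>The distance to a fixed operator is a supremum over countably many finite parts of the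
  basis, each depending on finitely many values at basis vectors. Strong measurability thus gives
  Borel measurability for the Hilbert--Schmidt norm.\<close>

lemma borel_measurable_hs_opI:
  fixes f :: "'a \<Rightarrow> ('u::{real_inner,second_countable_topology},
    'h::{real_inner,second_countable_topology}) hs_op"
  assumes f: "\<And>e. e \<in> hs_basis \<Longrightarrow> (\<lambda>x. blinfun_of_hs (f x) e) \<in> borel_measurable M"
  shows "f \<in> borel_measurable M"
proof (rule borel_measurable_distI)
  fix A :: "('u, 'h) hs_op"
  have "{x \<in> space M. dist (f x) A \<le> c} \<in> sets M" for c
  proof -
    have "{x \<in> space M. dist (f x) A \<le> c} = {x \<in> space M. \<forall>G\<in>{G. finite G \<and> G \<subseteq> hs_basis}.
        L2_set (\<lambda>e. norm (blinfun_of_hs (f x) e - blinfun_of_hs A e)) G \<le> c}"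
      by (simp add: dist_norm norm_hs_le_iff minus_hs_op.rep_eq blinfun.diff_left)
    also have "\<dots> = (\<Inter>G\<in>{G. finite G \<and> G \<subseteq> hs_basis}.
        {x \<in> space M. L2_set (\<lambda>e. norm (blinfun_of_hs (f x) e - blinfun_of_hs A e)) G \<le> c})"
      by auto
    also have "\<dots> \<in> sets M"
    proof (rule sets.countable_INT'[OF countable_finite_subsets_hs_basis])
      show "(\<lambda>G. {x \<in> space M. L2_set (\<lambda>e. norm (blinfun_of_hs (f x) e - blinfun_of_hs A e)) G \<le> c})
          ` {G. finite G \<and> G \<subseteq> hs_basis} \<subseteq> sets M"
      proof (rule image_subsetI)
        fix G assume "G \<in> {G. finite G \<and> G \<subseteq> (hs_basis :: 'u set)}"
        then have "(\<lambda>x. blinfun_of_hs (f x) e) \<in> borel_measurable M" if "e \<in> G" for e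
          using f that by auto
        then have "(\<lambda>x. L2_set (\<lambda>e. norm (blinfun_of_hs (f x) e - blinfun_of_hs A e)) G)
            \<in> borel_measurable M"
          unfolding L2_set_def by measurable
        then show "{x \<in> space M. L2_set (\<lambda>e. norm (blinfun_of_hs (f x) e - blinfun_of_hs A e)) G \<le> c}
            \<in> sets M"
          by measurable
      qed
    qed auto
    finally show ?thesis .
  qed
  then show "(\<lambda>x. dist (f x) A) \<in> borel_measurable M" by (simp add: borel_measurable_iff_le)
qed

text \<open>If A is not Hilbert--Schmidt, a finite supremum would contradict
  \<open>hs_boundI\<close>, so both sides are infinite. The right side is a countable supremum,
  whence \<open>measurable_hs_enorm\<close>.\<close>

lemma hs_enorm_SUP:
  "hs_enorm A = (SUP G\<in>{G. finite G \<and> G \<subseteq> hs_basis}. ennreal (L2_set (\<lambda>e. norm (A e)) G))"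
proof (cases "hilbert_schmidt A")
  case True
  show ?thesis
  proof (rule antisym)
    show "hs_enorm A \<le> (SUP G\<in>{G. finite G \<and> G \<subseteq> hs_basis}. ennreal (L2_set (\<lambda>e. norm (A e)) G))"
      (is "_ \<le> ?S")
    proof (cases ?S)
      case (real c)
      have "L2_set (\<lambda>e. norm (A e)) G \<le> c" if "finite G" "G \<subseteq> hs_basis" for G
      proof -
        have "ennreal (L2_set (\<lambda>e. norm (A e)) G) \<le> ?S" using that by (intro SUP_upper) auto
        then show ?thesis using real by simp
      qed
      then have "hs_norm A \<le> c" by (rule hs_boundI)
      then show ?thesis using True real by (simp add: hs_enorm_def ennreal_leI)
    qed (simp only: top_greatest)
    show "?S \<le> hs_enorm A"
      using True hs_finite_le[OF True] by (intro SUP_least) (auto simp: hs_enorm_def ennreal_leI)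
  qed
next
  case False
  show ?thesis
  proof (cases "SUP G\<in>{G. finite G \<and> G \<subseteq> hs_basis}. ennreal (L2_set (\<lambda>e. norm (A e)) G)")
    case (real c)
    have "L2_set (\<lambda>e. norm (A e)) G \<le> c" if "finite G" "G \<subseteq> hs_basis" for G
    proof -
      have "ennreal (L2_set (\<lambda>e. norm (A e)) G) \<le> ennreal c"
        unfolding real(2)[symmetric] using that by (intro SUP_upper) auto
      then show ?thesis using real by simp
    qed
    then have "hilbert_schmidt A" by (rule hs_boundI)
    then show ?thesis using False by simp
  next
    case top
    then show ?thesis unfolding top using False by (simp add: hs_enorm_def)
  qed
qed

section \<open>Algebra of \<open>hs_enorm\<close>, \<open>to_hs\<close> and
  \<open>hs_compose\<close>\<close>

lemma hs_enorm_less_top_iff: "hs_enorm A < \<top> \<longleftrightarrow> hilbert_schmidt A"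
  by (simp add: hs_enorm_def)

lemma norm_to_hs_le: "ennreal (norm (to_hs A)) \<le> hs_enorm A"
  by (simp add: to_hs_def hs_enorm_def norm_hs_op.rep_eq Hs_op_inverse)

lemma blinfun_of_to_hs: "hilbert_schmidt A \<Longrightarrow> blinfun_of_hs (to_hs A) = A"
  by (simp add: to_hs_def Hs_op_inverse)

lemma hs_enorm_add: "hs_enorm (A + B) \<le> hs_enorm A + hs_enorm B"
  using hs_add[of A B] by (auto simp: hs_enorm_def hs_norm_def infsum_nonneg simp flip: ennreal_plus)

lemma hs_enorm_scaleR: "hs_enorm (c *\<^sub>R A) = ennreal \<bar>c\<bar> * hs_enorm A"
proof (cases "hilbert_schmidt A \<or> c = 0")
  case True
  then show ?thesis using hs_scaleR[of A c]
    by (auto simp: hs_enorm_def hs_zero ennreal_mult' hs_norm_def infsum_nonneg)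
next
  case False
  then have "\<not> hilbert_schmidt (c *\<^sub>R A)"
    using hs_scaleR(1)[of "c *\<^sub>R A" "inverse c"] by auto
  then show ?thesis using False by (simp add: hs_enorm_def ennreal_mult_top)
qed

lemma to_hs_add: "hilbert_schmidt A \<Longrightarrow> hilbert_schmidt B \<Longrightarrow> to_hs (A + B) = to_hs A + to_hs B"
  by (intro hs_op_eqI) (simp add: blinfun_of_to_hs hs_add plus_hs_op.rep_eq)

lemma to_hs_scaleR: "hilbert_schmidt A \<Longrightarrow> to_hs (c *\<^sub>R A) = c *\<^sub>R to_hs A"
  by (intro hs_op_eqI) (simp add: blinfun_of_to_hs hs_scaleR scaleR_hs_op.rep_eq)

lemma to_hs_compose: "hilbert_schmidt A \<Longrightarrow> to_hs (Q o\<^sub>L A) = hs_compose Q (to_hs A)"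
  by (intro hs_op_eqI) (simp add: blinfun_of_to_hs hs_compose_left hs_compose.rep_eq)

lemma norm_hs_compose: "norm (hs_compose Q A) \<le> norm Q * norm A"
  unfolding norm_hs_le_iff
proof
  fix G :: "'a set" assume G: "G \<in> {G. finite G \<and> G \<subseteq> hs_basis}"
  have "L2_set (\<lambda>e. norm (blinfun_of_hs (hs_compose Q A) e)) G
      \<le> L2_set (\<lambda>e. norm Q * norm (blinfun_of_hs A e)) G"
    by (rule L2_set_mono) (auto simp: norm_blinfun hs_compose.rep_eq)
  also have "\<dots> = norm Q * L2_set (\<lambda>e. norm (blinfun_of_hs A e)) G"
    by (simp add: L2_set_right_distrib)
  also have "\<dots> \<le> norm Q * norm A"
    using G norm_hs_le_iff[of A "norm A"] by (simp add: mult_left_mono)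
  finally show "L2_set (\<lambda>e. norm (blinfun_of_hs (hs_compose Q A) e)) G \<le> norm Q * norm A" .
qed

lemma bounded_linear_hs_compose: "bounded_linear (hs_compose Q)"
proof (rule bounded_linear_intro[where K = "norm Q"])
  show "hs_compose Q (x + y) = hs_compose Q x + hs_compose Q y" for x y
    by (intro hs_op_eqI) (simp add: hs_compose.rep_eq plus_hs_op.rep_eq blinfun.add_left blinfun.add_right)
  show "hs_compose Q (r *\<^sub>R x) = r *\<^sub>R hs_compose Q x" for r x
    by (intro hs_op_eqI)
      (simp add: hs_compose.rep_eq scaleR_hs_op.rep_eq blinfun.scaleR_left blinfun.scaleR_right)
  show "norm (hs_compose Q x) \<le> norm x * norm Q" for x
    using norm_hs_compose[of Q x] by (simp add: mult.commute)
qed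

lemma measurable_hs_enorm:
  fixes A :: "'a \<Rightarrow> 'u::{real_inner,second_countable_topology}
    \<Rightarrow>\<^sub>L 'h::{real_inner,second_countable_topology}"
  assumes A: "\<And>e. (\<lambda>x. A x e) \<in> borel_measurable M"
  shows "(\<lambda>x. hs_enorm (A x)) \<in> borel_measurable M"
  unfolding hs_enorm_SUP
proof (rule borel_measurable_SUP[OF countable_finite_subsets_hs_basis])
  fix G
  have [measurable]: "(\<lambda>x. A x e) \<in> borel_measurable M" for e by (rule A)
  show "(\<lambda>x. ennreal (L2_set (\<lambda>e. norm (A x e)) G)) \<in> borel_measurable M"
    unfolding L2_set_def by measurable
qed

text \<open>The points where \<open>A x\<close> is Hilbert--Schmidt are those with finite
  \<open>hs_enorm\<close>, a measurable set; elsewhere \<open>to_hs\<close> is 0.\<close>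

lemma measurable_to_hs:
  fixes A :: "'a \<Rightarrow> 'u::{real_inner,second_countable_topology}
    \<Rightarrow>\<^sub>L 'h::{real_inner,second_countable_topology}"
  assumes A: "\<And>e. (\<lambda>x. A x e) \<in> borel_measurable M"
  shows "(\<lambda>x. to_hs (A x)) \<in> borel_measurable M"
proof (rule borel_measurable_hs_opI)
  fix e
  have [measurable]: "(\<lambda>x. A x e) \<in> borel_measurable M" by (rule A)
  have [measurable]: "(\<lambda>x. hs_enorm (A x)) \<in> borel_measurable M" by (rule measurable_hs_enorm[OF A])
  have "(\<lambda>x. blinfun_of_hs (to_hs (A x)) e) = (\<lambda>x. if hs_enorm (A x) < \<top> then A x e else 0)"
    by (rule ext) (simp add: hs_enorm_less_top_iff to_hs_def zero_hs_op.rep_eq Hs_op_inverse)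
  then show "(\<lambda>x. blinfun_of_hs (to_hs (A x)) e) \<in> borel_measurable M" by simp
qed

lemma blinfun_compose_assoc: "(A o\<^sub>L B) o\<^sub>L C = A o\<^sub>L (B o\<^sub>L C)"
  by (rule blinfun_eqI) simp

lemma blinfun_compose_add_right: "A o\<^sub>L (B + C) = (A o\<^sub>L B) + (A o\<^sub>L C)"
  by (rule blinfun_eqI) (simp add: blinfun.add_left blinfun.add_right)

lemma blinfun_compose_scaleR_right: "A o\<^sub>L (c *\<^sub>R B) = c *\<^sub>R (A o\<^sub>L B)"
  by (rule blinfun_eqI) (simp add: blinfun.scaleR_left blinfun.scaleR_right)

text \<open>By Baire's theorem one of the closed sets \<open>A n\<close> contains a ball. Applied to
  the operators S(t), t in [0,T], it makes M a genuine supremum.\<close>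

lemma uniform_boundedness:
  fixes f :: "'i \<Rightarrow> 'a::banach \<Rightarrow>\<^sub>L 'b::real_normed_vector"
  assumes pw: "\<And>x. \<exists>B. \<forall>i\<in>J. norm (f i x) \<le> B"
  shows "\<exists>B. \<forall>i\<in>J. norm (f i) \<le> B"
proof -
  define A where "A n = {x. \<forall>i\<in>J. norm (f i x) \<le> real n}" for n
  have closed: "closed (A n)" for n
  proof -
    have "A n = (\<Inter>i\<in>J. {x. norm (f i x) \<le> real n})" by (auto simp: A_def)
    then show ?thesis by (auto intro!: closed_INT closed_Collect_le continuous_intros)
  qed
  have cover: "(\<Union>n. A n) = UNIV"
  proof (intro equalityI subsetI UNIV_I)
    fix x
    obtain B where "\<forall>i\<in>J. norm (f i x) \<le> B" using pw by blast
    then have "x \<in> A (nat \<lceil>B\<rceil>)" unfolding A_def using of_nat_ceiling order_trans by fastforce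
    then show "x \<in> (\<Union>n. A n)" by blast
  qed
  have "\<exists>n. interior (A n) \<noteq> {}"
  proof (rule ccontr)
    assume *: "\<not> ?thesis"
    have "Met_TC.mcomplete TYPE('a)"
      by (auto simp: Met_TC.mcomplete_def intro: Cauchy_convergent simp flip: convergent_def)
    then have "Met_TC.mtopology interior_of \<Union>(range A) = {}"
      by (rule Met_TC.metric_Baire_category_alt) (use * closed in \<open>auto simp: \<close>)
    then show False by (simp add: cover)
  qed
  then obtain n x e where e: "0 < e" "ball x e \<subseteq> A n"
    by (metis equals0I mem_interior)
  \<comment> \<open>A vector z of norm e/2 is the difference of x + z and x, both in
    \<open>A n\<close>; this accounts for 2n and for e/2.\<close>
  have "norm (f i) \<le> 2 * real n / (e / 2)" if "i \<in> J" for i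
  proof (rule norm_blinfun_bound)
    show "norm (f i y) \<le> 2 * real n / (e / 2) * norm y" for y
    proof (cases "y = 0")
      case False
      define z where "z = (e / 2 / norm y) *\<^sub>R y"
      have "norm z = e / 2" using e False by (simp add: z_def)
      then have "x + z \<in> ball x e" "x \<in> ball x e" using e by (auto simp: dist_norm)
      then have "x + z \<in> A n" "x \<in> A n" using e(2) by blast+
      then have "norm (f i (x + z)) \<le> n" "norm (f i x) \<le> n" using that by (auto simp: A_def)
      then have "norm (f i (x + z) - f i x) \<le> 2 * n" using norm_triangle_ineq4[of "f i (x + z)" "f i x"] by simp
      then have "norm (f i z) \<le> 2 * n" by (simp add: blinfun.add_right)
      then show ?thesis using e False by (simp add: z_def blinfun.scaleR_right field_simps)
    qed simp
  qed (use e in auto)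
  then show ?thesis by blast
qed

section \<open>Paths and predictable processes\<close>

text \<open>One countable dense set of times, fixed once: for continuous paths it replaces
  uncountable suprema and intersections over [0,T], which need not be measurable, by countable
  ones.\<close>

definition time_dense :: "real \<Rightarrow> real set" where
  "time_dense T = (SOME D. countable D \<and> D \<subseteq> {0..T} \<and> {0..T} \<subseteq> closure D)"

lemma time_dense:
  "countable (time_dense T)" "time_dense T \<subseteq> {0..T}" "{0..T} \<subseteq> closure (time_dense T)"
proof -
  have "\<exists>D. countable D \<and> D \<subseteq> {0..T} \<and> {0..T} \<subseteq> closure D"
    using separable[of "{0..T}"] by metis
  then have "countable (time_dense T) \<and> time_dense T \<subseteq> {0..T} \<and> {0..T} \<subseteq> closure (time_dense T)"
    unfolding time_dense_def by (rule someI_ex)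
  then show "countable (time_dense T)" "time_dense T \<subseteq> {0..T}" "{0..T} \<subseteq> closure (time_dense T)"
    by auto
qed

lemma time_dense_extend:
  fixes f :: "real \<Rightarrow> 'a::t2_space"
  assumes f: "continuous_on {0..T} f" and U: "closed U"
    and D: "\<And>t. t \<in> time_dense T \<Longrightarrow> f t \<in> U" and t: "t \<in> {0..T}"
  shows "f t \<in> U"
proof -
  have "closed ({0..T} \<inter> f -` U)"
    using f U by (intro continuous_closed_preimage) auto
  moreover have "time_dense T \<subseteq> {0..T} \<inter> f -` U" using D time_dense(2) by auto
  ultimately have "closure (time_dense T) \<subseteq> {0..T} \<inter> f -` U" by (rule closure_minimal[rotated])
  then show ?thesis using time_dense(3)[of T] t by blast
qed

lemma SUP_time_dense:
  fixes f :: "real \<Rightarrow> 'a::real_normed_vector"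
  assumes f: "continuous_on {0..T} f"
  shows "(SUP t\<in>{0..T}. ennreal (norm (f t))) = (SUP t\<in>time_dense T. ennreal (norm (f t)))"
proof (rule antisym)
  have c: "continuous_on {0..T} (\<lambda>t. ennreal (norm (f t)))"
    using f by (intro continuous_on_ennreal continuous_on_norm)
  have "ennreal (norm (f t)) \<in> {..SUP t\<in>time_dense T. ennreal (norm (f t))}" if "t \<in> {0..T}" for t
    by (rule time_dense_extend[OF c closed_atMost _ that]) (auto intro: SUP_upper)
  then show "(SUP t\<in>{0..T}. ennreal (norm (f t))) \<le> (SUP t\<in>time_dense T. ennreal (norm (f t)))"
    by (intro SUP_least) auto
qed (use time_dense(2) in \<open>auto intro!: SUP_subset_mono\<close>)

lemma restrict_in_path_space_iff:
  "restrict f {0..T} \<in> mspace (path_space T) \<longleftrightarrow> continuous_on {0..T} f"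
  (is "?l \<longleftrightarrow> ?r")
proof
  assume ?l
  then have "continuous_on {0..T} (restrict f {0..T})" by (simp add: path_space_def)
  then show ?r by (subst continuous_on_cong) auto
next
  assume ?r
  then have c: "continuous_on {0..T} (restrict f {0..T})" by (subst continuous_on_cong) auto
  then have "bounded (restrict f {0..T} ` {0..T})"
    by (intro compact_imp_bounded compact_continuous_image) auto
  with c show ?l by (simp add: path_space_def restrict_def extensional_def)
qed

lemma mspace_path_spaceD: "f \<in> mspace (path_space T) \<Longrightarrow> continuous_on {0..T} f"
  by (simp add: path_space_def)

lemma mdist_path_space_le:
  assumes "0 \<le> T" "f \<in> mspace (path_space T)" "g \<in> mspace (path_space T)"
  shows "mdist (path_space T) f g \<le> a \<longleftrightarrow> (\<forall>t\<in>{0..T}. dist (f t) (g t) \<le> a)"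
  using assms cfunspace_mdist_le[of f "top_of_set {0..T}" euclidean_metric g a]
  by (simp add: path_space_def)

text \<open>By uniform continuity the values on a fine grid determine a path up to a small error,
  and they are approximated from a countable dense subset of H. The dense paths are picked inside
  \<open>A\<close>, as separability of a subspace demands.\<close>

lemma path_space_dense_subset:
  fixes A :: "(real \<Rightarrow> 'h::{real_normed_vector,second_countable_topology}) set"
  assumes T: "0 < T" and A: "A \<subseteq> mspace (path_space T)"
  obtains D where "countable D" "D \<subseteq> A" "\<And>f e. f \<in> A \<Longrightarrow> 0 < e \<Longrightarrow> \<exists>g\<in>D. mdist (path_space T) f g < e"
proof -
  obtain C :: "'h set" where C: "countable C" "\<And>X. open X \<Longrightarrow> X \<noteq> {} \<Longrightarrow> \<exists>d\<in>C. d \<in> X"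
    using countable_dense_exists by blast
  define osc :: "real \<Rightarrow> real \<Rightarrow> (real \<Rightarrow> 'h) \<Rightarrow> bool" where
    "osc d e f \<longleftrightarrow> (\<forall>s\<in>{0..T}. \<forall>t\<in>{0..T}. \<bar>s - t\<bar> \<le> d \<longrightarrow> dist (f s) (f t) < e)" for d e f
  \<comment> \<open>One function is picked for every resolution \<open>1/k\<close>, mesh \<open>T/n\<close> and list of approximate grid values.\<close>
  define K where "K = (\<lambda>(k::nat, n::nat, l::'h list) f. f \<in> A \<and> osc (T / n) (1 / k) f \<and>
    length l = Suc n \<and> (\<forall>i\<le>n. dist (f (T * i / n)) (l ! i) < 1 / k))"
  define D where "D = (\<lambda>x. SOME f. K x f) ` {x \<in> UNIV \<times> UNIV \<times> lists C. \<exists>f. K x f}"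
  have "countable (UNIV \<times> UNIV \<times> lists C :: (nat \<times> nat \<times> 'h list) set)"
    using C(1) by (intro countable_SIGMA countable_lists) auto
  then have "countable D" unfolding D_def by (intro countable_image countable_Collect) auto
  moreover have "D \<subseteq> A"
  proof
    fix g assume "g \<in> D"
    then obtain x where "g = (SOME f. K x f)" "\<exists>f. K x f" by (auto simp: D_def)
    then have "K x g" by (metis someI_ex)
    then show "g \<in> A" by (auto simp: K_def)
  qed
  moreover have "\<exists>g\<in>D. mdist (path_space T) f g < e" if f: "f \<in> A" and e: "0 < e" for f e
  proof -
    \<comment> \<open>Four errors of size 1/k will be added, hence e/5.\<close>
    obtain k :: nat where k: "0 < k" "1 / real k < e / 5"
      using nat_approx_posE[of "e / 5"] e by (metis divide_pos_pos zero_less_Suc zero_less_numeral)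
    have "uniformly_continuous_on {0..T} f"
      using A f by (intro compact_uniformly_continuous mspace_path_spaceD) auto
    then obtain d where d: "0 < d"
      "\<And>s t. s \<in> {0..T} \<Longrightarrow> t \<in> {0..T} \<Longrightarrow> dist s t < d \<Longrightarrow> dist (f s) (f t) < 1 / k"
      unfolding uniformly_continuous_on_def using k(1) by (metis dist_commute of_nat_0_less_iff zero_less_divide_1_iff)
    obtain n where n: "0 < n" "1 / real n < d / T"
      using nat_approx_posE[of "d / T"] d T by (metis divide_pos_pos zero_less_Suc)
    have nd: "T / n < d" using n T by (simp add: field_simps)
    have osc_f: "osc (T / n) (1 / k) f" using d(2) nd by (auto simp: osc_def dist_real_def)
    have "\<exists>c\<in>C. dist (f (T * i / n)) c < 1 / k" for i :: nat
      using C(2)[of "ball (f (T * i / n)) (1 / k)"] k(1) by auto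
    then obtain c where c: "\<And>i. c i \<in> C" "\<And>i::nat. dist (f (T * i / n)) (c i) < 1 / k" by metis
    define l where "l = map c [0..<Suc n]"
    have l: "l \<in> lists C" "length l = Suc n" "\<And>i. i \<le> n \<Longrightarrow> l ! i = c i"
      using c(1) by (auto simp: l_def simp del: upt_Suc)
    have Kf: "K (k, n, l) f" using f osc_f l c(2) by (simp add: K_def)
    define g where "g = (SOME f. K (k, n, l) f)"
    have Kg: "K (k, n, l) g" unfolding g_def by (rule someI[of "K (k, n, l)", OF Kf])
    have gD: "g \<in> D" unfolding D_def g_def using Kf l by (intro imageI) auto
    have "dist (f t) (g t) \<le> 4 / k" if t: "t \<in> {0..T}" for t
    proof -
      define i where "i = nat \<lfloor>t * n / T\<rfloor>"
      have i: "real i \<le> t * n / T" "t * n / T < real i + 1"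
        using t T by (auto simp: i_def of_nat_nat floor_le_iff)
      have "t * n / T \<le> n" using t T n by (simp add: field_simps mult_right_mono)
      then have "i \<le> n" using i by linarith
      have ti: "T * i / n \<in> {0..T}" using \<open>i \<le> n\<close> n T by (simp add: field_simps)
      have "T * i / n \<le> t" using i(1) n T by (simp add: field_simps)
      moreover have "t \<le> T * i / n + T / n" using i(2) n T by (simp add: field_simps)
      ultimately have near: "\<bar>t - T * i / n\<bar> \<le> T / n" by linarith
      \<comment> \<open>Each of f and g oscillates by less than 1/k between t and the grid point,
        and both lie within 1/k of the common value \<open>c i\<close>.\<close>
      have "dist (f t) (f (T * i / n)) < 1 / k" "dist (g t) (g (T * i / n)) < 1 / k"
        using osc_f Kg near t ti unfolding K_def osc_def by auto
      moreover have "dist (f (T * i / n)) (c i) < 1 / k" by (rule c(2))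
      moreover have "dist (g (T * i / n)) (c i) < 1 / k"
        using Kg \<open>i \<le> n\<close> l(3) by (auto simp: K_def)
      moreover have "dist (f t) (g t) \<le> dist (f t) (f (T * i / n)) + (dist (f (T * i / n)) (c i)
          + (dist (g (T * i / n)) (c i) + dist (g t) (g (T * i / n))))"
        by (smt (verit, best) dist_commute dist_triangle)
      ultimately have "dist (f t) (g t) \<le> 1 / k + (1 / k + (1 / k + 1 / k))" by linarith
      then show ?thesis by simp
    qed
    then have "mdist (path_space T) f g \<le> 4 / k"
      using A f Kg T by (subst mdist_path_space_le) (auto simp: K_def)
    also have "\<dots> < e" using k e by (simp add: field_simps)
    finally show ?thesis using gD by blast
  qed
  ultimately show thesis by (rule that)
qed

text \<open>This makes the separable-range clause of \<open>Lr_path_space\<close> automatic.\<close>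

lemma separable_path_subspace:
  fixes A :: "(real \<Rightarrow> 'h::{real_normed_vector,second_countable_topology}) set"
  assumes T: "0 < T" and A: "A \<subseteq> mspace (path_space T)"
  shows "separable_space (subtopology (mtopology_of (path_space T)) A)"
proof -
  interpret m: Metric_space "mspace (path_space T)" "mdist (path_space T)"
    by (rule Metric_space_mspace_mdist)
  obtain D where D: "countable D" "D \<subseteq> A"
    "\<And>f e. f \<in> A \<Longrightarrow> 0 < e \<Longrightarrow> \<exists>g\<in>D. mdist (path_space T) f g < e"
    using path_space_dense_subset[OF assms] by metis
  have "A \<inter> (mtopology_of (path_space T)) closure_of (A \<inter> D) = A"
    unfolding mtopology_of_def m.metric_closure_of using A D(2,3)
    by (force simp: m.in_mball subset_iff)
  moreover have "topspace (mtopology_of (path_space T)) = mspace (path_space T)" by simp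
  ultimately show ?thesis
    using D(1,2) A unfolding separable_space_def closure_of_subtopology
    by (intro exI[of _ D]) auto
qed

text \<open>An open set of paths is a countable union of closed balls centred in a countable dense
  set. Closed balls are chosen because the condition
  \<open>dist (g t) (X (\<omega>, t)) \<le> e\<close> for all t follows from its validity at
  countably many t.\<close>

lemma measurable_path:
  fixes X :: "'w \<times> real \<Rightarrow> 'h::{real_normed_vector,second_countable_topology}"
  assumes T: "0 < T"
    and X: "\<And>t. t \<in> {0..T} \<Longrightarrow> (\<lambda>\<omega>. X (\<omega>, t)) \<in> borel_measurable M"
    and cont: "\<And>\<omega>. \<omega> \<in> space M \<Longrightarrow> continuous_on {0..T} (\<lambda>t. X (\<omega>, t))"
  shows "path T X \<in> measurable M (path_borel T)"
  unfolding path_borel_def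
proof (rule measurable_measure_of)
  let ?m = "path_space T :: (real \<Rightarrow> 'h) metric"
  interpret m: Metric_space "mspace ?m" "mdist ?m"
    by (rule Metric_space_mspace_mdist)
  show "{U. openin (mtopology_of ?m) U} \<subseteq> Pow (mspace ?m)"
    using openin_subset by fastforce
  show path: "path T X \<in> space M \<rightarrow> mspace ?m"
    using cont by (simp add: path_def restrict_in_path_space_iff)
  fix U assume "U \<in> {U. openin (mtopology_of ?m) U}"
  then have U: "openin m.mtopology U" by (simp add: mtopology_of_def)
  obtain D where D: "countable D" "D \<subseteq> mspace ?m"
    "\<And>f e. f \<in> mspace ?m \<Longrightarrow> 0 < e \<Longrightarrow> \<exists>g\<in>D. mdist ?m f g < e"
    using path_space_dense_subset[OF T subset_refl] by metis
  define J where "J = {(g, n). g \<in> D \<and> m.mcball g (1 / real (Suc n)) \<subseteq> U}"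
  have "countable J"
    by (rule countable_subset[of _ "D \<times> UNIV"]) (use D(1) in \<open>auto simp: J_def\<close>)
  have UJ: "U = (\<Union>(g, n)\<in>J. m.mcball g (1 / real (Suc n)))"
  proof
    show "U \<subseteq> (\<Union>(g, n)\<in>J. m.mcball g (1 / real (Suc n)))"
    proof
      fix f assume f: "f \<in> U"
      then have fm: "f \<in> mspace ?m" using U openin_subset by fastforce
      obtain e where e: "0 < e" "m.mcball f e \<subseteq> U"
        using U f unfolding m.openin_mtopology_mcball by blast
      obtain n where n: "1 / real (Suc n) < e / 2" using nat_approx_posE[of "e / 2"] e by auto
      obtain g where g: "g \<in> D" "mdist ?m f g < 1 / real (Suc n)" using D(3)[OF fm, of "1 / real (Suc n)"] by auto
      then have gm: "g \<in> mspace ?m" using D(2) by auto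
      have "m.mcball g (1 / real (Suc n)) \<subseteq> m.mcball f e"
      proof
        fix h assume "h \<in> m.mcball g (1 / real (Suc n))"
        then show "h \<in> m.mcball f e"
          using fm gm g(2) n m.triangle[of f g h] by (auto simp: m.in_mcball)
      qed
      then have "(g, n) \<in> J" using g e by (auto simp: J_def)
      moreover have "f \<in> m.mcball g (1 / real (Suc n))"
        using fm gm g(2) by (auto simp: m.in_mcball m.commute)
      ultimately show "f \<in> (\<Union>(g, n)\<in>J. m.mcball g (1 / real (Suc n)))" by blast
    qed
  qed (auto simp: J_def)
  have "path T X -` m.mcball g e \<inter> space M \<in> sets M" if g: "g \<in> D" for g e
  proof -
    have gm: "g \<in> mspace ?m" using g D by auto
    have in_cball: "path T X \<omega> \<in> m.mcball g e \<longleftrightarrow> (\<forall>t\<in>{0..T}. dist (g t) (X (\<omega>, t)) \<le> e)"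
      if "\<omega> \<in> space M" for \<omega>
    proof -
      have px: "path T X \<omega> \<in> mspace ?m" using path that by auto
      have "mdist ?m g (path T X \<omega>) \<le> e \<longleftrightarrow> (\<forall>t\<in>{0..T}. dist (g t) (path T X \<omega> t) \<le> e)"
        using T gm px by (intro mdist_path_space_le) auto
      then show ?thesis using gm px by (simp add: m.in_mcball) (simp add: path_def)
    qed
    have "path T X -` m.mcball g e \<inter> space M = {\<omega> \<in> space M. \<forall>t\<in>{0..T}. dist (g t) (X (\<omega>, t)) \<le> e}"
      using in_cball by auto
    also have "\<dots> = {\<omega> \<in> space M. \<forall>t\<in>time_dense T. dist (g t) (X (\<omega>, t)) \<le> e}"
    proof (intro Collect_cong conj_cong refl iffI ballI)
      fix \<omega> t assume "\<omega> \<in> space M" "\<forall>t\<in>time_dense T. dist (g t) (X (\<omega>, t)) \<le> e" "t \<in> {0..T}"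
      moreover from this have "continuous_on {0..T} (\<lambda>t. dist (g t) (X (\<omega>, t)))"
        using cont mspace_path_spaceD[OF gm] by (intro continuous_on_dist) auto
      ultimately show "dist (g t) (X (\<omega>, t)) \<le> e"
        using time_dense_extend[of T "\<lambda>t. dist (g t) (X (\<omega>, t))" "{..e}" t] by auto
    qed (use time_dense(2) in auto)
    also have "\<dots> = space M \<inter> (\<Inter>t\<in>time_dense T. {\<omega> \<in> space M. dist (g t) (X (\<omega>, t)) \<le> e})"
      by auto
    also have "\<dots> \<in> sets M"
    proof (cases "time_dense T = {}")
      case False
      have "(\<Inter>t\<in>time_dense T. {\<omega> \<in> space M. dist (g t) (X (\<omega>, t)) \<le> e}) \<in> sets M"
      proof (rule sets.countable_INT'[OF time_dense(1) False], rule image_subsetI)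
        fix t assume "t \<in> time_dense T"
        then have [measurable]: "(\<lambda>\<omega>. X (\<omega>, t)) \<in> borel_measurable M" using X subsetD[OF time_dense(2)] by blast
        show "{\<omega> \<in> space M. dist (g t) (X (\<omega>, t)) \<le> e} \<in> sets M" by measurable
      qed
      then show ?thesis by auto
    qed auto
    finally show ?thesis .
  qed
  then have "(\<Union>(g, n)\<in>J. path T X -` m.mcball g (1 / real (Suc n)) \<inter> space M) \<in> sets M"
    using \<open>countable J\<close> by (intro sets.countable_UN') (auto simp: J_def)
  then show "path T X -` U \<inter> space M \<in> sets M"
    unfolding UJ by (simp add: vimage_UN case_prod_beta')
qed

lemma separable_top_of_set: "separable_space (top_of_set (A :: 'a::{metric_space,second_countable_topology} set))"
proof -
  obtain D where "countable D" "D \<subseteq> A" "A \<subseteq> closure D" by (rule separable)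
  then show ?thesis
    unfolding separable_space_def closure_of_subtopology
    by (intro exI[of _ D]) (auto simp: Int_absorb1)
qed

section \<open>The filtered space and the inclusions between its \<sigma>-algebras\<close>

locale time_interval =
  fixes T :: real
  assumes T: "0 < T"
begin

abbreviation "time \<equiv> restrict_space lborel {0..T}"

end

locale filtered_space =
  time_interval T
  for P :: "'w measure" and F :: "real \<Rightarrow> 'w measure" and T :: real +
  assumes filtered: "complete_filtered_prob_space P F T"
begin

text \<open>The product \<sigma>-algebra on which paths are measurable, not the progressive
  \<sigma>-algebra.\<close>

abbreviation "prog \<equiv> F T \<Otimes>\<^sub>M restrict_space borel {0..T}"
abbreviation "pred \<equiv> predictable_algebra F T"

sublocale prob_space P
  using filtered by (simp add: complete_filtered_prob_space_def)

sublocale time: finite_measure "restrict_space lborel {0..T}"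
  using T by (intro finite_measureI) (simp add: space_restrict_space emeasure_restrict_space)

sublocale pair_sigma_finite P "restrict_space lborel {0..T}" ..

lemma sigma_finite_P: "sigma_finite_measure P" and sigma_finite_time: "sigma_finite_measure time"
  ..

lemma F_subalgebra: "t \<in> {0..T} \<Longrightarrow> space (F t) = space P" "t \<in> {0..T} \<Longrightarrow> sets (F t) \<subseteq> sets P"
  "t \<in> {0..T} \<Longrightarrow> null_sets P \<subseteq> sets (F t)"
  using filtered by (auto simp: complete_filtered_prob_space_def subalgebra_def)

lemma F_mono: "0 \<le> s \<Longrightarrow> s \<le> t \<Longrightarrow> t \<le> T \<Longrightarrow> sets (F s) \<subseteq> sets (F t)"
  using filtered by (auto simp: complete_filtered_prob_space_def)

lemma sets_time: "sets time = sets (restrict_space borel {0..T})"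
  by (intro sets_restrict_space_cong) simp

lemma space_time [simp]: "space time = {0..T}"
  by (simp add: space_restrict_space)

lemma space_pred: "space pred = space P \<times> {0..T}"
  unfolding predictable_algebra_def using T F_subalgebra(1)[of 0]
  by (subst space_measure_of_conv) auto

lemma space_prog: "space prog = space P \<times> {0..T}"
  using T F_subalgebra(1)[of T] by (simp add: space_pair_measure space_restrict_space)

lemma measurable_id_F: "t \<in> {0..T} \<Longrightarrow> (\<lambda>x. x) \<in> measurable P (F t)"
  using F_subalgebra[of t] by (auto simp: measurable_def)

text \<open>Inclusions of \<sigma>-algebras are phrased as measurability of the identity;
  composition with it transports measurability from \<open>pred\<close> to \<open>prog\<close> and
  on to the product space that carries the measure.\<close>

lemma measurable_id_prog: "(\<lambda>x. x) \<in> measurable (P \<Otimes>\<^sub>M time) prog"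
proof -
  have 1: "fst \<in> measurable (P \<Otimes>\<^sub>M time) (F T)"
    by (rule measurable_compose[OF measurable_fst measurable_id_F]) (use T in auto)
  have "sets (restrict_space borel {0..T}) = sets time" by (rule sets_time[symmetric])
  then have 2: "snd \<in> measurable (P \<Otimes>\<^sub>M time) (restrict_space borel {0..T})"
    by (subst measurable_cong_sets[OF refl]) auto
  show ?thesis using measurable_Pair[OF 1 2] by simp
qed

lemma predictable_generator:
  "{A \<times> {0} |A. A \<in> sets (F 0)} \<union>
      {A \<times> {s<..t} |A s t. 0 \<le> s \<and> s \<le> t \<and> t \<le> T \<and> A \<in> sets (F s)} \<subseteq> Pow (space (F 0) \<times> {0..T})"
proof -
  have sp: "space (F 0) = space P" using F_subalgebra(1) T by auto
  have sub: "A \<subseteq> space P" if "A \<in> sets (F s)" "0 \<le> s" "s \<le> T" for A s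
    using sets.sets_into_space[OF that(1)] F_subalgebra(1)[of s] that by auto
  have a: "A \<times> {0} \<subseteq> space P \<times> {0..T}" if "A \<in> sets (F 0)" for A
    using sub[OF that] T by auto
  have b: "A \<times> {s<..t} \<subseteq> space P \<times> {0..T}"
    if "A \<in> sets (F s)" "0 \<le> s" "s \<le> t" "t \<le> T" for A s t
    using sub[of A s] that by auto
  show ?thesis unfolding sp
  proof (rule Un_least)
    show "{A \<times> {0} |A. A \<in> sets (F 0)} \<subseteq> Pow (space P \<times> {0..T})" using a by blast
    show "{A \<times> {s<..t} |A s t. 0 \<le> s \<and> s \<le> t \<and> t \<le> T \<and> A \<in> sets (F s)}
        \<subseteq> Pow (space P \<times> {0..T})"
      using b by blast
  qed
qed

lemma measurable_id_pred: "(\<lambda>x. x) \<in> measurable prog pred"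
  unfolding predictable_algebra_def
proof (rule measurable_measure_of)
  have sp: "space (F 0) = space P" "space (F T) = space P" using F_subalgebra(1) T by auto
  note predictable_generator
  then show "{A \<times> {0} |A. A \<in> sets (F 0)} \<union>
      {A \<times> {s<..t} |A s t. 0 \<le> s \<and> s \<le> t \<and> t \<le> T \<and> A \<in> sets (F s)} \<subseteq> Pow (space (F 0) \<times> {0..T})" .
  show "(\<lambda>x. x) \<in> space prog \<rightarrow> space (F 0) \<times> {0..T}"
    by (auto simp: space_prog sp)
  fix Z assume Z: "Z \<in> {A \<times> {0} |A. A \<in> sets (F 0)} \<union>
      {A \<times> {s<..t} |A s t. 0 \<le> s \<and> s \<le> t \<and> t \<le> T \<and> A \<in> sets (F s)}"
  then have "Z \<in> sets prog"
  proof
    assume "Z \<in> {A \<times> {0} |A. A \<in> sets (F 0)}"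
    then obtain A where "Z = A \<times> {0}" "A \<in> sets (F 0)" by auto
    moreover have "{0} \<in> sets (restrict_space borel {0..T})"
      using T by (subst sets_restrict_space_iff) auto
    ultimately show ?thesis using F_mono[of 0 T] T by auto
  next
    assume "Z \<in> {A \<times> {s<..t} |A s t. 0 \<le> s \<and> s \<le> t \<and> t \<le> T \<and> A \<in> sets (F s)}"
    then obtain A s t where Zs: "Z = A \<times> {s<..t}" "A \<in> sets (F s)" "0 \<le> s" "s \<le> t" "t \<le> T" by auto
    moreover have "{s<..t} \<in> sets (restrict_space borel {0..T})"
      using Zs by (subst sets_restrict_space_iff) auto
    ultimately show ?thesis using F_mono[of s T] by auto
  qed
  moreover have "Z \<subseteq> space prog" using \<open>Z \<in> sets prog\<close> by (rule sets.sets_into_space)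
  ultimately show "(\<lambda>x. x) -` Z \<inter> space prog \<in> sets prog" by (simp add: Int_absorb2)
qed

lemma measurable_prog_P: "f \<in> measurable prog N \<Longrightarrow> f \<in> measurable (P \<Otimes>\<^sub>M time) N"
  using measurable_compose[OF measurable_id_prog] by blast

lemma measurable_pred_prog: "f \<in> measurable pred N \<Longrightarrow> f \<in> measurable prog N"
  using measurable_compose[OF measurable_id_pred] by blast

lemma measurable_pred_P: "f \<in> measurable pred N \<Longrightarrow> f \<in> measurable (P \<Otimes>\<^sub>M time) N"
  by (intro measurable_prog_P measurable_pred_prog)

lemma measurable_joint_prog_P:
  assumes "f \<in> measurable (M \<Otimes>\<^sub>M prog) N"
  shows "f \<in> measurable (M \<Otimes>\<^sub>M (P \<Otimes>\<^sub>M time)) N"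
  using measurable_compose[OF measurable_Pair[OF measurable_fst
      measurable_compose[OF measurable_snd measurable_id_prog]] assms] by simp

lemma measurable_joint_pred_prog:
  assumes "f \<in> measurable (M \<Otimes>\<^sub>M pred) N"
  shows "f \<in> measurable (M \<Otimes>\<^sub>M prog) N"
  using measurable_compose[OF measurable_Pair[OF measurable_fst
      measurable_compose[OF measurable_snd measurable_id_pred]] assms] by simp

lemma path_norm_eq: "path_norm P T r X = lpn P r (\<lambda>\<omega>. SUP t\<in>{0..T}. ennreal (norm (X (\<omega>, t))))"
  by (simp add: path_norm_def lpn_def)

lemma Lpq_norm_eq:
  assumes "1 \<le> p"
  shows "Lpq_norm P T p q X = lpn2 P p time q (\<lambda>z. ennreal (norm (X z)))"
  unfolding Lpq_norm_def lpn2_def lpn_def using assms by (simp add: epowr_epowr epowr_ennreal)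

text \<open>For jointly measurable, a.e. continuous X the clauses on the path map follow: its
  measurability reduces to single times, its separable range to that of C([0,T],H). A null set N off
  which the paths are continuous serves both.\<close>

lemma Lr_reps_iff:
  fixes X :: "'w \<times> real \<Rightarrow> 'h::{real_normed_vector,second_countable_topology}"
  shows "X \<in> reps (Lr_path_space P F T r) \<longleftrightarrow> X \<in> borel_measurable prog \<and>
    (AE \<omega> in P. continuous_on {0..T} (\<lambda>t. X (\<omega>, t))) \<and> path_norm P T r X < \<infinity>"
    (is "_ \<longleftrightarrow> ?R")
proof
  assume X: "X \<in> reps (Lr_path_space P F T r)"
  then obtain N where N: "N \<in> null_sets P" "\<forall>\<omega>\<in>space P - N. path T X \<omega> \<in> mspace (path_space T)"
    by (auto simp: Lr_path_space_def)
  have "AE \<omega> in P. continuous_on {0..T} (\<lambda>t. X (\<omega>, t))"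
    using AE_not_in[OF N(1)] AE_space
    by eventually_elim (use N(2) in \<open>auto simp: path_def restrict_in_path_space_iff\<close>)
  then show ?R using X by (auto simp: Lr_path_space_def)
next
  assume R: ?R
  then obtain N where N: "N \<in> null_sets P" "{\<omega> \<in> space P. \<not> continuous_on {0..T} (\<lambda>t. X (\<omega>, t))} \<subseteq> N"
    by (auto simp: eventually_ae_filter)
  have cont: "continuous_on {0..T} (\<lambda>t. X (\<omega>, t))" if "\<omega> \<in> space P - N" for \<omega>
    using that N by auto
  have sl: "(\<lambda>\<omega>. X (\<omega>, t)) \<in> borel_measurable (restrict_space (F T) (space P - N))" if "t \<in> {0..T}" for t
  proof -
    have [measurable]: "X \<in> borel_measurable prog" using R by simp
    have [measurable]: "t \<in> space (restrict_space borel {0..T})" using that by (simp add: space_restrict_space)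
    show ?thesis by (intro measurable_restrict_space1) measurable
  qed
  have "path T X \<in> measurable (restrict_space (F T) (space P - N)) (path_borel T)"
    using cont sl by (intro measurable_path T) (auto simp: space_restrict_space)
  moreover have ms: "path T X \<omega> \<in> mspace (path_space T)" if "\<omega> \<in> space P - N" for \<omega>
    using cont[OF that] by (simp add: path_def restrict_in_path_space_iff)
  moreover have "separable_space (subtopology (mtopology_of (path_space T)) (path T X ` (space P - N)))"
    by (rule separable_path_subspace[OF T]) (use ms in auto)
  ultimately have "\<exists>N\<in>null_sets P. (\<forall>\<omega>\<in>space P - N. path T X \<omega> \<in> mspace (path_space T)) \<and>
      path T X \<in> measurable (restrict_space (F T) (space P - N)) (path_borel T) \<and>
      separable_space (subtopology (mtopology_of (path_space T)) (path T X ` (space P - N)))"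
    using N(1) by (intro bexI[of _ N] conjI ballI)
  then show "X \<in> reps (Lr_path_space P F T r)"
    using R unfolding Lr_path_space_def by simp
qed

lemma Lpq_reps_iff:
  fixes X :: "'w \<times> real \<Rightarrow> 'e::{real_normed_vector,second_countable_topology}"
  shows "X \<in> reps (Lpq_space P F T p q) \<longleftrightarrow>
    X \<in> borel_measurable pred \<and> Lpq_norm P T p q X < \<infinity>"
  by (auto simp: Lpq_space_def separable_top_of_set intro!: bexI[of _ "{}"])

end

section \<open>The semigroup and the fractional kernel\<close>

text \<open>The substitution s = u + (t - u) x gives the Beta integral B(1 - \<beta>, \<beta>). The
  powers of t - u cancel, since 1 + (\<beta> - 1) - \<beta> = 0, so the value depends neither on u
  nor on t: this is what makes the factorization work.\<close>

lemma nn_integral_Beta_kernel: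
  fixes u t \<beta> :: real
  assumes ut: "u < t" and b: "0 < \<beta>" "\<beta> < 1"
  shows "(\<integral>\<^sup>+s. ennreal (indicator {u..t} s * ((t - s) powr (\<beta> - 1) * (s - u) powr (- \<beta>))) \<partial>lborel)
    = ennreal (pi / sin (pi * \<beta>))"
proof -
  have refl: "Beta (1 - \<beta>) \<beta> = pi / sin (pi * \<beta>)"
  proof -
    \<comment> \<open>Euler's reflection formula is applied over the complex numbers and read off on
      the real line.\<close>
    have "complex_of_real (Gamma (1 - \<beta>) * Gamma \<beta>) = Gamma (of_real \<beta>) * Gamma (1 - of_real \<beta>)"
      by (simp add: Gamma_complex_of_real[symmetric] mult.commute)
    also have "\<dots> = complex_of_real (pi / sin (pi * \<beta>))"
      by (simp add: Gamma_reflection_complex flip: sin_of_real)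
    finally have "Gamma (1 - \<beta>) * Gamma \<beta> = pi / sin (pi * \<beta>)" by (simp only: of_real_eq_iff)
    then show ?thesis by (simp add: Beta_def)
  qed
  have "(\<integral>\<^sup>+s. ennreal (indicator {u..t} s * ((t - s) powr (\<beta> - 1) * (s - u) powr (- \<beta>))) \<partial>lborel)
      = ennreal \<bar>t - u\<bar> * (\<integral>\<^sup>+x. ennreal (indicator {u..t} (u + (t - u) * x) *
          ((t - (u + (t - u) * x)) powr (\<beta> - 1) * (u + (t - u) * x - u) powr (- \<beta>))) \<partial>lborel)"
    using ut by (intro nn_integral_real_affine) auto
  also have "\<dots> = (\<integral>\<^sup>+x. ennreal \<bar>t - u\<bar> * ennreal (indicator {u..t} (u + (t - u) * x) *
          ((t - (u + (t - u) * x)) powr (\<beta> - 1) * (u + (t - u) * x - u) powr (- \<beta>))) \<partial>lborel)"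
    by (intro nn_integral_cmult[symmetric]) measurable
  also have "\<dots> = (\<integral>\<^sup>+x. ennreal (x powr ((1 - \<beta>) - 1) * (1 - x) powr (\<beta> - 1)) * indicator {0..1} x \<partial>lborel)"
  proof (intro nn_integral_cong)
    fix x :: real
    show "ennreal \<bar>t - u\<bar> * ennreal (indicator {u..t} (u + (t - u) * x) *
          ((t - (u + (t - u) * x)) powr (\<beta> - 1) * (u + (t - u) * x - u) powr (- \<beta>)))
        = ennreal (x powr ((1 - \<beta>) - 1) * (1 - x) powr (\<beta> - 1)) * indicator {0..1} x"
    proof (cases "x \<in> {0..1}")
      case True
      have 1: "t - (u + (t - u) * x) = (t - u) * (1 - x)" by (simp add: algebra_simps)
      have "(t - u) powr (\<beta> - 1) * (t - u) powr (- \<beta>) = inverse (t - u)"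
        unfolding powr_add[symmetric] using ut by (simp add: powr_minus)
      then have 2: "(t - u) * ((t - u) powr (\<beta> - 1) * (t - u) powr (- \<beta>)) = 1"
        using ut by simp
      have "(t - u) * (((t - u) * (1 - x)) powr (\<beta> - 1) * ((t - u) * x) powr (- \<beta>))
          = ((t - u) * ((t - u) powr (\<beta> - 1) * (t - u) powr (- \<beta>))) * (x powr (- \<beta>) * (1 - x) powr (\<beta> - 1))"
        using True ut by (simp add: powr_mult mult_ac)
      also have "\<dots> = x powr (- \<beta>) * (1 - x) powr (\<beta> - 1)" unfolding 2 by simp
      finally have 3: "(t - u) * (((t - u) * (1 - x)) powr (\<beta> - 1) * ((t - u) * x) powr (- \<beta>))
          = x powr (- \<beta>) * (1 - x) powr (\<beta> - 1)" .
      have "0 \<le> (t - u) * x" "(t - u) * x \<le> (t - u) * 1"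
        using True ut by (auto intro: mult_left_mono)
      then have "u + (t - u) * x \<in> {u..t}" by simp
      then show ?thesis
        using True ut 3 by (simp add: 1 flip: ennreal_mult)
    next
      case False
      have "u + (t - u) * x \<notin> {u..t}"
      proof (cases "x < 0")
        case True
        then have "(t - u) * x < 0" using ut by (simp add: mult_less_0_iff)
        then show ?thesis by simp
      next
        case F2: False
        then have "(t - u) * 1 < (t - u) * x" using ut False by (intro mult_strict_left_mono) auto
        then show ?thesis by simp
      qed
      then show ?thesis using False by simp
    qed
  qed
  also have "\<dots> = ennreal (pi / sin (pi * \<beta>))"
    unfolding refl[symmetric] using b has_integral_Beta_real[of "1 - \<beta>" \<beta>]
    by (intro nn_integral_has_integral_lebesgue') auto
  finally show ?thesis .
qed

lemma nn_integral_powr_reflect: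
  fixes a t :: real
  assumes a: "-1 < a" and t: "0 \<le> t"
  shows "(\<integral>\<^sup>+s. ennreal (indicator {0..t} s * (t - s) powr a) \<partial>lborel) = ennreal (t powr (a + 1) / (a + 1))"
proof -
  have "(\<integral>\<^sup>+s. ennreal (indicator {0..t} s * (t - s) powr a) \<partial>lborel)
      = ennreal \<bar>-1\<bar> * (\<integral>\<^sup>+x. ennreal (indicator {0..t} (t + (-1) * x) * (t - (t + (-1) * x)) powr a) \<partial>lborel)"
    by (intro nn_integral_real_affine) auto
  also have "\<dots> = (\<integral>\<^sup>+x. ennreal (x powr a) * indicator {0..t} x \<partial>lborel)"
    by (auto intro!: nn_integral_cong simp: indicator_def)
  also have "\<dots> = ennreal (t powr (a + 1) / (a + 1))"
    using has_integral_powr_from_0[OF a t] by (intro nn_integral_has_integral_lebesgue') auto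
  finally show ?thesis .
qed

lemma nn_integral_time:
  "(\<integral>\<^sup>+s. f s \<partial>restrict_space lborel {0..T}) = (\<integral>\<^sup>+s. f s * indicator {0..T} s \<partial>lborel)" for T :: real
  by (rule nn_integral_restrict_space) simp

section \<open>The semigroup and the singular kernel (t - s)^(\<beta> - 1)\<close>

locale kernel =
  time_interval T
  for T r \<beta> M :: real
    and S :: "real \<Rightarrow> 'h::{real_inner,banach,second_countable_topology} \<Rightarrow>\<^sub>L 'h" +
  assumes r: "1 < r" and \<beta>: "1 / r < \<beta>" "\<beta> < 1"
    and semigroup: "C0_semigroup S" and M: "M = (SUP t\<in>{0..T}. norm (S t))"
begin

lemma \<beta>_pos: "0 < \<beta>"
  using r \<beta> by (meson less_trans zero_less_divide_1_iff zero_less_one)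

lemma \<beta>r: "1 < \<beta> * r"
  using r \<beta>(1) by (simp add: field_simps)

text \<open>Orbits are continuous, hence bounded on [0,T], and the uniform boundedness principle
  applies. Without this the real \<open>SUP\<close> that defines \<open>M\<close> would give no
  bound.\<close>

lemma S_bdd: "bdd_above ((\<lambda>t. norm (S t)) ` {0..T})"
proof -
  have "\<exists>B. \<forall>t\<in>{0..T}. norm (S t) \<le> B"
  proof (rule uniform_boundedness)
    fix x
    have "continuous_on {0..T} (\<lambda>t. S t x)"
      using semigroup by (auto simp: C0_semigroup_def intro: continuous_on_subset)
    then have "bounded ((\<lambda>t. S t x) ` {0..T})"
      by (intro compact_imp_bounded compact_continuous_image) auto
    then show "\<exists>B. \<forall>t\<in>{0..T}. norm (S t x) \<le> B" by (auto simp: bounded_iff)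
  qed
  then show ?thesis by (auto intro: bdd_aboveI2)
qed

lemma norm_S_le: "t \<in> {0..T} \<Longrightarrow> norm (S t) \<le> M"
  unfolding M by (rule cSUP_upper[OF _ S_bdd])

lemma M_nonneg: "0 \<le> M"
  using T by (intro order_trans[OF norm_ge_zero norm_S_le[of 0]]) simp

lemma S_compose: "0 \<le> s \<Longrightarrow> 0 \<le> t \<Longrightarrow> S (s + t) = S s o\<^sub>L S t"
  using semigroup by (simp add: C0_semigroup_def)

text \<open>Freezing the semigroup outside \<open>[0,T]\<close> makes it jointly continuous on the whole line
  without changing the integrals below.\<close>

definition Sc :: "real \<Rightarrow> 'h \<Rightarrow>\<^sub>L 'h" where
  "Sc t = S (max 0 (min T t))"

lemma Sc_eq: "t \<in> {0..T} \<Longrightarrow> Sc t = S t"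
  by (simp add: Sc_def)

lemma norm_Sc_le: "norm (Sc t) \<le> M"
  unfolding Sc_def using T by (intro norm_S_le) auto

lemma norm_Sc_apply_le: "norm (Sc t x) \<le> M * norm x"
  by (rule order_trans[OF norm_blinfun]) (simp add: norm_Sc_le mult_right_mono)

text \<open>Split Sc t' x' - Sc t x into Sc t' (x' - x), controlled by M, and Sc t' x - Sc t x,
  controlled by strong continuity. Joint continuity yields joint measurability although t \<mapsto>
  \<open>Sc t\<close> need not be continuous in operator norm.\<close>

lemma continuous_Sc: "continuous_on UNIV (\<lambda>(t, x). Sc t x)"
proof -
  have c: "continuous_on UNIV (\<lambda>t. Sc t x)" for x
  proof -
    have "continuous_on {0..} (\<lambda>t. S t x)" using semigroup by (simp add: C0_semigroup_def)
    then show ?thesis unfolding Sc_def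
      by (rule continuous_on_compose2) (auto intro!: continuous_intros)
  qed
  show ?thesis
    unfolding continuous_on_eq_continuous_at[OF open_UNIV] continuous_at tendsto_iff
  proof (intro ballI allI impI)
    fix z :: "real \<times> 'h" and e :: real assume "0 < e"
    obtain t x where z: "z = (t, x)" by (cases z)
    have t1: "((\<lambda>w. Sc (fst w) x) \<longlongrightarrow> Sc t x) (at z)"
      using c[of x] tendsto_fst[OF tendsto_ident_at, of z UNIV]
      by (intro continuous_on_tendsto_compose[OF c]) (auto simp: z)
    have t2: "((\<lambda>w. M * norm (snd w - x)) \<longlongrightarrow> M * norm (snd z - x)) (at z)"
      by (intro tendsto_intros)
    have "((\<lambda>w. M * norm (snd w - x) + norm (Sc (fst w) x - Sc t x))
        \<longlongrightarrow> M * norm (snd z - x) + norm (Sc t x - Sc t x)) (at z)"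
      by (intro tendsto_add t2 tendsto_norm tendsto_diff t1 tendsto_const)
    then have "((\<lambda>w. M * norm (snd w - x) + norm (Sc (fst w) x - Sc t x)) \<longlongrightarrow> 0) (at z)"
      by (simp add: z)
    then have "\<forall>\<^sub>F w in at z. M * norm (snd w - x) + norm (Sc (fst w) x - Sc t x) < e"
      using \<open>0 < e\<close> by (rule order_tendstoD)
    then show "\<forall>\<^sub>F w in at z. dist (case w of (t, x) \<Rightarrow> Sc t x) (case z of (t, x) \<Rightarrow> Sc t x) < e"
    proof eventually_elim
      case (elim w)
      have "Sc (fst w) (snd w) - Sc t x = Sc (fst w) (snd w - x) + (Sc (fst w) x - Sc t x)"
        by (simp add: blinfun.diff_right)
      then have "norm (Sc (fst w) (snd w) - Sc t x)
          \<le> norm (Sc (fst w) (snd w - x)) + norm (Sc (fst w) x - Sc t x)"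
        by (simp only: norm_triangle_ineq)
      then have "norm (Sc (fst w) (snd w) - Sc t x) \<le> M * norm (snd w - x) + norm (Sc (fst w) x - Sc t x)"
        using norm_Sc_apply_le[of "fst w" "snd w - x"] by linarith
      then show ?case using elim by (simp add: z dist_norm case_prod_beta')
    qed
  qed
qed

lemma measurable_Sc [measurable (raw)]:
  assumes "f \<in> borel_measurable N" "g \<in> borel_measurable N"
  shows "(\<lambda>x. Sc (f x) (g x)) \<in> borel_measurable N"
proof -
  have "(\<lambda>(t, x). Sc t x) \<in> borel_measurable (borel \<Otimes>\<^sub>M borel)"
    unfolding borel_prod by (rule borel_measurable_continuous_onI[OF continuous_Sc])
  from measurable_compose[OF measurable_Pair[OF assms] this] show ?thesis by simp
qed

text \<open>Strong continuity is not norm continuity, so measurability is checked at basis vectors,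
  where \<open>measurable_Sc\<close> applies.\<close>

lemma measurable_hs_compose_Sc [measurable (raw)]:
  fixes G :: "'a \<Rightarrow> ('u::{real_inner,second_countable_topology}, 'h) hs_op"
  assumes [measurable]: "f \<in> borel_measurable N" "G \<in> borel_measurable N"
  shows "(\<lambda>x. hs_compose (Sc (f x)) (G x)) \<in> borel_measurable N"
proof (rule borel_measurable_hs_opI)
  fix e
  have "(\<lambda>x. blinfun_of_hs (G x) e) \<in> borel_measurable N"
    by (rule borel_measurable_continuous_on[OF
          linear_continuous_on[OF bounded_linear_hs_apply]]) measurable
  then have [measurable]: "(\<lambda>x. blinfun_of_hs (G x) e) \<in> borel_measurable N" .
  have "(\<lambda>x. Sc (f x) (blinfun_of_hs (G x) e)) \<in> borel_measurable N" by measurable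
  then show "(\<lambda>x. blinfun_of_hs (hs_compose (Sc (f x)) (G x)) e) \<in> borel_measurable N"
    by (simp add: hs_compose.rep_eq)
qed

text \<open>The cut-off at s < t lets all integrals in s run over the fixed space
  \<open>time\<close>.\<close>

definition k :: "real \<Rightarrow> real \<Rightarrow> real" where
  "k t s = indicator {0..<t} s * (t - s) powr (\<beta> - 1)"

lemma k_nonneg: "0 \<le> k t s"
  by (simp add: k_def)

lemma measurable_k [measurable (raw)]:
  assumes [measurable]: "f \<in> borel_measurable N" "g \<in> borel_measurable N"
  shows "(\<lambda>x. k (f x) (g x)) \<in> borel_measurable N"
proof -
  have "(\<lambda>x. k (f x) (g x)) = (\<lambda>x. if 0 \<le> g x \<and> g x < f x then (f x - g x) powr (\<beta> - 1) else 0)"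
    by (auto simp: k_def indicator_def)
  then show ?thesis by simp
qed

definition K :: real where
  "K = T powr (\<beta> - 1 / r) * ((r - 1) / (\<beta> * r - 1)) powr ((r - 1) / r)"

lemma K_nonneg: "0 \<le> K"
  by (simp add: K_def)

text \<open>The exponent a = (\<beta> - 1) r/(r - 1) exceeds -1 because \<beta> > 1/r. The integral
  of its power up to t is t^(a+1)/(a+1), which increases with t and is therefore bounded by the
  value at T.\<close>

lemma lpn_k_le:
  assumes t: "t \<in> {0..T}"
  shows "lpn time (r / (r - 1)) (\<lambda>s. ennreal (k t s)) \<le> ennreal K"
proof -
  let ?q = "r / (r - 1)"
  let ?a = "(\<beta> - 1) * ?q"
  have a1: "?a + 1 = (\<beta> * r - 1) / (r - 1)" using r by (simp add: field_simps)
  have a: "0 < ?a + 1" unfolding a1 using r \<beta>r by simp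
  have "(\<integral>\<^sup>+s. epowr (ennreal (k t s)) ?q \<partial>time)
      \<le> (\<integral>\<^sup>+s. ennreal (indicator {0..t} s * (t - s) powr ?a) \<partial>lborel)"
    unfolding nn_integral_time
  proof (intro nn_integral_mono)
    fix s
    have "epowr (ennreal (k t s)) ?q = ennreal (k t s powr ?q)"
      by (intro epowr_ennreal k_nonneg)
    also have "k t s powr ?q \<le> indicator {0..t} s * (t - s) powr ?a"
      by (auto simp: k_def indicator_def powr_powr)
    finally show "epowr (ennreal (k t s)) ?q * indicator {0..T} s
        \<le> ennreal (indicator {0..t} s * (t - s) powr ?a)"
      by (auto simp: indicator_def ennreal_leI)
  qed
  also have "\<dots> = ennreal (t powr (?a + 1) / (?a + 1))"
    using t a by (intro nn_integral_powr_reflect) auto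
  also have "\<dots> \<le> ennreal (T powr (?a + 1) / (?a + 1))"
    using t a by (intro ennreal_leI divide_right_mono powr_mono2) auto
  finally have "lpn time ?q (\<lambda>s. ennreal (k t s)) \<le> epowr (ennreal (T powr (?a + 1) / (?a + 1))) (1 / ?q)"
    unfolding lpn_def using r by (intro epowr_mono) auto
  also have "\<dots> = ennreal ((T powr (?a + 1) / (?a + 1)) powr (1 / ?q))"
    using a by (intro epowr_ennreal) auto
  also have "(T powr (?a + 1) / (?a + 1)) powr (1 / ?q) = K"
  proof -
    \<comment> \<open>This is the origin of the exponent of T in the constant.\<close>
    have e: "(?a + 1) * (1 / ?q) = \<beta> - 1 / r"
      unfolding a1 using r by (simp add: field_simps)
    have "(T powr (?a + 1) / (?a + 1)) powr (1 / ?q) = (T powr (?a + 1)) powr (1 / ?q) * (1 / (?a + 1)) powr (1 / ?q)"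
      using a by (simp flip: powr_mult)
    also have "(T powr (?a + 1)) powr (1 / ?q) = T powr (\<beta> - 1 / r)"
      unfolding powr_powr e ..
    also have "1 / (?a + 1) = (r - 1) / (\<beta> * r - 1)" unfolding a1 by simp
    also have "1 / ?q = (r - 1) / r" by simp
    finally show ?thesis by (simp add: K_def)
  qed
  finally show ?thesis .
qed

text \<open>The constant does not depend on t; this is what turns an L^r bound in s into a bound on
  the supremum over t.\<close>

lemma kernel_Hoelder:
  assumes t: "t \<in> {0..T}" and [measurable]: "g \<in> borel_measurable time"
  shows "(\<integral>\<^sup>+s. ennreal (k t s) * g s \<partial>time) \<le> ennreal K * lpn time r g"
proof -
  have [measurable]: "(\<lambda>s. s) \<in> borel_measurable time"
    by (rule measurable_restrict_space1) simp
  have "(\<integral>\<^sup>+s. ennreal (k t s) * g s \<partial>time) \<le> lpn time (r / (r - 1)) (\<lambda>s. ennreal (k t s)) * lpn time r g"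
    using r by (intro Hoelder) (auto simp: field_simps)
  also have "\<dots> \<le> ennreal K * lpn time r g"
    by (intro mult_right_mono lpn_k_le t) simp
  finally show ?thesis .
qed

lemma borel_measurable_time_id [measurable]: "(\<lambda>s. s) \<in> borel_measurable time"
  by (rule measurable_restrict_space1) simp

lemma nn_integral_k_finite:
  assumes "t \<in> {0..T}"
  shows "(\<integral>\<^sup>+s. ennreal (k t s) \<partial>time) < \<top>"
proof -
  have "lpn time r (\<lambda>s. 1) = epowr (ennreal T) (1 / r)"
    using T by (simp add: lpn_def space_restrict_space emeasure_restrict_space)
  then have "ennreal K * lpn time r (\<lambda>s. 1) < \<top>"
    using T by (simp add: epowr_ennreal ennreal_mult_less_top)
  then show ?thesis
    using kernel_Hoelder[OF assms, of "\<lambda>_. 1"] by (auto intro: le_less_trans)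
qed

lemma integrable_k:
  assumes "t \<in> {0..T}"
  shows "integrable time (k t)"
proof (rule integrableI_nonneg)
  show "(\<integral>\<^sup>+s. ennreal (k t s) \<partial>time) < \<infinity>" using nn_integral_k_finite[OF assms] by simp
qed (auto simp: k_nonneg)

lemma integrable_k_bounded:
  fixes f :: "real \<Rightarrow> 'b::{banach,second_countable_topology}"
  assumes t: "t \<in> {0..T}" and [measurable]: "f \<in> borel_measurable time"
    and B: "\<And>s. s \<in> {0..T} \<Longrightarrow> norm (f s) \<le> B"
  shows "integrable time (\<lambda>s. k t s *\<^sub>R f s)"
proof (rule Bochner_Integration.integrable_bound)
  show "integrable time (\<lambda>s. k t s * B)" using integrable_k[OF t] by simp
  show "AE s in time. norm (k t s *\<^sub>R f s) \<le> norm (k t s * B)"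
  proof (rule AE_I2)
    fix s assume "s \<in> space time"
    then have "norm (f s) \<le> \<bar>B\<bar>" using B[of s] by (auto simp: space_restrict_space)
    then show "norm (k t s *\<^sub>R f s) \<le> norm (k t s * B)"
      by (simp add: abs_mult mult_left_mono)
  qed
qed measurable

text \<open>The integral of the kernel times S(t - s) over 0 \<le> s \<le> a, s < t, taken at each h
  separately, since strong continuity does not give an integral in operator norm.
  \<open>Rop_apply\<close> supplies the boundedness that \<open>Blinfun\<close> presupposes.\<close>

definition Rop :: "real \<Rightarrow> real \<Rightarrow> 'h \<Rightarrow>\<^sub>L 'h" where
  "Rop a t = Blinfun (\<lambda>h. \<integral>s. k t s *\<^sub>R (indicator {..a} s *\<^sub>R Sc (t - s) h) \<partial>time)"

lemma integrable_Rop: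
  "t \<in> {0..T} \<Longrightarrow> integrable time (\<lambda>s. k t s *\<^sub>R (indicator {..a} s *\<^sub>R Sc (t - s) h))"
proof (rule integrable_k_bounded)
  have "indicator {..a} \<in> borel_measurable time"
    by (intro measurable_restrict_space1) simp
  then show "(\<lambda>s. indicator {..a} s *\<^sub>R Sc (t - s) h) \<in> borel_measurable time"
    by measurable
  show "norm (indicator {..a} s *\<^sub>R Sc (t - s) h) \<le> M * norm h" for s
    using norm_Sc_apply_le[of "t - s" h] M_nonneg by (auto simp: indicator_def)
qed

lemma Rop_apply:
  assumes t: "t \<in> {0..T}"
  shows "Rop a t h = (\<integral>s. k t s *\<^sub>R (indicator {..a} s *\<^sub>R Sc (t - s) h) \<partial>time)"
proof -
  let ?R = "\<lambda>h. \<integral>s. k t s *\<^sub>R (indicator {..a} s *\<^sub>R Sc (t - s) h) \<partial>time"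
  have "bounded_linear ?R"
  proof (rule bounded_linear_intro)
    show "?R (x + y) = ?R x + ?R y" for x y
      unfolding Bochner_Integration.integral_add[OF integrable_Rop[OF t] integrable_Rop[OF t], symmetric]
      by (simp add: blinfun.add_right scaleR_add_right)
    show "?R (c *\<^sub>R x) = c *\<^sub>R ?R x" for c x
      unfolding integral_scaleR_right[symmetric]
      by (intro Bochner_Integration.integral_cong refl) (simp add: blinfun.scaleR_right mult_ac)
    show "norm (?R x) \<le> norm x * (M * (\<integral>s. k t s \<partial>time))" for x
    proof -
      have "norm (?R x) \<le> (\<integral>s. norm (k t s *\<^sub>R (indicator {..a} s *\<^sub>R Sc (t - s) x)) \<partial>time)"
        by (rule integral_norm_bound)
      also have "\<dots> \<le> (\<integral>s. k t s * (M * norm x) \<partial>time)"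
      proof (rule integral_mono)
        fix s
        show "norm (k t s *\<^sub>R (indicator {..a} s *\<^sub>R Sc (t - s) x)) \<le> k t s * (M * norm x)"
          using norm_Sc_apply_le[of "t - s" x] M_nonneg k_nonneg[of t s]
          by (auto simp: indicator_def intro!: mult_left_mono)
      next
        show "integrable time (\<lambda>s. norm (k t s *\<^sub>R (indicator {..a} s *\<^sub>R Sc (t - s) x)))"
          by (rule integrable_norm[OF integrable_Rop[OF t]])
      qed (use integrable_k[OF t] in auto)
      finally show ?thesis using integrable_k[OF t] by (simp add: mult_ac)
    qed
  qed
  then show ?thesis by (simp add: Rop_def bounded_linear_Blinfun_apply)
qed

text \<open>After x = t - s the time t occurs only in indicators. The singularity of the kernel sits
  at the fixed point x = 0, so one dominating function serves all t.\<close>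

lemma Rop_reflect:
  assumes t: "t \<in> {0..T}"
  shows "Rop a t h = (\<integral>x. (indicator {0<..t} x * indicator {t - a..} x * x powr (\<beta> - 1)) *\<^sub>R Sc x h \<partial>lborel)"
proof -
  have "Rop a t h = (\<integral>s. indicator {0..T} s *\<^sub>R (k t s *\<^sub>R (indicator {..a} s *\<^sub>R Sc (t - s) h)) \<partial>lborel)"
    unfolding Rop_apply[OF t] by (rule integral_restrict_space) simp
  also have "\<dots> = \<bar>-1\<bar> *\<^sub>R (\<integral>x. indicator {0..T} (t + (-1) * x) *\<^sub>R (k t (t + (-1) * x) *\<^sub>R
      (indicator {..a} (t + (-1) * x) *\<^sub>R Sc (t - (t + (-1) * x)) h)) \<partial>lborel)"
    by (rule lborel_integral_real_affine) simp
  also have "\<dots> = (\<integral>x. (indicator {0<..t} x * indicator {t - a..} x * x powr (\<beta> - 1)) *\<^sub>R Sc x h \<partial>lborel)"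
    using t by (simp, intro Bochner_Integration.integral_cong refl) (auto simp: k_def indicator_def)
  finally show ?thesis .
qed

text \<open>Dominated convergence in the reflected form, with operator and argument varying
  together. The dominating function x^(\<beta> - 1) M B is integrable near 0 because \<beta> >
  0.\<close>

lemma continuous_Rop:
  assumes y: "continuous_on {0..T} y"
  shows "continuous_on {0..T} (\<lambda>t. Rop a t (y t))"
  unfolding continuous_on_sequentially
proof (intro allI ballI impI, elim conjE)
  fix t :: "nat \<Rightarrow> real" and l assume l: "l \<in> {0..T}" and t: "\<forall>n. t n \<in> {0..T}" "t \<longlonglongrightarrow> l"
  have "bounded (y ` {0..T})"
    using y by (intro compact_imp_bounded compact_continuous_image) auto
  then obtain B where "\<forall>x\<in>y ` {0..T}. norm x \<le> B" unfolding bounded_iff by blast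
  then have B: "\<And>t. t \<in> {0..T} \<Longrightarrow> norm (y t) \<le> B" by blast
  have yl: "(\<lambda>n. y (t n)) \<longlonglongrightarrow> y l"
    using y t l by (auto simp: continuous_on_sequentially o_def)
  let ?f = "\<lambda>t x. (indicator {0<..t} x * indicator {t - a..} x * x powr (\<beta> - 1)) *\<^sub>R Sc x (y t)"
  have f_meas: "?f t \<in> borel_measurable lborel" for t
    by (intro borel_measurable_scaleR borel_measurable_times borel_measurable_indicator
        powr_real_measurable measurable_Sc) simp_all
  have "(\<lambda>n. \<integral>x. ?f (t n) x \<partial>lborel) \<longlonglongrightarrow> (\<integral>x. ?f l x \<partial>lborel)"
  proof (rule integral_dominated_convergence)
    show "integrable lborel (\<lambda>x. indicator {0..T} x *\<^sub>R (x powr (\<beta> - 1) * (M * B)))"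
    proof -
      have "(\<integral>\<^sup>+x. ennreal (x powr (\<beta> - 1)) * indicator {0..T} x \<partial>lborel) = ennreal (T powr (\<beta> - 1 + 1) / (\<beta> - 1 + 1))"
        using has_integral_powr_from_0[of "\<beta> - 1" T] \<beta>_pos T
        by (intro nn_integral_has_integral_lebesgue') auto
      also have "(\<lambda>x. ennreal (x powr (\<beta> - 1)) * indicator {0..T} x) = (\<lambda>x. ennreal (indicator {0..T} x * x powr (\<beta> - 1)))"
        by (auto simp: indicator_def)
      finally have "integrable lborel (\<lambda>x. indicator {0..T} x * x powr (\<beta> - 1))"
        by (intro integrableI_nonneg) auto
      then have "integrable lborel (\<lambda>x. (indicator {0..T} x * x powr (\<beta> - 1)) * (M * B))" by simp
      then show ?thesis by (simp add: mult_ac)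
    qed
    show "AE x in lborel. norm (?f (t n) x) \<le> indicator {0..T} x *\<^sub>R (x powr (\<beta> - 1) * (M * B))" for n
    proof (rule AE_I2)
      fix x
      have "norm (Sc x (y (t n))) \<le> M * B"
        using norm_Sc_apply_le[of x "y (t n)"] B[of "t n"] t(1) M_nonneg
        by (meson mult_left_mono order_trans)
      moreover from this have "0 \<le> M * B" by (rule order_trans[OF norm_ge_zero])
      ultimately show "norm (?f (t n) x) \<le> indicator {0..T} x *\<^sub>R (x powr (\<beta> - 1) * (M * B))"
        using t(1)[rule_format, of n] by (auto simp: indicator_def mult_left_mono)
    qed
    \<comment> \<open>The indicators can fail to converge only at their limiting end points l and l
      - a, a null set.\<close>
    have "AE x in lborel. x \<noteq> l" "AE x in lborel. x \<noteq> l - a"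
      by (rule AE_lborel_singleton)+
    then show "AE x in lborel. (\<lambda>n. ?f (t n) x) \<longlonglongrightarrow> ?f l x"
    proof eventually_elim
      case (elim x)
      have 1: "(\<lambda>n. indicator {0<..t n} x :: real) \<longlonglongrightarrow> indicator {0<..l} x"
      proof (rule tendsto_eventually)
        show "\<forall>\<^sub>F n in sequentially. (indicator {0<..t n} x :: real) = indicator {0<..l} x"
        proof (cases "x < l")
          case True
          with order_tendstoD(1)[OF t(2) True] show ?thesis by (auto elim!: eventually_mono simp: indicator_def)
        next
          case False
          then have "l < x" using elim by simp
          from order_tendstoD(2)[OF t(2) this] show ?thesis using \<open>l < x\<close> by (auto elim!: eventually_mono simp: indicator_def)
        qed
      qed
      have 2: "(\<lambda>n. indicator {t n - a..} x :: real) \<longlonglongrightarrow> indicator {l - a..} x"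
      proof (rule tendsto_eventually)
        have ta: "(\<lambda>n. t n - a) \<longlonglongrightarrow> l - a" using t(2) by (intro tendsto_intros)
        show "\<forall>\<^sub>F n in sequentially. (indicator {t n - a..} x :: real) = indicator {l - a..} x"
        proof (cases "x < l - a")
          case True
          with order_tendstoD(1)[OF ta True] show ?thesis by (auto elim!: eventually_mono simp: indicator_def)
        next
          case False
          then have "l - a < x" using elim by simp
          from order_tendstoD(2)[OF ta this] show ?thesis using \<open>l - a < x\<close> by (auto elim!: eventually_mono simp: indicator_def)
        qed
      qed
      have 3: "(\<lambda>n. Sc x (y (t n))) \<longlonglongrightarrow> Sc x (y l)"
        by (intro blinfun.tendsto tendsto_const yl)
      show ?case by (intro tendsto_scaleR tendsto_mult tendsto_const 1 2 3)
    qed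
  qed (rule f_meas)+
  then show "((\<lambda>t. Rop a t (y t)) \<circ> t) \<longlonglongrightarrow> Rop a l (y l)"
    using t(1) l by (simp add: Rop_reflect o_def)
qed

end

section \<open>Convolution of step functions\<close>

locale stochastic_convolution =
  filtered_space P F T + kernel T r \<beta> M S
  for P :: "'w measure" and F T r \<beta> M
    and S :: "real \<Rightarrow> 'h::{real_inner,banach,second_countable_topology} \<Rightarrow>\<^sub>L 'h" +
  fixes p q :: real
    and I :: "('w \<times> real \<Rightarrow> ('u::{real_inner,banach,second_countable_topology}, 'h) hs_op)
      \<Rightarrow> ('w \<times> real \<Rightarrow> 'h)"
  assumes p: "1 \<le> p" and q: "1 \<le> q"
    and I: "continuous_linear_op (Lpq_space P F T p q) (Lr_path_space P F T r) I"
    and I_commutes: "\<And>Q \<Psi>. \<Psi> \<in> reps (Lpq_space P F T p q) \<Longrightarrow>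
      same (Lr_path_space P F T r) (\<lambda>x. blinfun_apply Q (I \<Psi> x)) (I (\<lambda>x. hs_compose Q (\<Psi> x)))"
begin

section \<open>Norms and the operator \<open>I\<close> on representatives\<close>

sublocale mx: mixed_norm P "restrict_space lborel {0..T}" p q
  by unfold_locales (use p q in auto)

lemma r_pos: "0 < r" "1 \<le> r" "r \<noteq> 0"
  using r by auto

abbreviation "Lpq \<equiv> reps (Lpq_space P F T p q :: ('w \<times> real, ('u, 'h) hs_op) class_space)"
abbreviation "Lr \<equiv> reps (Lr_path_space P F T r :: ('w \<times> real, 'h) class_space)"
abbreviation "same_path \<equiv> same (Lr_path_space P F T r :: ('w \<times> real, 'h) class_space)"

definition nrm :: "('w \<times> real \<Rightarrow> ('u, 'h) hs_op) \<Rightarrow> ennreal" where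
  "nrm \<Psi> = lpn2 P p time q (\<lambda>z. ennreal (norm (\<Psi> z)))"

text \<open>A countable supremum, hence measurable for every jointly measurable X; it equals the
  supremum norm when the path is continuous.\<close>

definition sup_path :: "('w \<times> real \<Rightarrow> 'h) \<Rightarrow> 'w \<Rightarrow> ennreal" where
  "sup_path X \<omega> = (SUP t\<in>time_dense T. ennreal (norm (X (\<omega>, t))))"

definition N :: real where
  "N = op_norm (Lpq_space P F T p q) (Lr_path_space P F T r) I"

lemma same_path_iff: "same_path X Y \<longleftrightarrow> (AE \<omega> in P. \<forall>t\<in>{0..T}. X (\<omega>, t) = Y (\<omega>, t))"
  by (simp add: Lr_path_space_def)

lemma Lpq_iff: "\<Psi> \<in> Lpq \<longleftrightarrow> \<Psi> \<in> borel_measurable pred \<and> nrm \<Psi> < \<top>"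
  by (simp add: Lpq_reps_iff Lpq_norm_eq[OF p] nrm_def)

lemma same_Lpq_iff: "same (Lpq_space P F T p q) \<Psi> \<Psi>' \<longleftrightarrow> (AE z in P \<Otimes>\<^sub>M time. \<Psi> z = \<Psi>' z)"
  unfolding Lpq_space_def prod_lebesgue_def by simp

lemma measurable_norm_P:
  fixes f :: "'w \<times> real \<Rightarrow> 'e::{real_normed_vector,second_countable_topology}"
  assumes "f \<in> borel_measurable pred"
  shows "(\<lambda>z. ennreal (norm (f z))) \<in> borel_measurable (P \<Otimes>\<^sub>M time)"
  using measurable_pred_P[OF assms] by simp

lemma measurable_sup_path:
  assumes X: "X \<in> borel_measurable prog"
  shows "sup_path X \<in> borel_measurable P"
  unfolding sup_path_def
proof (rule borel_measurable_SUP[OF time_dense(1)])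
  fix t assume "t \<in> time_dense T"
  then have "t \<in> space time" using time_dense(2)[of T] by auto
  then show "(\<lambda>\<omega>. ennreal (norm (X (\<omega>, t)))) \<in> borel_measurable P"
    using mx.measurable_slice[of "\<lambda>z. ennreal (norm (X z))" t] measurable_prog_P[OF X] by simp
qed

lemma Lr_measurable: "X \<in> Lr \<Longrightarrow> X \<in> borel_measurable prog"
  and Lr_continuous: "X \<in> Lr \<Longrightarrow> AE \<omega> in P. continuous_on {0..T} (\<lambda>t. X (\<omega>, t))"
  by (simp_all add: Lr_reps_iff)

lemma path_norm_sup_path:
  assumes "AE \<omega> in P. continuous_on {0..T} (\<lambda>t. X (\<omega>, t))"
  shows "path_norm P T r X = lpn P r (sup_path X)"
  unfolding path_norm_eq using assms
  by (intro lpn_cong_AE) (auto elim!: eventually_mono simp: sup_path_def SUP_time_dense)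

lemma Lr_iff: "X \<in> Lr \<longleftrightarrow> X \<in> borel_measurable prog \<and>
    (AE \<omega> in P. continuous_on {0..T} (\<lambda>t. X (\<omega>, t))) \<and> lpn P r (sup_path X) < \<top>"
  using path_norm_sup_path[of X] by (auto simp: Lr_reps_iff)

lemma norm_le_sup_path:
  assumes "continuous_on {0..T} (\<lambda>t. X (\<omega>, t))" "t \<in> {0..T}"
  shows "ennreal (norm (X (\<omega>, t))) \<le> sup_path X \<omega>"
  unfolding sup_path_def SUP_time_dense[OF assms(1), symmetric] using assms(2) by (rule SUP_upper)

lemma bounded_Lpq:
  assumes f: "f \<in> borel_measurable pred" and B: "\<And>z. norm (f z) \<le> B"
  shows "f \<in> Lpq"
proof -
  have B0: "0 \<le> B" using order_trans[OF norm_ge_zero B] .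
  have "nrm f \<le> lpn2 P p time q (\<lambda>z. ennreal B)"
    unfolding nrm_def using B by (intro mx.lpn2_mono ennreal_leI)
  also have "\<dots> < \<top>"
    using B0 T by (simp add: lpn2_def lpn_def emeasure_space_1 emeasure_restrict_space
        space_restrict_space ennreal_mult_less_top)
  finally show ?thesis using f by (simp add: Lpq_iff)
qed

lemma nrm_triangle:
  assumes "f \<in> borel_measurable pred" "g \<in> borel_measurable pred"
    and "\<And>z. z \<in> space P \<times> {0..T} \<Longrightarrow> norm (h z) \<le> norm (f z) + norm (g z)"
  shows "nrm h \<le> nrm f + nrm g"
proof -
  have "nrm h \<le> lpn2 P p time q (\<lambda>z. ennreal (norm (f z)) + ennreal (norm (g z)))"
    unfolding nrm_def using assms(3)
    by (intro mx.lpn2_mono) (auto simp: space_pair_measure simp flip: ennreal_plus)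
  also have "\<dots> \<le> nrm f + nrm g"
    unfolding nrm_def using assms by (intro mx.lpn2_add measurable_norm_P)
  finally show ?thesis .
qed

lemma nrm_scaleR:
  assumes "f \<in> borel_measurable pred"
  shows "nrm (\<lambda>z. c *\<^sub>R f z) = ennreal \<bar>c\<bar> * nrm f"
  unfolding nrm_def using mx.lpn2_cmult[OF measurable_norm_P[OF assms], of "ennreal \<bar>c\<bar>"]
  by (simp add: ennreal_mult)

lemma Lpq_dominated:
  assumes "f \<in> Lpq" "g \<in> Lpq" "h \<in> borel_measurable pred"
    and "\<And>z. norm (h z) \<le> norm (f z) + norm (g z)"
  shows "h \<in> Lpq"
proof -
  have "nrm h \<le> nrm f + nrm g" using assms by (intro nrm_triangle) (auto simp: Lpq_iff)
  also have "\<dots> < \<top>" using assms by (simp add: Lpq_iff)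
  finally show ?thesis using assms by (simp add: Lpq_iff)
qed

lemma Lpq_add: "f \<in> Lpq \<Longrightarrow> g \<in> Lpq \<Longrightarrow> (\<lambda>z. f z + g z) \<in> Lpq"
  by (rule Lpq_dominated[of f g]) (auto simp: Lpq_iff norm_triangle_ineq)

lemma Lpq_diff: "f \<in> Lpq \<Longrightarrow> g \<in> Lpq \<Longrightarrow> (\<lambda>z. f z - g z) \<in> Lpq"
  by (rule Lpq_dominated[of f g]) (auto simp: Lpq_iff norm_triangle_ineq4)

lemma Lpq_scaleR: "f \<in> Lpq \<Longrightarrow> (\<lambda>z. c *\<^sub>R f z) \<in> Lpq"
  using nrm_scaleR[of f c] by (auto simp: Lpq_iff ennreal_mult_less_top)

lemma zero_Lpq: "(\<lambda>z. 0) \<in> Lpq"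
  by (rule bounded_Lpq[where B = 0]) auto

lemma I_Lr: "\<Psi> \<in> Lpq \<Longrightarrow> I \<Psi> \<in> Lr"
  using I by (auto simp: continuous_linear_op_def)

lemma I_cong:
  assumes "\<Psi> \<in> Lpq" "\<Psi>' \<in> Lpq" "AE z in P \<Otimes>\<^sub>M time. \<Psi> z = \<Psi>' z"
  shows "AE \<omega> in P. \<forall>t\<in>{0..T}. I \<Psi> (\<omega>, t) = I \<Psi>' (\<omega>, t)"
  using I assms unfolding continuous_linear_op_def same_path_iff same_Lpq_iff by blast

lemma I_add:
  assumes "\<Psi> \<in> Lpq" "\<Psi>' \<in> Lpq"
  shows "AE \<omega> in P. \<forall>t\<in>{0..T}. I (\<lambda>z. \<Psi> z + \<Psi>' z) (\<omega>, t) = I \<Psi> (\<omega>, t) + I \<Psi>' (\<omega>, t)"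
  using I assms unfolding continuous_linear_op_def same_path_iff by blast

lemma I_scaleR:
  assumes "\<Psi> \<in> Lpq"
  shows "AE \<omega> in P. \<forall>t\<in>{0..T}. I (\<lambda>z. c *\<^sub>R \<Psi> z) (\<omega>, t) = c *\<^sub>R I \<Psi> (\<omega>, t)"
  using I assms unfolding continuous_linear_op_def same_path_iff by blast

lemma I_diff:
  assumes "\<Psi> \<in> Lpq" "\<Psi>' \<in> Lpq"
  shows "AE \<omega> in P. \<forall>t\<in>{0..T}. I (\<lambda>z. \<Psi> z - \<Psi>' z) (\<omega>, t) = I \<Psi> (\<omega>, t) - I \<Psi>' (\<omega>, t)"
  using I_add[OF assms(1) Lpq_scaleR[OF assms(2), of "-1"]] I_scaleR[OF assms(2), of "-1"]
  by eventually_elim simp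

lemma I_zero: "AE \<omega> in P. \<forall>t\<in>{0..T}. I (\<lambda>z. 0) (\<omega>, t) = 0"
  using I_diff[OF zero_Lpq zero_Lpq] by simp

lemma I_compose:
  assumes "\<Psi> \<in> Lpq"
  shows "AE \<omega> in P. \<forall>t\<in>{0..T}. I (\<lambda>z. hs_compose Q (\<Psi> z)) (\<omega>, t) = Q (I \<Psi> (\<omega>, t))"
  using I_commutes[OF assms, of Q] unfolding same_path_iff by (auto elim!: eventually_mono)

text \<open>\<open>op_norm\<close> is a real supremum of ratios: it bounds them only once they are
  known to be bounded, and says nothing where the denominator is 0. Both gaps are filled by the
  constant from continuity of \<open>I\<close>.\<close>

lemma N_bound:
  shows N_nonneg: "0 \<le> N"
    and I_norm: "\<Psi> \<in> Lpq \<Longrightarrow> lpn P r (sup_path (I \<Psi>)) \<le> ennreal N * nrm \<Psi>"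
proof -
  let ?V = "Lpq_space P F T p q :: ('w \<times> real, ('u, 'h) hs_op) class_space"
    and ?W = "Lr_path_space P F T r :: ('w \<times> real, 'h) class_space"
  have cV: "class_norm ?V f = enn2real (nrm f)" for f :: "'w \<times> real \<Rightarrow> ('u, 'h) hs_op"
    by (simp add: Lpq_space_def Lpq_norm_eq[OF p] nrm_def)
  have cW: "class_norm ?W X = enn2real (path_norm P T r X)" for X :: "'w \<times> real \<Rightarrow> 'h"
    by (simp add: Lr_path_space_def)
  obtain K where K: "\<And>f. f \<in> Lpq \<Longrightarrow> class_norm ?W (I f) \<le> class_norm ?V f * K"
    using I unfolding continuous_linear_op_def by blast
  have bdd: "bdd_above ((\<lambda>f. class_norm ?W (I f) / class_norm ?V f) ` Lpq)"
  proof (rule bdd_aboveI2)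
    fix f assume "f \<in> Lpq"
    \<comment> \<open>The constant from continuity may be negative, hence its absolute
      value.\<close>
    then have "class_norm ?W (I f) \<le> class_norm ?V f * \<bar>K\<bar>"
      using K[of f] by (intro order_trans[OF K] mult_left_mono) (auto simp: cV)
    then show "class_norm ?W (I f) / class_norm ?V f \<le> \<bar>K\<bar>"
      by (cases "class_norm ?V f = 0") (auto simp: cV divide_le_eq less_le mult.commute)
  qed
  have ratio: "class_norm ?W (I f) / class_norm ?V f \<le> N" if "f \<in> Lpq" for f
    unfolding N_def op_norm_def by (rule cSUP_upper[OF that bdd])
  have "class_norm ?V (\<lambda>z. 0) = 0" by (simp add: cV nrm_def lpn2_def)
  \<comment> \<open>Division by 0 gives 0, so the ratio at the zero process is 0.\<close>
  then show N: "0 \<le> N" using ratio[OF zero_Lpq] by simp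
  show "lpn P r (sup_path (I \<Psi>)) \<le> ennreal N * nrm \<Psi>" if "\<Psi> \<in> Lpq"
  proof -
    \<comment> \<open>If \<Psi> has norm 0 the ratio is uninformative, and the bound by
      \<open>K\<close> shows that the image has norm 0.\<close>
    have 1: "class_norm ?W (I \<Psi>) \<le> N * class_norm ?V \<Psi>"
      using ratio[OF that] K[OF that]
      by (cases "class_norm ?V \<Psi> = 0") (auto simp: cV divide_le_eq less_le mult.commute)
    have fin: "nrm \<Psi> < \<top>" "lpn P r (sup_path (I \<Psi>)) < \<top>"
      using that I_Lr[OF that] by (simp_all add: Lpq_iff Lr_iff)
    have "lpn P r (sup_path (I \<Psi>)) = ennreal (class_norm ?W (I \<Psi>))"
      using fin(2) path_norm_sup_path[OF Lr_continuous[OF I_Lr[OF that]]] by (simp add: cW)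
    also have "\<dots> \<le> ennreal (N * class_norm ?V \<Psi>)" using 1 by (rule ennreal_leI)
    also have "\<dots> = ennreal N * nrm \<Psi>" using fin(1) N by (simp add: cV ennreal_mult)
    finally show ?thesis .
  qed
qed

text \<open>\<open>Xop Y\<close> convolves paths and \<open>Vop t G\<close> integrands;
  \<open>I\<close> links the two at time t (\<open>step_V\<close>). The factor
  \<open>c\<beta>\<close> is left out of both and multiplied in later.\<close>

definition Xop :: "(real \<Rightarrow> 'w \<times> real \<Rightarrow> 'h) \<Rightarrow> 'w \<times> real \<Rightarrow> 'h" where
  "Xop Y = (\<lambda>(\<omega>, t). \<integral>s. k t s *\<^sub>R Sc (t - s) (Y s (\<omega>, t)) \<partial>time)"

definition Vop :: "real \<Rightarrow> (real \<Rightarrow> 'w \<times> real \<Rightarrow> ('u, 'h) hs_op) \<Rightarrow> 'w \<times> real \<Rightarrow> ('u, 'h) hs_op" where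
  "Vop t G = (\<lambda>z. \<integral>s. k t s *\<^sub>R hs_compose (Sc (t - s)) (G s z) \<partial>time)"

text \<open>Step functions \<open>G\<close> from \<open>[0,T]\<close> to \<open>L\<^bsup>p,q\<^esup>\<close>, paired with a jointly measurable version \<open>Y\<close> of
  \<open>s \<mapsto> I (G s)\<close>. Steps start at \<open>0\<close>, so that convolving against them is continuous in time.\<close>

inductive step :: "(real \<Rightarrow> 'w \<times> real \<Rightarrow> ('u, 'h) hs_op) \<Rightarrow> (real \<Rightarrow> 'w \<times> real \<Rightarrow> 'h) \<Rightarrow> bool" where
  rect: "B \<in> sets pred \<Longrightarrow> step (\<lambda>s z. indicator {..a} s *\<^sub>R (indicator B z *\<^sub>R h))
    (\<lambda>s z. indicator {..a} s *\<^sub>R I (\<lambda>z. indicator B z *\<^sub>R h) z)"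
| diff: "step G Y \<Longrightarrow> step G' Y' \<Longrightarrow> step (\<lambda>s z. G s z - G' s z) (\<lambda>s z. Y s z - Y' s z)"

lemma indicator_Lpq: "B \<in> sets pred \<Longrightarrow> (\<lambda>z. indicator B z *\<^sub>R h) \<in> Lpq"
  by (rule bounded_Lpq[where B = "norm h"]) (auto simp: indicator_def)

lemma measurable_fst_indicator: "(\<lambda>x. indicator {..a} (fst x) :: real) \<in> borel_measurable (time \<Otimes>\<^sub>M M')"
proof -
  have "indicator {..a} \<in> borel_measurable time"
    by (intro measurable_restrict_space1) simp
  then show ?thesis by (rule measurable_compose[OF measurable_fst])
qed

lemma step_G:
  assumes "step G Y"
  shows "(\<lambda>(s, z). G s z) \<in> borel_measurable (time \<Otimes>\<^sub>M pred) \<and> (\<exists>B. \<forall>s z. norm (G s z) \<le> B)"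
  using assms
proof induction
  case (rect B a h)
  have [measurable]: "B \<in> sets pred" by fact
  have "(\<lambda>x. indicator {..a} (fst x) *\<^sub>R (indicator B (snd x) *\<^sub>R h)) \<in> borel_measurable (time \<Otimes>\<^sub>M pred)"
    by (intro borel_measurable_scaleR measurable_fst_indicator) measurable
  moreover have "norm (indicator {..a} s *\<^sub>R (indicator B z *\<^sub>R h)) \<le> norm h" for s z
    by (auto simp: indicator_def)
  ultimately show ?case by (auto simp: case_prod_beta')
next
  case (diff G Y G' Y')
  then obtain B B' where "\<And>s z. norm (G s z) \<le> B" "\<And>s z. norm (G' s z) \<le> B'" by blast
  then have "norm (G s z - G' s z) \<le> B + B'" for s z
    using norm_triangle_ineq4[of "G s z" "G' s z"] by (meson add_mono order_trans)
  moreover have "(\<lambda>x. G (fst x) (snd x) - G' (fst x) (snd x)) \<in> borel_measurable (time \<Otimes>\<^sub>M pred)"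
    using diff by (intro borel_measurable_diff) (auto simp: case_prod_beta')
  ultimately show ?case by (auto simp: case_prod_beta')
qed

lemma joint_slice:
  assumes "(\<lambda>(s, z). G s z) \<in> measurable (time \<Otimes>\<^sub>M M') M''" "s \<in> {0..T}"
  shows "(\<lambda>z. G s z) \<in> measurable M' M''"
  using measurable_compose[OF measurable_Pair1'[of s time M'] assms(1)] assms(2) by simp

lemma joint_slice2:
  assumes "(\<lambda>(s, z). G s z) \<in> measurable (time \<Otimes>\<^sub>M M') M''" "z \<in> space M'"
  shows "(\<lambda>s. G s z) \<in> measurable time M''"
  using measurable_compose[OF measurable_Pair2'[of z M' time] assms(1)] assms(2) by simp

lemma step_G_Lpq:
  assumes "step G Y" "s \<in> {0..T}"
  shows "G s \<in> Lpq"
proof -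
  obtain B where "\<And>z. norm (G s z) \<le> B" using step_G[OF assms(1)] by blast
  then show ?thesis
    using step_G[OF assms(1)] joint_slice[OF _ assms(2)] by (intro bounded_Lpq[where B = B]) auto
qed

lemma step_Y_measurable: "step G Y \<Longrightarrow> (\<lambda>(s, z). Y s z) \<in> borel_measurable (time \<Otimes>\<^sub>M prog)"
proof (induction rule: step.induct)
  case (rect B a h)
  have "I (\<lambda>z. indicator B z *\<^sub>R h) \<in> borel_measurable prog"
    by (rule Lr_measurable[OF I_Lr[OF indicator_Lpq[OF rect]]])
  then have "(\<lambda>x. indicator {..a} (fst x) *\<^sub>R I (\<lambda>z. indicator B z *\<^sub>R h) (snd x)) \<in> borel_measurable (time \<Otimes>\<^sub>M prog)"
    by (intro borel_measurable_scaleR measurable_fst_indicator measurable_compose[OF measurable_snd])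
  then show ?case by (simp add: case_prod_beta')
next
  case (diff G Y G' Y')
  then have "(\<lambda>x. Y (fst x) (snd x) - Y' (fst x) (snd x)) \<in> borel_measurable (time \<Otimes>\<^sub>M prog)"
    by (intro borel_measurable_diff) (auto simp: case_prod_beta')
  then show ?case by (simp add: case_prod_beta')
qed

text \<open>The exceptional null set may depend on s. This is harmless where \<omega> is integrated
  out first for each fixed s, as in \<open>step_bound\<close>.\<close>

lemma step_Y_I: "step G Y \<Longrightarrow> s \<in> {0..T} \<Longrightarrow> AE \<omega> in P. \<forall>t\<in>{0..T}. Y s (\<omega>, t) = I (G s) (\<omega>, t)"
proof (induction rule: step.induct)
  case (rect B a h)
  show ?case
  proof (cases "s \<le> a")
    case False
    then show ?thesis using I_zero by (auto elim!: eventually_mono)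
  qed simp
next
  case (diff G Y G' Y')
  from diff.IH(1)[OF diff.prems] diff.IH(2)[OF diff.prems]
    I_diff[OF step_G_Lpq[OF diff.hyps(1) diff.prems] step_G_Lpq[OF diff.hyps(2) diff.prems]]
  show ?case by eventually_elim auto
qed

text \<open>One null set serves all s, because every \<open>Y s\<close> is built from the same
  finitely many paths of \<open>I\<close>.\<close>

lemma step_Y_path: "step G Y \<Longrightarrow> AE \<omega> in P. (\<forall>s. continuous_on {0..T} (\<lambda>t. Y s (\<omega>, t))) \<and>
    (\<exists>B. \<forall>s. \<forall>t\<in>{0..T}. norm (Y s (\<omega>, t)) \<le> B)"
proof (induction rule: step.induct)
  case (rect B a h)
  from Lr_continuous[OF I_Lr[OF indicator_Lpq[OF rect, of h]]] show ?case
  proof eventually_elim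
    case (elim \<omega>)
    let ?y = "\<lambda>t. I (\<lambda>z. indicator B z *\<^sub>R h) (\<omega>, t)"
    have "bounded (?y ` {0..T})"
      using elim by (intro compact_imp_bounded compact_continuous_image) auto
    then obtain C where "\<forall>x\<in>?y ` {0..T}. norm x \<le> C" unfolding bounded_iff by blast
    then have C: "\<And>t. t \<in> {0..T} \<Longrightarrow> norm (?y t) \<le> C" by blast
    have "norm (indicator {..a} s *\<^sub>R ?y t) \<le> C" if "t \<in> {0..T}" for s :: real and t
      using C[OF that] order_trans[OF norm_ge_zero C[OF that]] by (auto simp: indicator_def)
    moreover have "continuous_on {0..T} (\<lambda>t. indicator {..a} s *\<^sub>R ?y t)" for s :: real
      using elim by (intro continuous_on_scaleR continuous_on_const)
    ultimately show ?case by blast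
  qed
next
  case (diff G Y G' Y')
  from diff.IH show ?case
  proof eventually_elim
    case (elim \<omega>)
    then obtain B B' where "\<And>s t. t \<in> {0..T} \<Longrightarrow> norm (Y s (\<omega>, t)) \<le> B"
      "\<And>s t. t \<in> {0..T} \<Longrightarrow> norm (Y' s (\<omega>, t)) \<le> B'" by blast
    then have "norm (Y s (\<omega>, t) - Y' s (\<omega>, t)) \<le> B + B'" if "t \<in> {0..T}" for s t
      using norm_triangle_ineq4[of "Y s (\<omega>, t)" "Y' s (\<omega>, t)"] that by (meson add_mono order_trans)
    moreover have "continuous_on {0..T} (\<lambda>t. Y s (\<omega>, t) - Y' s (\<omega>, t))" for s
      using elim by (intro continuous_on_diff) auto
    ultimately show ?case by blast
  qed
qed

lemma step_Y_integrable:
  assumes "step G Y" and B: "\<forall>s. \<forall>t\<in>{0..T}. norm (Y s (\<omega>, t)) \<le> B"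
    and \<omega>: "\<omega> \<in> space P" and t: "t \<in> {0..T}"
  shows "integrable time (\<lambda>s. k t s *\<^sub>R Sc (t - s) (Y s (\<omega>, t)))"
proof (rule integrable_k_bounded[OF t])
  have "(\<lambda>s. Y s (\<omega>, t)) \<in> borel_measurable time"
    by (rule joint_slice2[OF step_Y_measurable[OF assms(1)]]) (use \<omega> t in \<open>auto simp: space_prog\<close>)
  then show "(\<lambda>s. Sc (t - s) (Y s (\<omega>, t))) \<in> borel_measurable time" by measurable
  show "norm (Sc (t - s) (Y s (\<omega>, t))) \<le> M * B" for s
    using norm_Sc_apply_le[of "t - s" "Y s (\<omega>, t)"] B t M_nonneg by (meson mult_left_mono order_trans)
qed

lemma step_X_diff:
  assumes "step G Y" "step G' Y'"
  shows "AE \<omega> in P. \<forall>t\<in>{0..T}. Xop (\<lambda>s z. Y s z - Y' s z) (\<omega>, t) = Xop Y (\<omega>, t) - Xop Y' (\<omega>, t)"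
  using step_Y_path[OF assms(1)] step_Y_path[OF assms(2)] AE_space
proof eventually_elim
  case (elim \<omega>)
  then obtain B B' where B: "\<forall>s. \<forall>t\<in>{0..T}. norm (Y s (\<omega>, t)) \<le> B"
    "\<forall>s. \<forall>t\<in>{0..T}. norm (Y' s (\<omega>, t)) \<le> B'" by blast
  show ?case
    using step_Y_integrable[OF assms(1) B(1) elim(3)] step_Y_integrable[OF assms(2) B(2) elim(3)]
    by (simp add: Xop_def blinfun.diff_right scaleR_diff_right)
qed

text \<open>For a rectangle, \<open>Xop Y\<close> at (\<omega>, t) is \<open>Rop a t\<close> applied
  to a fixed continuous path at t, so \<open>continuous_Rop\<close> applies; differences follow by
  induction.\<close>

lemma step_X_continuous: "step G Y \<Longrightarrow> AE \<omega> in P. continuous_on {0..T} (\<lambda>t. Xop Y (\<omega>, t))"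
proof (induction rule: step.induct)
  case (rect B a h)
  from Lr_continuous[OF I_Lr[OF indicator_Lpq[OF rect, of h]]] show ?case
  proof eventually_elim
    case (elim \<omega>)
    from continuous_Rop[OF elim, of a] show ?case
      by (rule continuous_on_eq) (simp add: Rop_apply Xop_def blinfun.scaleR_right)
  qed
next
  case (diff G Y G' Y')
  from diff.IH step_X_diff[OF diff.hyps] show ?case
  proof eventually_elim
    case (elim \<omega>)
    with continuous_on_diff[OF elim(1,2)] show ?case by (auto intro: continuous_on_eq)
  qed
qed

lemma step_G_integrable:
  assumes "step G Y" and z: "z \<in> space P \<times> {0..T}" and t: "t \<in> {0..T}"
  shows "integrable time (\<lambda>s. k t s *\<^sub>R hs_compose (Sc (t - s)) (G s z))"
proof -
  obtain B where B: "\<And>s z. norm (G s z) \<le> B" using step_G[OF assms(1)] by blast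
  show ?thesis
  proof (rule integrable_k_bounded[OF t])
    have "(\<lambda>s. G s z) \<in> borel_measurable time"
      by (rule joint_slice2[OF conjunct1[OF step_G[OF assms(1)]]]) (use z in \<open>auto simp: space_pred\<close>)
    then show "(\<lambda>s. hs_compose (Sc (t - s)) (G s z)) \<in> borel_measurable time" by measurable
    show "norm (hs_compose (Sc (t - s)) (G s z)) \<le> M * B" for s
      using norm_hs_compose[of "Sc (t - s)" "G s z"] norm_Sc_le[of "t - s"] B M_nonneg
      by (meson mult_mono norm_ge_zero order_trans)
  qed
qed

text \<open>For a rectangle, \<open>Vop t\<close> composes the integrand with the single bounded
  operator \<open>Rop a t\<close>, and the commutation hypothesis is used with Q =
  \<open>Rop a t\<close>. Linearity of \<open>I\<close> handles differences.\<close>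

lemma step_V:
  assumes t: "t \<in> {0..T}"
  shows "step G Y \<Longrightarrow> Vop t G \<in> Lpq \<and> (AE \<omega> in P. I (Vop t G) (\<omega>, t) = Xop Y (\<omega>, t))"
proof (induction rule: step.induct)
  case (rect B a h)
  let ?\<Psi> = "\<lambda>z. indicator B z *\<^sub>R h"
  \<comment> \<open>The left side is an integral of Hilbert--Schmidt operators, \<open>Rop\<close> a
    pointwise integral; evaluation at u is bounded linear and compares them.\<close>
  have V: "Vop t (\<lambda>s z. indicator {..a} s *\<^sub>R ?\<Psi> z) z = hs_compose (Rop a t) (?\<Psi> z)"
    if z: "z \<in> space P \<times> {0..T}" for z
  proof (rule hs_op_eqI)
    fix u
    have "step (\<lambda>s z. indicator {..a} s *\<^sub>R ?\<Psi> z) (\<lambda>s z. indicator {..a} s *\<^sub>R I ?\<Psi> z)"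
      using rect by (rule step.rect)
    note int = step_G_integrable[OF this z t]
    have "blinfun_of_hs (Vop t (\<lambda>s z. indicator {..a} s *\<^sub>R ?\<Psi> z) z) u
        = (\<integral>s. blinfun_of_hs (k t s *\<^sub>R hs_compose (Sc (t - s)) (indicator {..a} s *\<^sub>R ?\<Psi> z)) u \<partial>time)"
      unfolding Vop_def by (rule integral_bounded_linear[OF bounded_linear_hs_apply int, symmetric])
    also have "\<dots> = Rop a t (blinfun_of_hs (?\<Psi> z) u)"
      unfolding Rop_apply[OF t]
      by (intro Bochner_Integration.integral_cong refl)
        (simp add: scaleR_hs_op.rep_eq hs_compose.rep_eq blinfun.scaleR_left blinfun.scaleR_right mult_ac)
    finally show "blinfun_of_hs (Vop t (\<lambda>s z. indicator {..a} s *\<^sub>R ?\<Psi> z) z) u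
        = blinfun_of_hs (hs_compose (Rop a t) (?\<Psi> z)) u"
      by (simp add: hs_compose.rep_eq)
  qed
  have RL: "(\<lambda>z. hs_compose (Rop a t) (?\<Psi> z)) \<in> Lpq"
  proof (rule bounded_Lpq)
    have "?\<Psi> \<in> borel_measurable pred" using rect by simp
    then show "(\<lambda>z. hs_compose (Rop a t) (?\<Psi> z)) \<in> borel_measurable pred"
      by (rule borel_measurable_continuous_on[OF linear_continuous_on[OF bounded_linear_hs_compose]])
    show "norm (hs_compose (Rop a t) (?\<Psi> z)) \<le> norm (Rop a t) * norm h" for z
      by (rule order_trans[OF norm_hs_compose]) (auto simp: indicator_def mult_left_mono)
  qed
  have VL: "Vop t (\<lambda>s z. indicator {..a} s *\<^sub>R ?\<Psi> z) \<in> Lpq"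
  proof -
    have "Vop t (\<lambda>s z. indicator {..a} s *\<^sub>R ?\<Psi> z) \<in> borel_measurable pred
        \<longleftrightarrow> (\<lambda>z. hs_compose (Rop a t) (?\<Psi> z)) \<in> borel_measurable pred"
      by (rule measurable_cong) (use V space_pred in auto)
    moreover have "nrm (Vop t (\<lambda>s z. indicator {..a} s *\<^sub>R ?\<Psi> z)) = nrm (\<lambda>z. hs_compose (Rop a t) (?\<Psi> z))"
      unfolding nrm_def using V by (intro mx.lpn2_cong_AE AE_I2) (auto simp: space_pair_measure)
    ultimately show ?thesis using RL by (simp add: Lpq_iff)
  qed
  have "AE z in P \<Otimes>\<^sub>M time. Vop t (\<lambda>s z. indicator {..a} s *\<^sub>R ?\<Psi> z) z = hs_compose (Rop a t) (?\<Psi> z)"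
    using V by (intro AE_I2) (auto simp: space_pair_measure)
  from I_cong[OF VL RL this] I_compose[OF indicator_Lpq[OF rect, of h], of "Rop a t"]
  have "AE \<omega> in P. I (Vop t (\<lambda>s z. indicator {..a} s *\<^sub>R ?\<Psi> z)) (\<omega>, t)
      = Xop (\<lambda>s z. indicator {..a} s *\<^sub>R I ?\<Psi> z) (\<omega>, t)"
  proof eventually_elim
    case (elim \<omega>)
    then show ?case using t by (simp add: Rop_apply Xop_def blinfun.scaleR_right)
  qed
  with VL show ?case by blast
next
  case (diff G Y G' Y')
  have V: "Vop t (\<lambda>s z. G s z - G' s z) z = Vop t G z - Vop t G' z" if z: "z \<in> space P \<times> {0..T}" for z
    using step_G_integrable[OF diff.hyps(1) z t] step_G_integrable[OF diff.hyps(2) z t]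
    by (simp add: Vop_def linear_diff[OF bounded_linear.linear[OF bounded_linear_hs_compose]] scaleR_diff_right)
  have L: "(\<lambda>z. Vop t G z - Vop t G' z) \<in> Lpq" using diff.IH by (intro Lpq_diff) auto
  have VL: "Vop t (\<lambda>s z. G s z - G' s z) \<in> Lpq"
  proof -
    have "Vop t (\<lambda>s z. G s z - G' s z) \<in> borel_measurable pred
        \<longleftrightarrow> (\<lambda>z. Vop t G z - Vop t G' z) \<in> borel_measurable pred"
      by (rule measurable_cong) (use V space_pred in auto)
    moreover have "nrm (Vop t (\<lambda>s z. G s z - G' s z)) = nrm (\<lambda>z. Vop t G z - Vop t G' z)"
      unfolding nrm_def using V by (intro mx.lpn2_cong_AE AE_I2) (auto simp: space_pair_measure)
    ultimately show ?thesis using L by (simp add: Lpq_iff)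
  qed
  have "AE z in P \<Otimes>\<^sub>M time. Vop t (\<lambda>s z. G s z - G' s z) z = Vop t G z - Vop t G' z"
    using V by (intro AE_I2) (auto simp: space_pair_measure)
  from I_cong[OF VL L this] I_diff[OF conjunct1[OF diff.IH(1)] conjunct1[OF diff.IH(2)]]
    conjunct2[OF diff.IH(1)] conjunct2[OF diff.IH(2)]
    step_X_diff[OF diff.hyps]
  have "AE \<omega> in P. I (Vop t (\<lambda>s z. G s z - G' s z)) (\<omega>, t) = Xop (\<lambda>s z. Y s z - Y' s z) (\<omega>, t)"
    by eventually_elim (use t in auto)
  with VL show ?case by blast
qed

lemma step_X_measurable:
  assumes "step G Y"
  shows "Xop Y \<in> borel_measurable prog"
proof -
  have [measurable]: "(\<lambda>x. Y (fst x) (snd x)) \<in> borel_measurable (time \<Otimes>\<^sub>M prog)"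
    using step_Y_measurable[OF assms] by (simp add: case_prod_beta')
  have [measurable]: "(\<lambda>x. snd x) \<in> borel_measurable prog"
    by (rule measurable_compose[OF measurable_snd measurable_restrict_space1]) simp
  have "(\<lambda>y. Y (snd y) (fst y)) \<in> borel_measurable (prog \<Otimes>\<^sub>M time)"
    using measurable_compose[OF measurable_Pair[OF measurable_snd measurable_fst],
        of "\<lambda>x. Y (fst x) (snd x)" time prog borel] by simp
  then have "(\<lambda>y. k (snd (fst y)) (snd y) *\<^sub>R Sc (snd (fst y) - snd y) (Y (snd y) (fst y)))
      \<in> borel_measurable (prog \<Otimes>\<^sub>M time)"
    by measurable
  then have "(\<lambda>z. \<integral>s. k (snd z) s *\<^sub>R Sc (snd z - s) (Y s z) \<partial>time) \<in> borel_measurable prog"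
    by (intro time.borel_measurable_lebesgue_integral) (simp add: case_prod_beta')
  then show ?thesis by (simp add: Xop_def case_prod_beta')
qed

text \<open>For fixed \<omega> the kernel bound controls the supremum over t by the L^r norm in s of
  the path norms of \<open>Y s\<close>. Equal exponents then allow the norms in \<omega> and s to be
  exchanged, and for each s continuity of \<open>I\<close> gives the factor N.\<close>

lemma step_bound:
  assumes st: "step G Y"
  shows "lpn P r (sup_path (Xop Y)) \<le> ennreal (M * K * N) * lpn time r (\<lambda>s. nrm (G s))"
proof -
  let ?g = "\<lambda>s \<omega>. sup_path (Y s) \<omega>"
  have Ym: "(\<lambda>(s, z). Y s z) \<in> borel_measurable (time \<Otimes>\<^sub>M (P \<Otimes>\<^sub>M time))"
    using measurable_joint_prog_P[OF step_Y_measurable[OF st]] .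
  have gm: "(\<lambda>(s, \<omega>). ?g s \<omega>) \<in> borel_measurable (time \<Otimes>\<^sub>M P)"
    unfolding sup_path_def case_prod_beta'
  proof (rule borel_measurable_SUP[OF time_dense(1)])
    fix t assume "t \<in> time_dense T"
    then have [measurable]: "t \<in> space time" using time_dense(2)[of T] by auto
    have "(\<lambda>x. (fst x, snd x, t)) \<in> measurable (time \<Otimes>\<^sub>M P) (time \<Otimes>\<^sub>M (P \<Otimes>\<^sub>M time))" by measurable
    from measurable_compose[OF this Ym]
    show "(\<lambda>x. ennreal (norm (Y (fst x) (snd x, t)))) \<in> borel_measurable (time \<Otimes>\<^sub>M P)" by simp
  qed
  have gm2: "(\<lambda>s. ?g s \<omega>) \<in> borel_measurable time" if "\<omega> \<in> space P" for \<omega>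
    using joint_slice2[OF gm that] .
  have 1: "lpn P r (sup_path (Xop Y)) \<le> lpn P r (\<lambda>\<omega>. ennreal (M * K) * lpn time r (\<lambda>s. ?g s \<omega>))"
  proof (rule lpn_mono_AE[OF _ r_pos(1)], use step_Y_path[OF st] AE_space in eventually_elim)
    case (elim \<omega>)
    then obtain B where B: "\<forall>s. \<forall>t\<in>{0..T}. norm (Y s (\<omega>, t)) \<le> B" by blast
    show ?case
      unfolding sup_path_def[of "Xop Y"]
    proof (rule SUP_least)
      fix t assume "t \<in> time_dense T"
      then have t: "t \<in> {0..T}" using time_dense(2)[of T] by auto
      have "ennreal (norm (Xop Y (\<omega>, t))) \<le> (\<integral>\<^sup>+s. ennreal (norm (k t s *\<^sub>R Sc (t - s) (Y s (\<omega>, t)))) \<partial>time)"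
        unfolding Xop_def prod.case by (rule integral_norm_bound_ennreal[OF step_Y_integrable[OF st B elim(2) t]])
      also have "\<dots> \<le> (\<integral>\<^sup>+s. ennreal M * (ennreal (k t s) * ?g s \<omega>) \<partial>time)"
      proof (rule nn_integral_mono)
        fix s
        have "norm (k t s *\<^sub>R Sc (t - s) (Y s (\<omega>, t))) \<le> k t s * (M * norm (Y s (\<omega>, t)))"
          using norm_Sc_apply_le[of "t - s" "Y s (\<omega>, t)"] by (simp add: k_nonneg mult_left_mono)
        then have "ennreal (norm (k t s *\<^sub>R Sc (t - s) (Y s (\<omega>, t))))
            \<le> ennreal M * (ennreal (k t s) * ennreal (norm (Y s (\<omega>, t))))"
          using M_nonneg k_nonneg[of t s] by (simp add: mult_ac flip: ennreal_mult)
        also have "\<dots> \<le> ennreal M * (ennreal (k t s) * ?g s \<omega>)"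
          using elim t by (intro mult_left_mono norm_le_sup_path) auto
        finally show "ennreal (norm (k t s *\<^sub>R Sc (t - s) (Y s (\<omega>, t)))) \<le> ennreal M * (ennreal (k t s) * ?g s \<omega>)" .
      qed
      also have "\<dots> = ennreal M * (\<integral>\<^sup>+s. ennreal (k t s) * ?g s \<omega> \<partial>time)"
      proof (rule nn_integral_cmult)
        have [measurable]: "(\<lambda>s. ?g s \<omega>) \<in> borel_measurable time" by (rule gm2[OF elim(2)])
        show "(\<lambda>s. ennreal (k t s) * ?g s \<omega>) \<in> borel_measurable time" by measurable
      qed
      \<comment> \<open>The right side is free of t, so it also bounds the supremum.\<close>
      also have "\<dots> \<le> ennreal M * (ennreal K * lpn time r (\<lambda>s. ?g s \<omega>))"
        by (intro mult_left_mono kernel_Hoelder t gm2[OF elim(2)]) auto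
      finally show "ennreal (norm (Xop Y (\<omega>, t))) \<le> ennreal (M * K) * lpn time r (\<lambda>s. ?g s \<omega>)"
        using M_nonneg K_nonneg by (simp add: ennreal_mult mult_ac)
    qed
  qed
  have 2: "lpn P r (\<lambda>\<omega>. ennreal (M * K) * lpn time r (\<lambda>s. ?g s \<omega>))
      = ennreal (M * K) * lpn P r (\<lambda>\<omega>. lpn time r (\<lambda>s. ?g s \<omega>))"
  proof (rule lpn_cmult[OF measurable_lpn[OF sigma_finite_time] r_pos(3)])
    show "(\<lambda>(\<omega>, s). ?g s \<omega>) \<in> borel_measurable (P \<Otimes>\<^sub>M time)"
      using gm by (subst measurable_pair_swap_iff) simp
  qed
  have "lpn P r (\<lambda>\<omega>. lpn time r (\<lambda>s. ?g s \<omega>)) = lpn time r (\<lambda>s. lpn P r (?g s))"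
    by (rule lpn_swap[OF sigma_finite_time sigma_finite_P r_pos(1) gm])
  also have "\<dots> \<le> lpn time r (\<lambda>s. ennreal N * nrm (G s))"
  proof (rule lpn_mono[OF _ r_pos(1)])
    fix s assume "s \<in> space time"
    then have s: "s \<in> {0..T}" by simp
    \<comment> \<open>For this fixed s the measurable version may be replaced by
      \<open>I (G s)\<close>.\<close>
    have "lpn P r (?g s) = lpn P r (sup_path (I (G s)))"
      using step_Y_I[OF st s] time_dense(2)[of T]
      by (intro lpn_cong_AE) (auto elim!: eventually_mono simp: sup_path_def intro!: SUP_cong)
    also have "\<dots> \<le> ennreal N * nrm (G s)" by (rule I_norm[OF step_G_Lpq[OF st s]])
    finally show "lpn P r (?g s) \<le> ennreal N * nrm (G s)" .
  qed
  also have "\<dots> = ennreal N * lpn time r (\<lambda>s. nrm (G s))"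
  proof (rule lpn_cmult[OF _ r_pos(3)])
    have "(\<lambda>(s, z). ennreal (norm (G s z))) \<in> borel_measurable (time \<Otimes>\<^sub>M (P \<Otimes>\<^sub>M time))"
      using measurable_joint_prog_P[OF measurable_joint_pred_prog[OF conjunct1[OF step_G[OF st]]]]
      by (simp add: case_prod_beta')
    then show "(\<lambda>s. nrm (G s)) \<in> borel_measurable time"
      unfolding nrm_def by (rule mx.measurable_lpn2)
  qed
  finally have 3: "lpn P r (\<lambda>\<omega>. lpn time r (\<lambda>s. ?g s \<omega>)) \<le> ennreal N * lpn time r (\<lambda>s. nrm (G s))" .
  have "lpn P r (sup_path (Xop Y)) \<le> ennreal (M * K) * (ennreal N * lpn time r (\<lambda>s. nrm (G s)))"
    using 1 unfolding 2 by (rule order_trans) (intro mult_left_mono 3 zero_le)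
  then show ?thesis
    using M_nonneg K_nonneg N_nonneg by (simp add: ennreal_mult mult_ac)
qed

section \<open>Density of step functions\<close>

abbreviation "joint G \<equiv> (\<lambda>(s, z). G s z) \<in> borel_measurable (time \<Otimes>\<^sub>M pred)"

text \<open>The norm of L^r(0,T; L^{p,q}), written for jointly measurable representatives so that no
  integration of class-valued functions occurs.\<close>

definition mixed :: "(real \<Rightarrow> 'w \<times> real \<Rightarrow> ('u, 'h) hs_op) \<Rightarrow> ennreal" where
  "mixed G = lpn time r (\<lambda>s. nrm (G s))"

lemma joint_norm:
  assumes "joint G"
  shows "(\<lambda>(s, z). ennreal (norm (G s z))) \<in> borel_measurable (time \<Otimes>\<^sub>M (P \<Otimes>\<^sub>M time))"
  using measurable_joint_prog_P[OF measurable_joint_pred_prog[OF assms]] by (simp add: case_prod_beta')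

lemma measurable_nrm: "joint G \<Longrightarrow> (\<lambda>s. nrm (G s)) \<in> borel_measurable time"
  unfolding nrm_def by (rule mx.measurable_lpn2[OF joint_norm])

lemma joint_diff:
  fixes G G' :: "real \<Rightarrow> 'w \<times> real \<Rightarrow> ('u, 'h) hs_op"
  shows "joint G \<Longrightarrow> joint G' \<Longrightarrow> joint (\<lambda>s z. G s z - G' s z)"
  unfolding case_prod_beta' by (rule borel_measurable_diff)

lemma mixed_triangle:
  assumes "joint f" "joint g"
    and "\<And>s z. s \<in> {0..T} \<Longrightarrow> z \<in> space P \<times> {0..T} \<Longrightarrow> norm (h s z) \<le> norm (f s z) + norm (g s z)"
  shows "mixed h \<le> mixed f + mixed g"
proof -
  have "mixed h \<le> lpn time r (\<lambda>s. nrm (f s) + nrm (g s))"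
    unfolding mixed_def using assms
    by (intro lpn_mono[OF _ r_pos(1)] nrm_triangle joint_slice[OF assms(1)] joint_slice[OF assms(2)]) auto
  also have "\<dots> \<le> mixed f + mixed g"
    unfolding mixed_def using assms r_pos by (intro lpn_add sigma_finite_time measurable_nrm)
  finally show ?thesis .
qed

lemma mixed_eq_0:
  assumes "\<And>s z. s \<in> {0..T} \<Longrightarrow> z \<in> space P \<times> {0..T} \<Longrightarrow> G s z = 0"
  shows "mixed G = 0"
proof -
  have "nrm (G s) = 0" if "s \<in> {0..T}" for s
  proof -
    have "nrm (G s) \<le> lpn2 P p time q (\<lambda>z. 0)"
      unfolding nrm_def using assms that by (intro mx.lpn2_mono) (auto simp: space_pair_measure)
    then show ?thesis by (simp add: lpn2_def)
  qed
  then have "mixed G = lpn time r (\<lambda>s. 0)" unfolding mixed_def by (intro lpn_cong) auto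
  then show ?thesis by simp
qed

text \<open>The norm \<open>nrm (G s)\<close> is finite only for a.e. s; for those s dominated
  convergence applies inside, and then once more in s.\<close>

lemma mixed_dominated:
  assumes X: "\<And>n. joint (X n)" and G: "joint G" and fin: "mixed G < \<top>"
    and le: "\<And>n s z. s \<in> {0..T} \<Longrightarrow> z \<in> space P \<times> {0..T} \<Longrightarrow> norm (X n s z) \<le> c * norm (G s z)"
    and lim: "\<And>s z. s \<in> {0..T} \<Longrightarrow> z \<in> space P \<times> {0..T} \<Longrightarrow> (\<lambda>n. X n s z) \<longlonglongrightarrow> 0"
  shows "(\<lambda>n. mixed (X n)) \<longlonglongrightarrow> 0"
proof -
  have le': "ennreal (norm (X n s z)) \<le> ennreal \<bar>c\<bar> * ennreal (norm (G s z))"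
    if "s \<in> {0..T}" "z \<in> space P \<times> {0..T}" for n s z
  proof -
    have "norm (X n s z) \<le> \<bar>c\<bar> * norm (G s z)"
      using le[OF that, of n] by (rule order_trans) (simp add: mult_right_mono)
    then show ?thesis by (simp add: ennreal_leI flip: ennreal_mult)
  qed
  have Gs: "(\<lambda>z. ennreal (norm (G s z))) \<in> borel_measurable (P \<Otimes>\<^sub>M time)" if "s \<in> {0..T}" for s
    by (rule measurable_norm_P[OF joint_slice[OF G that]])
  have cG: "lpn2 P p time q (\<lambda>z. ennreal \<bar>c\<bar> * ennreal (norm (G s z))) = ennreal \<bar>c\<bar> * nrm (G s)"
    if "s \<in> {0..T}" for s
    unfolding nrm_def by (rule mx.lpn2_cmult[OF Gs[OF that]])
  show ?thesis
    unfolding mixed_def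
  proof (rule lpn_dominated_0[where g = "\<lambda>s. ennreal \<bar>c\<bar> * nrm (G s)"])
    show "(\<lambda>s. nrm (X n s)) \<in> borel_measurable time" for n by (rule measurable_nrm[OF X])
    show "(\<lambda>s. ennreal \<bar>c\<bar> * nrm (G s)) \<in> borel_measurable time"
      using measurable_nrm[OF G] by simp
    show "AE s in time. nrm (X n s) \<le> ennreal \<bar>c\<bar> * nrm (G s)" for n
    proof (rule AE_I2)
      fix s assume "s \<in> space time"
      then have s: "s \<in> {0..T}" by simp
      show "nrm (X n s) \<le> ennreal \<bar>c\<bar> * nrm (G s)"
        unfolding cG[OF s, symmetric] unfolding nrm_def
        using le'[OF s] by (intro mx.lpn2_mono) (auto simp: space_pair_measure)
    qed
    show "lpn time r (\<lambda>s. ennreal \<bar>c\<bar> * nrm (G s)) < \<top>"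
      using fin lpn_cmult[OF measurable_nrm[OF G] r_pos(3)] by (simp add: mixed_def ennreal_mult_less_top)
    have "AE s in time. nrm (G s) < \<top>"
      using lpn_finite_AE[OF measurable_nrm[OF G]] fin by (simp add: mixed_def)
    then show "AE s in time. (\<lambda>n. nrm (X n s)) \<longlonglongrightarrow> 0"
      using AE_space
    proof eventually_elim
      case (elim s)
      then have s: "s \<in> {0..T}" by simp
      show ?case
        unfolding nrm_def
      proof (rule mx.lpn2_dominated_0[where g = "\<lambda>z. ennreal \<bar>c\<bar> * ennreal (norm (G s z))"])
        show "(\<lambda>z. ennreal (norm (X n s z))) \<in> borel_measurable (P \<Otimes>\<^sub>M time)" for n
          by (rule measurable_norm_P[OF joint_slice[OF X s]])
        show "(\<lambda>z. ennreal \<bar>c\<bar> * ennreal (norm (G s z))) \<in> borel_measurable (P \<Otimes>\<^sub>M time)"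
          using Gs[OF s] by simp
        show "lpn2 P p time q (\<lambda>z. ennreal \<bar>c\<bar> * ennreal (norm (G s z))) < \<top>"
          using elim(1) cG[OF s] by (simp add: ennreal_mult_less_top)
        show "(\<lambda>n. ennreal (norm (X n s z))) \<longlonglongrightarrow> 0" if "z \<in> space (P \<Otimes>\<^sub>M time)" for z
          using lim[OF s, of z] that tendsto_norm_zero tendsto_ennrealI[of _ 0]
          by (fastforce simp: space_pair_measure)
      qed (use le'[OF s] in \<open>auto simp: space_pair_measure\<close>)
    qed
  qed (rule r_pos)
qed

definition approx :: "(real \<Rightarrow> 'w \<times> real \<Rightarrow> ('u, 'h) hs_op) \<Rightarrow> bool" where
  "approx G \<longleftrightarrow> joint G \<and> (\<forall>e>0. \<exists>G' Y'. step G' Y' \<and> mixed (\<lambda>s z. G s z - G' s z) < ennreal e)"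

lemma step_zero: "\<exists>Y. step (\<lambda>s z. 0) Y"
proof -
  from step.rect[OF sets.empty_sets, of 0 0]
  have "step (\<lambda>s z. 0) (\<lambda>s z. indicator {..0} s *\<^sub>R I (\<lambda>z. indicator {} z *\<^sub>R 0) z)" by simp
  then show ?thesis by blast
qed

text \<open>G + G' = G - (0 - G'), the inductive definition being closed under differences.\<close>

lemma step_add:
  assumes "step G Y" "step G' Y'"
  shows "\<exists>Z. step (\<lambda>s z. G s z + G' s z) Z"
proof -
  obtain Y0 where "step (\<lambda>s z. 0) Y0" using step_zero by blast
  from step.diff[OF assms(1) step.diff[OF this assms(2)]] show ?thesis by auto
qed

lemma approx_step: "step G Y \<Longrightarrow> approx G"
  unfolding approx_def
proof (intro conjI allI impI)
  show "joint G" if "step G Y" using step_G[OF that] ..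
  show "\<exists>G' Y'. step G' Y' \<and> mixed (\<lambda>s z. G s z - G' s z) < ennreal e" if "step G Y" "0 < e" for e
    by (intro exI[of _ G] exI[of _ Y] conjI) (use that in \<open>simp_all add: mixed_eq_0\<close>)
qed

lemma approx_cong:
  assumes G: "approx G" and eq: "\<And>s z. s \<in> {0..T} \<Longrightarrow> z \<in> space P \<times> {0..T} \<Longrightarrow> G s z = G' s z"
  shows "approx G'"
proof -
  have "joint G' \<longleftrightarrow> joint G"
    by (rule measurable_cong) (auto simp: space_pair_measure space_pred eq)
  moreover have "mixed (\<lambda>s z. G' s z - H s z) = mixed (\<lambda>s z. G s z - H s z)" for H
    unfolding mixed_def nrm_def
    by (intro lpn_cong mx.lpn2_cong_AE AE_I2) (auto simp: space_pair_measure eq)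
  ultimately show ?thesis using G by (simp add: approx_def)
qed

lemma approx_add:
  assumes G: "approx G" and G': "approx G'"
  shows "approx (\<lambda>s z. G s z + G' s z)"
  unfolding approx_def
proof (intro conjI allI impI)
  show "joint (\<lambda>s z. G s z + G' s z)"
    using G G' unfolding approx_def case_prod_beta' by (intro borel_measurable_add) auto
  fix e :: real assume "0 < e"
  then have e2: "0 < e / 2" by simp
  obtain H Y where H: "step H Y" "mixed (\<lambda>s z. G s z - H s z) < ennreal (e / 2)"
    using G e2 unfolding approx_def by blast
  obtain H' Y' where H': "step H' Y'" "mixed (\<lambda>s z. G' s z - H' s z) < ennreal (e / 2)"
    using G' e2 unfolding approx_def by blast
  obtain Z where Z: "step (\<lambda>s z. H s z + H' s z) Z" using step_add[OF H(1) H'(1)] by blast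
  have "mixed (\<lambda>s z. G s z + G' s z - (H s z + H' s z))
      \<le> mixed (\<lambda>s z. G s z - H s z) + mixed (\<lambda>s z. G' s z - H' s z)"
    using G G' step_G[OF H(1)] step_G[OF H'(1)]
    by (intro mixed_triangle joint_diff) (auto simp: approx_def norm_diff_triangle_ineq)
  also have "\<dots> < ennreal (e / 2 + e / 2)" using H H' by (intro add_mono_ennreal)
  also have "e / 2 + e / 2 = e" by simp
  finally show "\<exists>H Y. step H Y \<and> mixed (\<lambda>s z. G s z + G' s z - H s z) < ennreal e" using Z by blast
qed

lemma approx_limit:
  assumes X: "\<And>n. approx (X n)" and G: "joint G"
    and lim: "(\<lambda>n::nat. mixed (\<lambda>s z. G s z - X n s z)) \<longlonglongrightarrow> 0"
  shows "approx G"
  unfolding approx_def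
proof (intro conjI allI impI)
  fix e :: real assume "0 < e"
  then have e2: "0 < e / 2" by simp
  obtain n where n: "mixed (\<lambda>s z. G s z - X n s z) < ennreal (e / 2)"
    using order_tendstoD(2)[OF lim, of "ennreal (e / 2)"] e2 by (auto simp: eventually_sequentially)
  obtain H Y where H: "step H Y" "mixed (\<lambda>s z. X n s z - H s z) < ennreal (e / 2)"
    using X[of n] e2 unfolding approx_def by blast
  have "mixed (\<lambda>s z. G s z - H s z) \<le> mixed (\<lambda>s z. G s z - X n s z) + mixed (\<lambda>s z. X n s z - H s z)"
  proof (rule mixed_triangle[OF joint_diff joint_diff])
    show "norm (G s z - H s z) \<le> norm (G s z - X n s z) + norm (X n s z - H s z)" for s z
      using norm_triangle_ineq[of "G s z - X n s z" "X n s z - H s z"] by simp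
  qed (use G X[of n] step_G[OF H(1)] in \<open>auto simp: approx_def\<close>)
  also have "\<dots> < ennreal (e / 2 + e / 2)" using H n by (intro add_mono_ennreal)
  also have "e / 2 + e / 2 = e" by simp
  finally show "\<exists>H Y. step H Y \<and> mixed (\<lambda>s z. G s z - H s z) < ennreal e" using H by blast
qed (rule G)

lemma mixed_const: "mixed (\<lambda>s z. h) < \<top>"
proof -
  have "nrm (\<lambda>z. h) < \<top>" using bounded_Lpq[of "\<lambda>z. h" "norm h"] by (simp add: Lpq_iff)
  then show ?thesis
    using T by (auto simp: mixed_def lpn_def emeasure_restrict_space space_restrict_space ennreal_mult_less_top)
qed

text \<open>These generators are intersection-stable, and on the domain their indicators are the
  rectangles of \<open>step\<close>; this prepares the induction over measurable sets.\<close>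

lemma sets_time_pred:
  "sets (time \<Otimes>\<^sub>M pred) = sigma_sets ({0..T} \<times> space pred)
     {({..a} \<inter> {0..T}) \<times> B |a B. B \<in> sets pred}"
proof -
  let ?E = "{{..a} \<inter> {0..T} |a. True}"
  \<comment> \<open>Traces of half-lines on [0,T] generate the trace of the Borel
    \<sigma>-algebra.\<close>
  have time_gen: "sets time = sigma_sets (space time) ?E"
  proof -
    have "sets time = (\<inter>) {0..T} ` sigma_sets UNIV (range atMost)"
      unfolding sets_restrict_space sets_lborel borel_eq_atMost by (subst sets_measure_of) auto
    also have "\<dots> = sigma_sets {0..T} ((\<inter>) {0..T} ` range atMost)"
    proof (rule sigma_sets_Int)
      have "{0..T} \<in> sets (borel :: real measure)" by simp
      then show "{0..T} \<in> sigma_sets UNIV (range atMost)"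
        unfolding borel_eq_atMost by (subst (asm) sets_measure_of) auto
    qed simp
    also have "(\<inter>) {0..T} ` range atMost = ?E"
      unfolding image_image Int_commute[of "{0..T}"] by blast
    finally show ?thesis by simp
  qed
  have "sets (time \<Otimes>\<^sub>M pred) = sets (sigma (space time \<times> space pred) {a \<times> b |a b. a \<in> ?E \<and> b \<in> sets pred})"
  proof (rule sets_pair_eq)
    show "?E \<subseteq> Pow (space time)" by auto
    show "sets time = sigma_sets (space time) ?E" by (rule time_gen)
    show "countable {{..T} \<inter> {0..T}}" "\<Union>{{..T} \<inter> {0..T}} = space time" by auto
    show "{{..T} \<inter> {0..T}} \<subseteq> ?E" by blast
    show "sets pred \<subseteq> Pow (space pred)" by (rule sets.space_closed)
    show "sets pred = sigma_sets (space pred) (sets pred)" by (rule sets.sigma_sets_eq[symmetric])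
    show "countable {space pred}" "{space pred} \<subseteq> sets pred" "\<Union>{space pred} = space pred" by auto
  qed
  also have "\<dots> = sigma_sets ({0..T} \<times> space pred) {a \<times> b |a b. a \<in> ?E \<and> b \<in> sets pred}"
    using sets.space_closed[of pred] by (subst sets_measure_of) auto
  also have "{a \<times> b |a b. a \<in> ?E \<and> b \<in> sets pred} = {({..a} \<inter> {0..T}) \<times> B |a B. B \<in> sets pred}" by blast
  finally show ?thesis .
qed

lemma joint_indicator:
  fixes h :: "('u, 'h) hs_op"
  assumes "E \<in> sets (time \<Otimes>\<^sub>M pred)"
  shows "joint (\<lambda>s z. indicator E (s, z) *\<^sub>R h)"
proof -
  have "(\<lambda>x. indicator E x *\<^sub>R h) \<in> borel_measurable (time \<Otimes>\<^sub>M pred)"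
    using assms by (intro borel_measurable_scaleR borel_measurable_indicator) simp_all
  then show ?thesis by (simp add: case_prod_beta')
qed

text \<open>Dynkin's argument: the sets with approximable indicators contain an intersection-stable
  generator and are closed under complements and countable disjoint unions.\<close>

lemma approx_indicator:
  assumes "E \<in> sets (time \<Otimes>\<^sub>M pred)"
  shows "approx (\<lambda>s z. indicator E (s, z) *\<^sub>R h)"
proof -
  let ?\<Omega> = "{0..T} \<times> space pred" and ?G = "{({..a} \<inter> {0..T}) \<times> B |a B. B \<in> sets pred}"
  have rect: "approx (\<lambda>s z. indicator (({..a} \<inter> {0..T}) \<times> B) (s, z) *\<^sub>R h)" if "B \<in> sets pred" for a B h
    by (rule approx_cong[OF approx_step[OF step.rect[OF that, of a h]]]) (auto simp: indicator_def)
  have "Int_stable ?G"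
  proof (rule Int_stableI)
    fix A A' assume "A \<in> ?G" "A' \<in> ?G"
    then obtain a B a' B' where AA': "A = ({..a} \<inter> {0..T}) \<times> B" "B \<in> sets pred"
      "A' = ({..a'} \<inter> {0..T}) \<times> B'" "B' \<in> sets pred" by auto
    then have "A \<inter> A' = ({..min a a'} \<inter> {0..T}) \<times> (B \<inter> B')" by auto
    then show "A \<inter> A' \<in> ?G" using AA' by blast
  qed
  moreover have "?G \<subseteq> Pow ?\<Omega>" using sets.sets_into_space[of _ pred] by blast
  moreover have "E \<in> sigma_sets ?\<Omega> ?G" using assms by (simp add: sets_time_pred)
  ultimately show ?thesis
  proof (induction E rule: sigma_sets_induct_disjoint)
    case (basic A)
    then show ?case using rect by auto
  next
    case empty
    then show ?case using rect[of "{}" 0 0] by simp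
  next
    case (compl A)
    have "space pred \<in> sets pred" by simp
    have neg: "approx (\<lambda>s z. - (indicator A (s, z) *\<^sub>R h))"
      unfolding approx_def
    proof (intro conjI allI impI)
      show "joint (\<lambda>s z. - (indicator A (s, z) *\<^sub>R h))"
        using compl(2) unfolding approx_def case_prod_beta' by (intro borel_measurable_uminus) auto
      fix e :: real assume "0 < e"
      then obtain H Y where H: "step H Y" "mixed (\<lambda>s z. indicator A (s, z) *\<^sub>R h - H s z) < ennreal e"
        using compl(2) unfolding approx_def by blast
      obtain Y0 where "step (\<lambda>s z. 0) Y0" using step_zero by blast
      from step.diff[OF this H(1)] have "step (\<lambda>s z. - H s z) (\<lambda>s z. Y0 s z - Y s z)" by simp
      moreover have "mixed (\<lambda>s z. - (indicator A (s, z) *\<^sub>R h) - - H s z) < ennreal e"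
        using H(2) by (simp add: mixed_def nrm_def norm_minus_commute)
      ultimately show "\<exists>H Y. step H Y \<and> mixed (\<lambda>s z. - (indicator A (s, z) *\<^sub>R h) - H s z) < ennreal e"
        by (intro exI conjI)
    qed
    \<comment> \<open>The rectangle with a = T and B = \<open>space pred\<close> is constantly h on
      the domain; subtracting the indicator of A leaves that of the complement.\<close>
    show ?case
      by (rule approx_cong[OF approx_add[OF rect[OF \<open>space pred \<in> sets pred\<close>, of T h] neg]])
        (auto simp: indicator_def space_pred)
  next
    case (union A)
    have A: "A i \<in> sets (time \<Otimes>\<^sub>M pred)" for i using union(2) by (auto simp: sets_time_pred)
    have sum: "approx (\<lambda>s z. \<Sum>i<n. indicator (A i) (s, z) *\<^sub>R h)" for n
    proof (induction n)
      case 0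
      then show ?case using rect[of "{}" 0 0] by simp
    next
      case (Suc n)
      then show ?case using approx_add[OF Suc union(3)[of n]] by simp
    qed
    have ind: "(\<Sum>i<n. indicator (A i) x *\<^sub>R h) = indicator (\<Union>i<n. A i) x *\<^sub>R h" for n x
    proof -
      have "(indicator (\<Union>i<n. A i) x :: real) = (\<Sum>i<n. indicator (A i) x)"
        using union(1) by (intro indicator_UN_disjoint) (auto simp: disjoint_family_on_def)
      then show ?thesis by (simp add: scaleR_sum_left)
    qed
    have UA: "(\<Union>i. A i) \<in> sets (time \<Otimes>\<^sub>M pred)" using A by auto
    show ?case
    proof (rule approx_limit[OF sum joint_indicator[OF UA]])
      show "(\<lambda>n. mixed (\<lambda>s z. indicator (\<Union>i. A i) (s, z) *\<^sub>R h - (\<Sum>i<n. indicator (A i) (s, z) *\<^sub>R h))) \<longlonglongrightarrow> 0"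
      \<comment> \<open>The remainders are bounded by |h|, a constant of finite norm, and at each
        point they are eventually 0.\<close>
      proof (rule mixed_dominated[where G = "\<lambda>s z. h" and c = 1])
        show "joint (\<lambda>s z. indicator (\<Union>i. A i) (s, z) *\<^sub>R h - (\<Sum>i<n. indicator (A i) (s, z) *\<^sub>R h))" for n
          by (rule joint_diff[OF joint_indicator[OF UA]]) (use sum in \<open>simp add: approx_def\<close>)
        show "norm (indicator (\<Union>i. A i) (s, z) *\<^sub>R h - (\<Sum>i<n. indicator (A i) (s, z) *\<^sub>R h)) \<le> 1 * norm h" for n s z
          unfolding ind by (auto simp: indicator_def)
        show "(\<lambda>n. indicator (\<Union>i. A i) (s, z) *\<^sub>R h - (\<Sum>i<n. indicator (A i) (s, z) *\<^sub>R h)) \<longlonglongrightarrow> 0" for s z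
          unfolding ind
        proof (rule tendsto_eventually)
          show "\<forall>\<^sub>F n in sequentially. indicator (\<Union>i. A i) (s, z) *\<^sub>R h - indicator (\<Union>i<n. A i) (s, z) *\<^sub>R h = 0"
          proof (cases "(s, z) \<in> (\<Union>i. A i)")
            case True
            then obtain i where i: "(s, z) \<in> A i" by auto
            show ?thesis using eventually_gt_at_top[of i]
              by eventually_elim (use i in \<open>auto simp: indicator_def\<close>)
          next
            case False
            then show ?thesis by (auto simp: indicator_def)
          qed
        qed
      qed (simp_all add: mixed_const)
    qed
  qed
qed

text \<open>G is a pointwise limit of simple functions dominated by a multiple of G, and each of
  these is a finite sum of indicators with fixed operator values.\<close>

lemma approx_joint:
  assumes G: "joint G" and fin: "mixed G < \<top>"
  shows "approx G"
proof -
  obtain f where f: "\<And>i. simple_function (time \<Otimes>\<^sub>M pred) (f i)"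
    "\<And>x. x \<in> space (time \<Otimes>\<^sub>M pred) \<Longrightarrow> (\<lambda>i. f i x) \<longlonglongrightarrow> (case x of (s, z) \<Rightarrow> G s z)"
    "\<And>i x. x \<in> space (time \<Otimes>\<^sub>M pred) \<Longrightarrow> dist (f i x) 0 \<le> 2 * dist (case x of (s, z) \<Rightarrow> G s z) 0"
    using borel_measurable_implies_sequence_metric[OF G, of 0] by metis
  have sp: "(s, z) \<in> space (time \<Otimes>\<^sub>M pred)" if "s \<in> {0..T}" "z \<in> space P \<times> {0..T}" for s z
    using that by (simp add: space_pair_measure space_pred)
  have Fa: "approx (\<lambda>s z. f n (s, z))" for n
  proof -
    let ?\<Omega> = "space (time \<Otimes>\<^sub>M pred)"
    let ?E = "\<lambda>y. f n -` {y} \<inter> ?\<Omega>"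
    have fin: "finite (f n ` ?\<Omega>)" by (rule simple_functionD(1)[OF f(1)])
    have "approx (\<lambda>s z. \<Sum>y\<in>J. indicator (?E y) (s, z) *\<^sub>R y)" if "finite J" for J
      using that
    proof induction
      case empty
      show ?case using approx_step step_zero by auto
    next
      case (insert y J)
      then show ?case
        using approx_add[OF approx_indicator[OF simple_functionD(2)[OF f(1)[of n], of "{y}"], of y] insert.IH]
        insert.hyps by (simp del: sum_indicator_scaleR indicator_simps)
    qed
    from this[OF fin] show ?thesis
    proof (rule approx_cong)
      fix s z assume "s \<in> {0..T}" "z \<in> space P \<times> {0..T}"
      then have x: "(s, z) \<in> ?\<Omega>" by (rule sp)
      have "(\<Sum>y\<in>f n ` ?\<Omega>. indicator (?E y) (s, z) *\<^sub>R y) = (\<Sum>y\<in>f n ` ?\<Omega>. if y = f n (s, z) then y else 0)"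
        using x by (intro sum.cong) (auto simp: indicator_def)
      also have "\<dots> = f n (s, z)" using fin x by simp
      finally show "(\<Sum>y\<in>f n ` ?\<Omega>. indicator (?E y) (s, z) *\<^sub>R y) = f n (s, z)" .
    qed
  qed
  show ?thesis
  proof (rule approx_limit[OF Fa G])
    show "(\<lambda>n. mixed (\<lambda>s z. G s z - f n (s, z))) \<longlonglongrightarrow> 0"
    \<comment> \<open>From |f n| \<le> 2 |G| follows |G - f n| \<le> 3 |G|.\<close>
    proof (rule mixed_dominated[where c = 3, OF _ G fin])
      show "joint (\<lambda>s z. G s z - f n (s, z))" for n
        by (rule joint_diff[OF G]) (use Fa in \<open>simp add: approx_def\<close>)
      fix s z assume "s \<in> {0..T}" "z \<in> space P \<times> {0..T}"
      then have x: "(s, z) \<in> space (time \<Otimes>\<^sub>M pred)" by (rule sp)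
      show "norm (G s z - f n (s, z)) \<le> 3 * norm (G s z)" for n
        using f(3)[OF x, of n] norm_triangle_ineq4[of "G s z" "f n (s, z)"] by simp
      show "(\<lambda>n. G s z - f n (s, z)) \<longlonglongrightarrow> 0"
        using tendsto_diff[OF tendsto_const f(2)[OF x], of "G s z"] by simp
    qed
  qed
qed

section \<open>The factorized integrand\<close>

abbreviation strongly_measurable :: "('w \<times> real \<Rightarrow> 'u \<Rightarrow>\<^sub>L 'h) \<Rightarrow> bool" where
  "strongly_measurable \<Phi> \<equiv> (\<forall>u. (\<lambda>z. blinfun_apply (\<Phi> z) u) \<in> borel_measurable pred)"

text \<open>The argument t is the intermediate time, called s in the overview, and
  \<open>snd z\<close> is u. The value is infinite where the operator is not Hilbert--Schmidt,
  whereas \<open>factorized\<close> is then 0; hence it dominates the norm of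
  \<open>factorized\<close>.\<close>

definition hs_weight :: "('w \<times> real \<Rightarrow> 'u \<Rightarrow>\<^sub>L 'h) \<Rightarrow> real \<Rightarrow> 'w \<times> real \<Rightarrow> ennreal" where
  "hs_weight \<Phi> t z = (if snd z < t then ennreal ((t - snd z) powr (- \<beta>)) * hs_enorm (Sc (t - snd z) o\<^sub>L \<Phi> z) else 0)"

definition factorized :: "('w \<times> real \<Rightarrow> 'u \<Rightarrow>\<^sub>L 'h) \<Rightarrow> real \<Rightarrow> 'w \<times> real \<Rightarrow> ('u, 'h) hs_op" where
  "factorized \<Phi> t z = (if snd z < t then (t - snd z) powr (- \<beta>) *\<^sub>R to_hs (Sc (t - snd z) o\<^sub>L \<Phi> z) else 0)"

text \<open>The time variable is predictable, since its sublevel sets are unions of generators.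
  Deterministic cut-offs, weights and S(t - u) therefore preserve predictability.\<close>

lemma measurable_snd_pred [measurable]: "(\<lambda>z. snd z) \<in> borel_measurable pred"
proof (rule borel_measurableI_le)
  fix y :: real
  have gen: "{A \<times> {0} |A. A \<in> sets (F 0)} \<union>
      {A \<times> {s<..t} |A s t. 0 \<le> s \<and> s \<le> t \<and> t \<le> T \<and> A \<in> sets (F s)} \<subseteq> sets pred" (is "?G \<subseteq> _")
    unfolding predictable_algebra_def using in_measure_of[OF predictable_generator] by blast
  have F0: "space P \<in> sets (F 0)" using sets.top[of "F 0"] F_subalgebra(1)[of 0] T by simp
  show "{z \<in> space pred. snd z \<le> y} \<in> sets pred"
  proof (cases "y < 0")
    case True
    then have empty: "{z \<in> space pred. snd z \<le> y} = {}" by (auto simp: space_pred)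
    show ?thesis unfolding empty by simp
  next
    case False
    have "{z \<in> space pred. snd z \<le> y} = space P \<times> {0} \<union> space P \<times> {0<..min y T}"
      using T False by (auto simp: space_pred)
    moreover have "space P \<times> {0} \<in> sets pred" using F0 by (intro subsetD[OF gen]) blast
    moreover have "space P \<times> {0<..min y T} \<in> sets pred"
      using F0 T False by (intro subsetD[OF gen] UnI2 CollectI exI[of _ "space P"] exI[of _ 0]
          exI[of _ "min y T"]) auto
    ultimately show ?thesis by simp
  qed
qed

lemma measurable_fst_time [measurable]: "(\<lambda>x. fst x) \<in> borel_measurable (time \<Otimes>\<^sub>M M')"
  by (rule measurable_compose[OF measurable_fst borel_measurable_time_id])

lemma measurable_snd_snd [measurable]: "(\<lambda>x. snd (snd x)) \<in> borel_measurable (time \<Otimes>\<^sub>M pred)"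
  by (rule measurable_compose[OF measurable_snd measurable_snd_pred])

lemma strongly_measurable_Sc:
  assumes "strongly_measurable \<Phi>"
  shows "(\<lambda>x. (Sc (fst x - snd (snd x)) o\<^sub>L \<Phi> (snd x)) e) \<in> borel_measurable (time \<Otimes>\<^sub>M pred)"
proof -
  have [measurable]: "(\<lambda>x. \<Phi> (snd x) e) \<in> borel_measurable (time \<Otimes>\<^sub>M pred)"
    using assms by (intro measurable_compose[OF measurable_snd, of "\<lambda>z. \<Phi> z e"]) auto
  have "(\<lambda>x. Sc (fst x - snd (snd x)) (\<Phi> (snd x) e)) \<in> borel_measurable (time \<Otimes>\<^sub>M pred)"
    by measurable
  then show ?thesis by simp
qed

lemma joint_hs_weight:
  assumes "strongly_measurable \<Phi>"
  shows "(\<lambda>(t, z). hs_weight \<Phi> t z) \<in> borel_measurable (time \<Otimes>\<^sub>M pred)"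
proof -
  have [measurable]: "(\<lambda>x. hs_enorm (Sc (fst x - snd (snd x)) o\<^sub>L \<Phi> (snd x))) \<in> borel_measurable (time \<Otimes>\<^sub>M pred)"
    by (rule measurable_hs_enorm[OF strongly_measurable_Sc[OF assms]])
  show ?thesis unfolding hs_weight_def case_prod_beta' by measurable
qed

lemma joint_hs_weight_P:
  assumes "strongly_measurable \<Phi>"
  shows "(\<lambda>(t, z). hs_weight \<Phi> t z) \<in> borel_measurable (time \<Otimes>\<^sub>M (P \<Otimes>\<^sub>M time))"
  by (rule measurable_joint_prog_P[OF measurable_joint_pred_prog[OF joint_hs_weight[OF assms]]])

lemma hs_weight_slice:
  assumes "strongly_measurable \<Phi>" "t \<in> {0..T}"
  shows "hs_weight \<Phi> t \<in> borel_measurable (P \<Otimes>\<^sub>M time)"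
  using joint_slice[OF joint_hs_weight_P[OF assms(1)] assms(2)] .

lemma joint_factorized:
  assumes "strongly_measurable \<Phi>"
  shows "joint (factorized \<Phi>)"
proof -
  have [measurable]: "(\<lambda>x. to_hs (Sc (fst x - snd (snd x)) o\<^sub>L \<Phi> (snd x))) \<in> borel_measurable (time \<Otimes>\<^sub>M pred)"
    by (rule measurable_to_hs[OF strongly_measurable_Sc[OF assms]])
  show ?thesis unfolding factorized_def case_prod_beta' by measurable
qed

text \<open>The weight (t - s)^(-\<beta> q) is the q-th power of one that can be moved inside the
  norm over \<omega>, and the varying domain [0,t] becomes a cut-off on [0,T]. The norm of \<Phi> is
  then an iterated norm of one jointly measurable function.\<close>

lemma Lambda_norm_eq:
  assumes "strongly_measurable \<Phi>"
  shows "Lambda_norm P T p q r S \<beta> \<Phi> = lpn time r (\<lambda>t. lpn2 P p time q (hs_weight \<Phi> t))"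
proof -
  have inner: "(\<integral>\<^sup>+s. ennreal ((t - s) powr (- \<beta> * q)) *
      epowr (\<integral>\<^sup>+\<omega>. epowr (hs_enorm (S (t - s) o\<^sub>L \<Phi> (\<omega>, s))) p \<partial>P) (q / p) \<partial>restrict_space lborel {0..t})
      = (\<integral>\<^sup>+s. epowr (lpn P p (\<lambda>\<omega>. hs_weight \<Phi> t (\<omega>, s))) q \<partial>time)" if t: "t \<in> {0..T}" for t
    unfolding nn_integral_time
  proof (intro nn_integral_cong)
    fix s
    show "ennreal ((t - s) powr (- \<beta> * q)) *
        epowr (\<integral>\<^sup>+\<omega>. epowr (hs_enorm (S (t - s) o\<^sub>L \<Phi> (\<omega>, s))) p \<partial>P) (q / p) * indicator {0..t} s
        = epowr (lpn P p (\<lambda>\<omega>. hs_weight \<Phi> t (\<omega>, s))) q * indicator {0..T} s"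
    proof (cases "s \<in> {0..<t}")
      case True
      then have Ss: "Sc (t - s) = S (t - s)" using t by (intro Sc_eq) auto
      have "(\<lambda>x. (Sc (t - snd x) o\<^sub>L \<Phi> x) e) \<in> borel_measurable pred" for e
      proof -
        have [measurable]: "(\<lambda>z. \<Phi> z e) \<in> borel_measurable pred" using assms by auto
        have "(\<lambda>x. Sc (t - snd x) (\<Phi> x e)) \<in> borel_measurable pred" by measurable
        then show ?thesis by simp
      qed
      then have "(\<lambda>x. hs_enorm (Sc (t - snd x) o\<^sub>L \<Phi> x)) \<in> borel_measurable (P \<Otimes>\<^sub>M time)"
        by (intro measurable_pred_P measurable_hs_enorm)
      from mx.measurable_slice[OF this, of s]
      have m: "(\<lambda>\<omega>. hs_enorm (S (t - s) o\<^sub>L \<Phi> (\<omega>, s))) \<in> borel_measurable P"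
        using True t by (simp add: Ss)
      have "lpn P p (\<lambda>\<omega>. hs_weight \<Phi> t (\<omega>, s))
          = ennreal ((t - s) powr (- \<beta>)) * lpn P p (\<lambda>\<omega>. hs_enorm (S (t - s) o\<^sub>L \<Phi> (\<omega>, s)))"
        using True lpn_cmult[OF m, of p "ennreal ((t - s) powr (- \<beta>))"] mx.pos
        by (simp add: hs_weight_def Ss)
      then have "epowr (lpn P p (\<lambda>\<omega>. hs_weight \<Phi> t (\<omega>, s))) q = ennreal ((t - s) powr (- \<beta> * q)) *
          epowr (\<integral>\<^sup>+\<omega>. epowr (hs_enorm (S (t - s) o\<^sub>L \<Phi> (\<omega>, s))) p \<partial>P) (q / p)"
        by (simp add: epowr_mult epowr_ennreal powr_powr lpn_def epowr_epowr)
      then show ?thesis using True t by (auto simp: indicator_def)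
    next
      case False
      \<comment> \<open>At s = t the weight is a power of 0, which has value 0, so the domains [0,t]
        and [0,t) agree even pointwise.\<close>
      then show ?thesis by (cases "s = t") (auto simp: hs_weight_def indicator_def)
    qed
  qed
  have "(\<integral>\<^sup>+t. epowr (\<integral>\<^sup>+s. ennreal ((t - s) powr (- \<beta> * q)) *
      epowr (\<integral>\<^sup>+\<omega>. epowr (hs_enorm (S (t - s) o\<^sub>L \<Phi> (\<omega>, s))) p \<partial>P) (q / p)
        \<partial>restrict_space lborel {0..t}) (r / q) \<partial>time)
      = (\<integral>\<^sup>+t. epowr (lpn2 P p time q (hs_weight \<Phi> t)) r \<partial>time)"
  proof (rule nn_integral_cong)
    fix t assume "t \<in> space time"
    then have t: "t \<in> {0..T}" by simp
    show "epowr (\<integral>\<^sup>+s. ennreal ((t - s) powr (- \<beta> * q)) *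
        epowr (\<integral>\<^sup>+\<omega>. epowr (hs_enorm (S (t - s) o\<^sub>L \<Phi> (\<omega>, s))) p \<partial>P) (q / p)
        \<partial>restrict_space lborel {0..t}) (r / q) = epowr (lpn2 P p time q (hs_weight \<Phi> t)) r"
      unfolding inner[OF t] by (simp add: lpn2_def lpn_def epowr_epowr)
  qed
  then show ?thesis by (simp add: Lambda_norm_def lpn_def)
qed

lemma mixed_factorized_le:
  assumes "strongly_measurable \<Phi>"
  shows "mixed (factorized \<Phi>) \<le> Lambda_norm P T p q r S \<beta> \<Phi>"
proof -
  have "ennreal (norm (factorized \<Phi> t z)) \<le> hs_weight \<Phi> t z" for t z
    using norm_to_hs_le[of "Sc (t - snd z) o\<^sub>L \<Phi> z"]
    by (simp add: factorized_def hs_weight_def ennreal_mult mult_left_mono)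
  then show ?thesis
    unfolding Lambda_norm_eq[OF assms] mixed_def nrm_def
    by (intro lpn_mono mx.lpn2_mono r_pos)
qed

text \<open>Infinity times the indicator of the set where f is infinite lies below f, so finiteness
  of the norm forces that indicator to have norm 0.\<close>

lemma lpn2_finite_AE:
  assumes [measurable]: "f \<in> borel_measurable (P \<Otimes>\<^sub>M time)" and fin: "lpn2 P p time q f < \<top>"
  shows "AE z in P \<Otimes>\<^sub>M time. f z < \<top>"
proof -
  let ?Z = "\<lambda>z. indicator {z \<in> space (P \<Otimes>\<^sub>M time). f z = \<top>} z :: ennreal"
  have Zm: "?Z \<in> borel_measurable (P \<Otimes>\<^sub>M time)" by measurable
  have "\<top> * lpn2 P p time q ?Z = lpn2 P p time q (\<lambda>z. \<top> * ?Z z)"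
    by (rule mx.lpn2_cmult[OF Zm, symmetric])
  also have "\<dots> \<le> lpn2 P p time q f"
    by (intro mx.lpn2_mono) (auto simp: indicator_def)
  finally have "\<top> * lpn2 P p time q ?Z < \<top>" using fin by (rule le_less_trans)
  then have "lpn2 P p time q ?Z = 0" by (simp add: ennreal_top_mult split: if_splits)
  then have "AE z in P \<Otimes>\<^sub>M time. ?Z z = 0" by (simp add: mx.lpn2_eq_0_iff[OF Zm])
  then show ?thesis
    using AE_space
  proof eventually_elim
    case (elim z)
    then show ?case by (cases "f z = \<top>") (simp_all add: less_top)
  qed
qed

text \<open>A property valid for a.e. time holds somewhere in every open interval; one such time is
  picked in each rational interval.\<close>

lemma countable_dense_of_AE_time:
  assumes "AE t in time. Q t"
  obtains C where "countable C" "C \<subseteq> {0..T}" "\<And>t. t \<in> C \<Longrightarrow> Q t"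
    "\<And>u s. 0 \<le> u \<Longrightarrow> u < s \<Longrightarrow> s \<le> T \<Longrightarrow> \<exists>t\<in>C. u < t \<and> t < s"
proof -
  have ae: "AE t in lborel. t \<in> {0..T} \<longrightarrow> Q t"
    using assms by (subst (asm) AE_restrict_space_iff) auto
  have ex: "\<exists>t. a < t \<and> t < b \<and> Q t" if "0 \<le> a" "a < b" "b \<le> T" for a b
  proof (rule ccontr)
    assume none: "\<not> ?thesis"
    from ae have "AE t in lborel. t \<notin> {a<..<b}"
      by eventually_elim (use that none in auto)
    then have "emeasure lborel {x. a < x \<and> x < b} = 0"
      by (subst (asm) AE_iff_measurable[OF _ refl]) auto
    also have "{x. a < x \<and> x < b} = {a<..<b}" by auto
    finally have "emeasure lborel {a<..<b} = 0" .
    then show False using that by simp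
  qed
  define J where "J = {(a, b). a \<in> \<rat> \<and> b \<in> \<rat> \<and> 0 \<le> a \<and> a < b \<and> b \<le> T}"
  define g where "g = (\<lambda>(a, b). SOME t. a < t \<and> t < b \<and> Q t)"
  have g: "a < g (a, b) \<and> g (a, b) < b \<and> Q (g (a, b))" if "(a, b) \<in> J" for a b
    using someI_ex[OF ex[of a b]] that by (simp add: g_def J_def)
  have "countable J"
    by (rule countable_subset[of _ "\<rat> \<times> \<rat>"]) (auto simp: J_def countable_rat)
  then have "countable (g ` J)" by simp
  moreover have "g ` J \<subseteq> {0..T}" using g by (fastforce simp: J_def)
  moreover have "Q t" if "t \<in> g ` J" for t using that g by auto
  moreover have "\<exists>t\<in>g ` J. u < t \<and> t < s" if us: "0 \<le> u" "u < s" "s \<le> T" for u s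
  proof -
    obtain a where a: "a \<in> \<rat>" "u < a" "a < s" using Rats_dense_in_real[OF us(2)] by auto
    obtain b where b: "b \<in> \<rat>" "a < b" "b < s" using Rats_dense_in_real[OF a(3)] by auto
    have "(a, b) \<in> J" using a b us by (auto simp: J_def)
    then show ?thesis using g[of a b] a b by (intro bexI[of _ "g (a, b)"]) auto
  qed
  ultimately show thesis by (rule that)
qed

text \<open>Countably many times \<open>t\<close> suffice, because \<open>S(s - u) = S(s - t) S(t - u)\<close> for \<open>u < t < s\<close>.\<close>

lemma AE_hilbert_schmidt:
  assumes \<Phi>: "strongly_measurable \<Phi>" and fin: "Lambda_norm P T p q r S \<beta> \<Phi> < \<top>"
  shows "AE z in P \<Otimes>\<^sub>M time. \<forall>s\<in>{0..T}. snd z < s \<longrightarrow> hilbert_schmidt (S (s - snd z) o\<^sub>L \<Phi> z)"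
proof -
  have "AE t in time. lpn2 P p time q (hs_weight \<Phi> t) < \<top>"
    using fin by (intro lpn_finite_AE mx.measurable_lpn2 joint_hs_weight_P \<Phi>) (simp add: Lambda_norm_eq[OF \<Phi>])
  then obtain C where C: "countable C" "C \<subseteq> {0..T}" "\<And>t. t \<in> C \<Longrightarrow> lpn2 P p time q (hs_weight \<Phi> t) < \<top>"
    "\<And>u s. 0 \<le> u \<Longrightarrow> u < s \<Longrightarrow> s \<le> T \<Longrightarrow> \<exists>t\<in>C. u < t \<and> t < s"
    by (rule countable_dense_of_AE_time) blast
  have "AE z in P \<Otimes>\<^sub>M time. hs_weight \<Phi> t z < \<top>" if "t \<in> C" for t
    using C(2,3) that by (intro lpn2_finite_AE hs_weight_slice \<Phi>) auto
  then have "AE z in P \<Otimes>\<^sub>M time. \<forall>t\<in>C. hs_weight \<Phi> t z < \<top>"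
    using C(1) by (simp add: AE_ball_countable)
  then show ?thesis
    using AE_space
  proof eventually_elim
    case (elim z)
    show ?case
    proof (intro ballI impI)
      fix s assume s: "s \<in> {0..T}" "snd z < s"
      have u: "0 \<le> snd z" using elim(2) by (auto simp: space_pair_measure)
      obtain t where t: "t \<in> C" "snd z < t" "t < s" using C(4)[OF u s(2)] s by auto
      have "hs_enorm (Sc (t - snd z) o\<^sub>L \<Phi> z) < \<top>"
      proof -
        have "hs_weight \<Phi> t z < \<top>" using elim(1) t by blast
        then have "ennreal ((t - snd z) powr (- \<beta>)) * hs_enorm (Sc (t - snd z) o\<^sub>L \<Phi> z) < \<top>"
          using t by (simp add: hs_weight_def)
        \<comment> \<open>A weight 0 could hide an infinite norm through 0 times infinity; here the
          weight is positive.\<close>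
        moreover have "ennreal ((t - snd z) powr (- \<beta>)) \<noteq> 0" using t by (simp add: ennreal_eq_0_iff)
        ultimately show ?thesis by (auto simp: ennreal_mult_less_top)
      qed
      moreover have "Sc (t - snd z) = S (t - snd z)" using t s u by (intro Sc_eq) auto
      ultimately have "hilbert_schmidt (S (t - snd z) o\<^sub>L \<Phi> z)" by (simp add: hs_enorm_less_top_iff)
      from hs_compose_left[OF this, of "S (s - t)"]
      have "hilbert_schmidt ((S (s - t) o\<^sub>L S (t - snd z)) o\<^sub>L \<Phi> z)" by (simp add: blinfun_compose_assoc)
      moreover have "S (s - t) o\<^sub>L S (t - snd z) = S (s - snd z)"
        using S_compose[of "s - t" "t - snd z"] t by simp
      ultimately show "hilbert_schmidt (S (s - snd z) o\<^sub>L \<Phi> z)" by simp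
    qed
  qed
qed

definition c\<beta> :: real where "c\<beta> = sin (pi * \<beta>) / pi"

lemma c\<beta>_pos: "0 < c\<beta>"
  using \<beta>_pos \<beta> by (auto simp: c\<beta>_def intro!: divide_pos_pos sin_gt_zero)

abbreviation "conv \<equiv> convolution_integrand S"

lemma has_integral_kernel:
  assumes u: "0 \<le> u" "u < t" and t: "t \<in> {0..T}"
  shows "has_bochner_integral time (\<lambda>s. if u < s then k t s * (s - u) powr (- \<beta>) else 0) (1 / c\<beta>)"
proof (rule has_bochner_integral_nn_integral)
  have "(\<integral>\<^sup>+s. ennreal (if u < s then k t s * (s - u) powr (- \<beta>) else 0) \<partial>time)
      = (\<integral>\<^sup>+s. ennreal (indicator {u..t} s * ((t - s) powr (\<beta> - 1) * (s - u) powr (- \<beta>))) \<partial>lborel)"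
    unfolding nn_integral_time
    by (intro nn_integral_cong) (use u t in \<open>auto simp: indicator_def k_def\<close>)
  also have "\<dots> = ennreal (1 / c\<beta>)"
    using nn_integral_Beta_kernel[OF u(2) \<beta>_pos \<beta>(2)] by (simp add: c\<beta>_def)
  finally show "(\<integral>\<^sup>+s. ennreal (if u < s then k t s * (s - u) powr (- \<beta>) else 0) \<partial>time) = ennreal (1 / c\<beta>)" .
qed (use c\<beta>_pos in \<open>auto simp: k_nonneg\<close>)

text \<open>For u < s < t the semigroup law gives S(t - s) S(s - u) = S(t - u), so the operator
  leaves the integral and only the scalar Beta kernel, of value 1 / \<open>c\<beta>\<close>,
  remains. The Hilbert--Schmidt hypothesis at every s keeps \<open>to_hs\<close> from replacing an
  operator by 0.\<close>

lemma conv_eq_integral: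
  assumes hs: "\<forall>s\<in>{0..T}. snd z < s \<longrightarrow> hilbert_schmidt (S (s - snd z) o\<^sub>L \<Phi> z)"
    and z: "z \<in> space P \<times> {0..T}" and t: "t \<in> {0..T}"
  shows "has_bochner_integral time (\<lambda>s. c\<beta> *\<^sub>R (k t s *\<^sub>R hs_compose (Sc (t - s)) (factorized \<Phi> s z))) (conv t \<Phi> z)"
proof (cases "snd z < t")
  case True
  let ?u = "snd z"
  have u: "0 \<le> ?u" using z by auto
  let ?A = "to_hs (S (t - ?u) o\<^sub>L \<Phi> z)"
  have eq: "c\<beta> *\<^sub>R (k t s *\<^sub>R hs_compose (Sc (t - s)) (factorized \<Phi> s z))
      = (c\<beta> * (if ?u < s then k t s * (s - ?u) powr (- \<beta>) else 0)) *\<^sub>R ?A" if s: "s \<in> {0..T}" for s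
  proof (cases "?u < s \<and> s < t")
    case us: True
    have "hs_compose (S (t - s)) (to_hs (S (s - ?u) o\<^sub>L \<Phi> z)) = to_hs (S (t - s) o\<^sub>L (S (s - ?u) o\<^sub>L \<Phi> z))"
      using hs s us by (intro to_hs_compose[symmetric]) auto
    also have "S (t - s) o\<^sub>L (S (s - ?u) o\<^sub>L \<Phi> z) = S (t - ?u) o\<^sub>L \<Phi> z"
      using S_compose[of "t - s" "s - ?u"] us by (simp add: blinfun_compose_assoc)
    finally have "hs_compose (S (t - s)) (to_hs (S (s - ?u) o\<^sub>L \<Phi> z)) = ?A" .
    moreover have "Sc (t - s) = S (t - s)" "Sc (s - ?u) = S (s - ?u)"
      using us s t u by (auto intro!: Sc_eq)
    ultimately show ?thesis
      using us by (simp add: factorized_def linear_scale[OF bounded_linear.linear[OF bounded_linear_hs_compose]])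
  next
    case False
    then show ?thesis
      by (auto simp: factorized_def k_def linear_0[OF bounded_linear.linear[OF bounded_linear_hs_compose]])
  qed
  have "has_bochner_integral time (\<lambda>s. (c\<beta> * (if ?u < s then k t s * (s - ?u) powr (- \<beta>) else 0)) *\<^sub>R ?A)
      ((c\<beta> * (1 / c\<beta>)) *\<^sub>R ?A)"
    by (intro has_bochner_integral_scaleR_left has_bochner_integral_mult_right has_integral_kernel u t True)
  moreover have "conv t \<Phi> z = ?A"
    using True u by (simp add: convolution_integrand_def case_prod_beta')
  ultimately show ?thesis
    using c\<beta>_pos eq by (subst has_bochner_integral_cong[OF refl, of _ _ _ "conv t \<Phi> z"]) auto
next
  case False
  have zero: "c\<beta> *\<^sub>R (k t s *\<^sub>R hs_compose (Sc (t - s)) (factorized \<Phi> s z)) = 0" for s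
    using False by (auto simp: factorized_def k_def linear_0[OF bounded_linear.linear[OF bounded_linear_hs_compose]])
  have conv: "conv t \<Phi> z = 0"
    using False by (simp add: convolution_integrand_def case_prod_beta')
  show ?thesis unfolding zero conv by (rule has_bochner_integral_zero)
qed

lemma measurable_conv:
  assumes "strongly_measurable \<Phi>" and t: "t \<in> {0..T}"
  shows "conv t \<Phi> \<in> borel_measurable pred"
proof -
  have "(\<lambda>x. (Sc (t - snd x) o\<^sub>L \<Phi> x) e) \<in> borel_measurable pred" for e
  proof -
    have [measurable]: "(\<lambda>z. \<Phi> z e) \<in> borel_measurable pred" using assms by auto
    have "(\<lambda>x. Sc (t - snd x) (\<Phi> x e)) \<in> borel_measurable pred" by measurable
    then show ?thesis by simp
  qed
  then have [measurable]: "(\<lambda>z. to_hs (Sc (t - snd z) o\<^sub>L \<Phi> z)) \<in> borel_measurable pred"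
    by (rule measurable_to_hs)
  have "(\<lambda>z. if snd z < t then to_hs (Sc (t - snd z) o\<^sub>L \<Phi> z) else 0) \<in> borel_measurable pred"
    by measurable
  moreover have "conv t \<Phi> z = (if snd z < t then to_hs (Sc (t - snd z) o\<^sub>L \<Phi> z) else 0)" if "z \<in> space pred" for z
    using that t by (auto simp: convolution_integrand_def case_prod_beta' space_pred Sc_eq)
  ultimately show ?thesis by (simp cong: measurable_cong)
qed

text \<open>The difference is for a.e. z an integral over s of \<open>factorized \<Phi>\<close>
  minus G. Minkowski's inequality takes the norm under the integral, and
  \<open>kernel_Hoelder\<close> produces \<open>mixed\<close>. With approximating G this gives
  convergence in L^{p,q} at each t.\<close>

lemma conv_step_bound:
  assumes \<Phi>: "strongly_measurable \<Phi>" "Lambda_norm P T p q r S \<beta> \<Phi> < \<top>" and st: "step G Y" and t: "t \<in> {0..T}"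
  shows "nrm (\<lambda>z. conv t \<Phi> z - c\<beta> *\<^sub>R Vop t G z)
    \<le> ennreal (c\<beta> * M * K) * mixed (\<lambda>s z. factorized \<Phi> s z - G s z)"
proof -
  let ?D = "\<lambda>s z. factorized \<Phi> s z - G s z"
  let ?f = "\<lambda>s z. ennreal (c\<beta> * M) * (ennreal (k t s) * ennreal (norm (?D s z)))"
  have jD: "joint ?D" by (rule joint_diff[OF joint_factorized[OF \<Phi>(1)] conjunct1[OF step_G[OF st]]])
  note jDP = joint_norm[OF jD]
  have jf: "(\<lambda>(s, z). ?f s z) \<in> borel_measurable (time \<Otimes>\<^sub>M (P \<Otimes>\<^sub>M time))"
  proof -
    have [measurable]: "(\<lambda>x. ennreal (norm (?D (fst x) (snd x)))) \<in> borel_measurable (time \<Otimes>\<^sub>M (P \<Otimes>\<^sub>M time))"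
      using jDP by (simp add: case_prod_beta')
    show ?thesis unfolding case_prod_beta' by measurable
  qed
  have Ds: "(\<lambda>z. ennreal (norm (?D s z))) \<in> borel_measurable (P \<Otimes>\<^sub>M time)" if "s \<in> {0..T}" for s
    by (rule joint_slice[OF jDP that])
  have "AE z in P \<Otimes>\<^sub>M time. ennreal (norm (conv t \<Phi> z - c\<beta> *\<^sub>R Vop t G z)) \<le> (\<integral>\<^sup>+s. ?f s z \<partial>time)"
    using AE_hilbert_schmidt[OF \<Phi>] AE_space
  proof eventually_elim
    case (elim z)
    then have z: "z \<in> space P \<times> {0..T}" by (simp add: space_pair_measure)
    have 1: "has_bochner_integral time (\<lambda>s. c\<beta> *\<^sub>R (k t s *\<^sub>R hs_compose (Sc (t - s)) (factorized \<Phi> s z))) (conv t \<Phi> z)"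
      by (rule conv_eq_integral[of z \<Phi> t, OF elim(1) z t])
    have 2: "has_bochner_integral time (\<lambda>s. c\<beta> *\<^sub>R (k t s *\<^sub>R hs_compose (Sc (t - s)) (G s z))) (c\<beta> *\<^sub>R Vop t G z)"
      unfolding Vop_def
      by (intro has_bochner_integral_scaleR_right has_bochner_integral_integrable step_G_integrable[OF st z t])
    let ?h = "\<lambda>s. c\<beta> *\<^sub>R (k t s *\<^sub>R hs_compose (Sc (t - s)) (factorized \<Phi> s z))
        - c\<beta> *\<^sub>R (k t s *\<^sub>R hs_compose (Sc (t - s)) (G s z))"
    have 3: "has_bochner_integral time ?h (conv t \<Phi> z - c\<beta> *\<^sub>R Vop t G z)"
      by (rule has_bochner_integral_diff[OF 1 2])
    have "ennreal (norm (conv t \<Phi> z - c\<beta> *\<^sub>R Vop t G z)) \<le> (\<integral>\<^sup>+s. ennreal (norm (?h s)) \<partial>time)"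
      using integral_norm_bound_ennreal[OF integrable.intros[OF 3]] has_bochner_integral_integral_eq[OF 3]
      by simp
    also have "\<dots> \<le> (\<integral>\<^sup>+s. ?f s z \<partial>time)"
    proof (rule nn_integral_mono)
      fix s
      have "?h s = (c\<beta> * k t s) *\<^sub>R hs_compose (Sc (t - s)) (?D s z)"
        by (simp add: linear_diff[OF bounded_linear.linear[OF bounded_linear_hs_compose]] scaleR_diff_right)
      moreover have "norm (hs_compose (Sc (t - s)) (?D s z)) \<le> M * norm (?D s z)"
        by (rule order_trans[OF norm_hs_compose]) (simp add: norm_Sc_le mult_right_mono)
      ultimately have "norm (?h s) \<le> (c\<beta> * k t s) * (M * norm (?D s z))"
        using c\<beta>_pos k_nonneg[of t s] by (simp add: abs_mult mult_left_mono)
      then have "ennreal (norm (?h s)) \<le> ennreal ((c\<beta> * k t s) * (M * norm (?D s z)))" by (rule ennreal_leI)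
      also have "\<dots> = ?f s z"
        using c\<beta>_pos M_nonneg k_nonneg[of t s] by (simp add: mult_ac flip: ennreal_mult)
      finally show "ennreal (norm (?h s)) \<le> ?f s z" .
    qed
    finally show ?case .
  qed
  then have "nrm (\<lambda>z. conv t \<Phi> z - c\<beta> *\<^sub>R Vop t G z) \<le> lpn2 P p time q (\<lambda>z. \<integral>\<^sup>+s. ?f s z \<partial>time)"
    unfolding nrm_def by (rule mx.lpn2_mono_AE)
  also have "\<dots> \<le> (\<integral>\<^sup>+s. lpn2 P p time q (?f s) \<partial>time)"
    by (rule mx.lpn2_Minkowski_integral[OF sigma_finite_time jf])
  also have "\<dots> = (\<integral>\<^sup>+s. ennreal (c\<beta> * M) * (ennreal (k t s) * nrm (?D s)) \<partial>time)"
  proof (rule nn_integral_cong)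
    fix s assume "s \<in> space time"
    then have s: "s \<in> {0..T}" by simp
    have "lpn2 P p time q (\<lambda>z. (ennreal (c\<beta> * M) * ennreal (k t s)) * ennreal (norm (?D s z)))
        = (ennreal (c\<beta> * M) * ennreal (k t s)) * nrm (?D s)"
      unfolding nrm_def by (rule mx.lpn2_cmult[OF Ds[OF s]])
    then show "lpn2 P p time q (?f s) = ennreal (c\<beta> * M) * (ennreal (k t s) * nrm (?D s))"
      by (simp only: mult.assoc)
  qed
  also have "\<dots> = ennreal (c\<beta> * M) * (\<integral>\<^sup>+s. ennreal (k t s) * nrm (?D s) \<partial>time)"
  proof (rule nn_integral_cmult)
    have [measurable]: "(\<lambda>s. nrm (?D s)) \<in> borel_measurable time" by (rule measurable_nrm[OF jD])
    show "(\<lambda>s. ennreal (k t s) * nrm (?D s)) \<in> borel_measurable time" by measurable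
  qed
  also have "\<dots> \<le> ennreal (c\<beta> * M) * (ennreal K * mixed ?D)"
    unfolding mixed_def by (intro mult_left_mono kernel_Hoelder t measurable_nrm jD) simp
  finally show ?thesis
    using c\<beta>_pos M_nonneg K_nonneg by (simp add: ennreal_mult mult_ac)
qed

lemma mixed_factorized_finite:
  assumes "strongly_measurable \<Phi>" "Lambda_norm P T p q r S \<beta> \<Phi> < \<top>"
  shows "mixed (factorized \<Phi>) < \<top>"
  using mixed_factorized_le[OF assms(1)] assms(2) by (rule le_less_trans)

lemma conv_Lpq:
  assumes "strongly_measurable \<Phi>" "Lambda_norm P T p q r S \<beta> \<Phi> < \<top>" and t: "t \<in> {0..T}"
  shows "conv t \<Phi> \<in> Lpq"
proof -
  \<comment> \<open>Against the zero step function the previous estimate bounds the norm of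
    \<open>conv t \<Phi>\<close> itself.\<close>
  obtain Y where "step (\<lambda>s z. 0) Y" using step_zero by blast
  from conv_step_bound[OF assms(1,2) this t]
  have "nrm (conv t \<Phi>) \<le> ennreal (c\<beta> * M * K) * mixed (factorized \<Phi>)"
    by (simp add: Vop_def linear_0[OF bounded_linear.linear[OF bounded_linear_hs_compose]])
  also have "\<dots> < \<top>" using mixed_factorized_finite[OF assms(1,2)] by (simp add: ennreal_mult_less_top)
  finally show ?thesis using measurable_conv[OF assms(1) t] by (simp add: Lpq_iff)
qed

section \<open>The convolution operator\<close>

lemma sup_path_scaleR: "sup_path (\<lambda>z. c *\<^sub>R X z) \<omega> = ennreal \<bar>c\<bar> * sup_path X \<omega>"
  by (simp add: sup_path_def ennreal_mult SUP_mult_left_ennreal)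

lemma lpn_sup_path_scaleR:
  assumes "X \<in> borel_measurable prog"
  shows "lpn P r (sup_path (\<lambda>z. c *\<^sub>R X z)) = ennreal \<bar>c\<bar> * lpn P r (sup_path X)"
  unfolding sup_path_scaleR using lpn_cmult[OF measurable_sup_path[OF assms] r_pos(3)] .

lemma slice_measurable:
  assumes "X \<in> borel_measurable prog" "t \<in> {0..T}"
  shows "(\<lambda>\<omega>. X (\<omega>, t)) \<in> borel_measurable P"
  using measurable_compose[OF measurable_Pair2'[of t time P] measurable_prog_P[OF assms(1)]] assms(2) by simp

text \<open>Step functions approximating \<open>factorized \<Phi>\<close> have convolutions that
  form a Cauchy sequence in the path norm, by \<open>step_bound\<close> applied to differences. The
  limit inherits continuity and the norm bound, and at each t it is identified by continuity of
  \<open>I\<close>.\<close>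

lemma exists_convolution:
  assumes \<Phi>: "strongly_measurable \<Phi>" "Lambda_norm P T p q r S \<beta> \<Phi> < \<top>"
  shows "\<exists>X\<in>Lr. (\<forall>t\<in>{0..T}. AE \<omega> in P. I (conv t \<Phi>) (\<omega>, t) = X (\<omega>, t)) \<and>
    lpn P r (sup_path X) \<le> ennreal (c\<beta> * M * K * N) * Lambda_norm P T p q r S \<beta> \<Phi>"
proof -
  define \<kappa> where "\<kappa> = c\<beta> * M * K * N"
  have \<kappa>: "0 \<le> \<kappa>" using c\<beta>_pos M_nonneg K_nonneg N_nonneg by (simp add: \<kappa>_def)
  have jt: "joint (factorized \<Phi>)" by (rule joint_factorized[OF \<Phi>(1)])
  \<comment> \<open>Summable errors, so that the distances of consecutive approximations sum up
    without passing to a subsequence.\<close>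
  define e where "e n = (1 / 2 :: real) ^ n" for n
  have e: "0 < e n" "e (Suc n) \<le> e n" for n by (auto simp: e_def)
  have e0: "e \<longlonglongrightarrow> 0" unfolding e_def by (rule LIMSEQ_power_zero) simp
  have ex: "\<exists>G Y. step G Y \<and> mixed (\<lambda>s z. factorized \<Phi> s z - G s z) < ennreal (e n)" for n
    using conjunct2[OF approx_joint[OF jt mixed_factorized_finite[OF \<Phi>], unfolded approx_def]] e(1)[of n]
    by (elim allE[of _ "e n"] impE)
  define G where "G n = (SOME G. \<exists>Y. step G Y \<and> mixed (\<lambda>s z. factorized \<Phi> s z - G s z) < ennreal (e n))" for n
  have G: "\<exists>Y. step (G n) Y \<and> mixed (\<lambda>s z. factorized \<Phi> s z - G n s z) < ennreal (e n)" for n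
    unfolding G_def by (rule someI_ex[OF ex])
  define Y where "Y n = (SOME Y. step (G n) Y)" for n
  have st: "step (G n) (Y n)" and mixed: "mixed (\<lambda>s z. factorized \<Phi> s z - G n s z) < ennreal (e n)" for n
    using G[of n] someI_ex[of "step (G n)"] unfolding Y_def by blast+
  define X where "X n z = c\<beta> *\<^sub>R Xop (Y n) z" for n z
  have Xm: "X n \<in> borel_measurable prog" for n
    unfolding X_def using step_X_measurable[OF st[of n]] by simp
  have Xc: "AE \<omega> in P. continuous_on {0..T} (\<lambda>t. X n (\<omega>, t))" for n
    using step_X_continuous[OF st[of n]] unfolding X_def
    by eventually_elim (intro continuous_intros)
  have jG: "joint (G n)" for n using step_G[OF st] ..
  have jD: "joint (\<lambda>s z. factorized \<Phi> s z - G n s z)" for n by (rule joint_diff[OF jt jG])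

  define D where "D n = sup_path (\<lambda>z. X (Suc n) z - X n z)" for n
  have Dm: "D n \<in> borel_measurable P" for n
    unfolding D_def by (intro measurable_sup_path borel_measurable_diff Xm)
  have bound: "lpn P r (sup_path (\<lambda>z. c\<beta> *\<^sub>R Xop Z z)) \<le> ennreal \<kappa> * mixed H" if "step H Z" for H Z
  proof -
    have "lpn P r (sup_path (\<lambda>z. c\<beta> *\<^sub>R Xop Z z)) = ennreal c\<beta> * lpn P r (sup_path (Xop Z))"
      using lpn_sup_path_scaleR[OF step_X_measurable[OF that], of c\<beta>] c\<beta>_pos by simp
    also have "\<dots> \<le> ennreal c\<beta> * (ennreal (M * K * N) * mixed H)"
      unfolding mixed_def by (intro mult_left_mono step_bound that) simp
    finally show ?thesis
      using c\<beta>_pos M_nonneg K_nonneg N_nonneg by (simp add: \<kappa>_def ennreal_mult mult_ac)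
  qed
  \<comment> \<open>The factor 2 arises because G n and G (Suc n) lie within e n and e (Suc n) \<le>
    e n of the same function.\<close>
  have D_le: "lpn P r (D n) \<le> ennreal (\<kappa> * (2 * e n))" for n
  proof -
    have "AE \<omega> in P. D n \<omega> = sup_path (\<lambda>z. c\<beta> *\<^sub>R Xop (\<lambda>s z. Y (Suc n) s z - Y n s z) z) \<omega>"
      using step_X_diff[OF st[of "Suc n"] st[of n]]
    proof eventually_elim
      case (elim \<omega>)
      then have "X (Suc n) (\<omega>, t) - X n (\<omega>, t) = c\<beta> *\<^sub>R Xop (\<lambda>s z. Y (Suc n) s z - Y n s z) (\<omega>, t)"
        if "t \<in> time_dense T" for t
        using subsetD[OF time_dense(2) that] by (simp add: X_def scaleR_diff_right)
      then show ?case unfolding D_def sup_path_def by (intro SUP_cong refl) simp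
    qed
    then have "lpn P r (D n) = lpn P r (sup_path (\<lambda>z. c\<beta> *\<^sub>R Xop (\<lambda>s z. Y (Suc n) s z - Y n s z) z))"
      by (rule lpn_cong_AE)
    also have "\<dots> \<le> ennreal \<kappa> * mixed (\<lambda>s z. G (Suc n) s z - G n s z)"
      by (rule bound[OF step.diff[OF st st]])
    also have "mixed (\<lambda>s z. G (Suc n) s z - G n s z)
        \<le> mixed (\<lambda>s z. factorized \<Phi> s z - G n s z) + mixed (\<lambda>s z. factorized \<Phi> s z - G (Suc n) s z)"
    proof (rule mixed_triangle[OF jD jD])
      fix s z
      show "norm (G (Suc n) s z - G n s z) \<le> norm (factorized \<Phi> s z - G n s z) + norm (factorized \<Phi> s z - G (Suc n) s z)"
        using norm_triangle_ineq4[of "factorized \<Phi> s z - G n s z" "factorized \<Phi> s z - G (Suc n) s z"] by simp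
    qed
    also have "\<dots> \<le> ennreal (e n) + ennreal (e (Suc n))"
      by (intro add_mono less_imp_le mixed)
    also have "\<dots> \<le> ennreal (2 * e n)"
      using e[of n] e(1)[of "Suc n"] by (simp flip: ennreal_plus)
    finally show ?thesis using \<kappa> e(1)[of n] by (simp add: ennreal_mult mult_left_mono)
  qed
  have "lpn P r (\<lambda>\<omega>. \<Sum>n. D n \<omega>) \<le> (\<Sum>n. lpn P r (D n))"
    by (rule lpn_suminf[OF sigma_finite_P r_pos(2) Dm])
  also have "\<dots> \<le> (\<Sum>n. ennreal (\<kappa> * (2 * e n)))"
    by (intro suminf_le D_le) auto
  also have "\<dots> < \<top>"
  proof -
    have "summable (\<lambda>n. \<kappa> * (2 * e n))"
      unfolding e_def by (intro summable_mult summable_geometric) simp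
    then show ?thesis
      using \<kappa> e(1) by (simp add: less_top[symmetric] ennreal_suminf_neq_top less_imp_le)
  qed
  finally have "lpn P r (\<lambda>\<omega>. \<Sum>n. D n \<omega>) < \<top>" .
  \<comment> \<open>A function with finite L^r norm is finite a.e.; hence the distances in supremum
    norm are summable for a.e. \<omega>.\<close>
  then have sumD: "AE \<omega> in P. (\<Sum>n. D n \<omega>) < \<top>"
    using Dm by (intro lpn_finite_AE) auto

  \<comment> \<open>Taking \<open>lim\<close> at every point keeps joint measurability; that it is a
    uniform limit in time is shown for a.e. \<omega> next.\<close>
  define Xl where "Xl z = lim (\<lambda>n. X n z)" for z
  have Xlm: "Xl \<in> borel_measurable prog"
    unfolding Xl_def by (intro borel_measurable_lim_metric Xm)
  have "AE \<omega> in P. \<forall>n. continuous_on {0..T} (\<lambda>t. X n (\<omega>, t))"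
    using Xc by (simp add: AE_all_countable)
  then have conv: "AE \<omega> in P. continuous_on {0..T} (\<lambda>t. Xl (\<omega>, t)) \<and>
      (\<forall>t\<in>{0..T}. (\<lambda>n. X n (\<omega>, t)) \<longlonglongrightarrow> Xl (\<omega>, t))"
    using sumD
  proof eventually_elim
    case (elim \<omega>)
    have fin: "D n \<omega> < \<top>" for n
      using elim(2) ennreal_suminf_lessD by blast
    define d where "d n = enn2real (D n \<omega>)" for n
    have d: "D n \<omega> = ennreal (d n)" for n using fin[of n] by (simp add: d_def)
    have sd: "summable d"
    proof (rule summable_suminf_not_top)
      show "(\<Sum>i. ennreal (d i)) \<noteq> \<top>" using elim(2) unfolding d by simp
    qed (simp add: d_def)
    have step_le: "norm (X (Suc n) (\<omega>, t) - X n (\<omega>, t)) \<le> d n" if "t \<in> {0..T}" for n t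
    proof -
      have "ennreal (norm (X (Suc n) (\<omega>, t) - X n (\<omega>, t))) \<le> D n \<omega>"
        unfolding D_def
        by (rule norm_le_sup_path[where X = "\<lambda>z. X (Suc n) z - X n z"])
          (use elim(1) that in \<open>auto intro: continuous_on_diff\<close>)
      then show ?thesis unfolding d by (simp add: d_def)
    qed
    have "uniform_limit {0..T} (\<lambda>n t. \<Sum>i<n. X (Suc i) (\<omega>, t) - X i (\<omega>, t))
        (\<lambda>t. \<Sum>i. X (Suc i) (\<omega>, t) - X i (\<omega>, t)) sequentially"
      by (rule Weierstrass_m_test[OF _ sd]) (rule step_le)
    then have *: "uniform_limit {0..T} (\<lambda>n t. X 0 (\<omega>, t) + (\<Sum>i<n. X (Suc i) (\<omega>, t) - X i (\<omega>, t)))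
        (\<lambda>t. X 0 (\<omega>, t) + (\<Sum>i. X (Suc i) (\<omega>, t) - X i (\<omega>, t))) sequentially"
      by (intro uniform_limit_add uniform_limit_const)
    have ul: "uniform_limit {0..T} (\<lambda>n t. X n (\<omega>, t))
        (\<lambda>t. X 0 (\<omega>, t) + (\<Sum>i. X (Suc i) (\<omega>, t) - X i (\<omega>, t))) sequentially"
    proof -
      have "(\<Sum>i<n. X (Suc i) (\<omega>, t) - X i (\<omega>, t)) = X n (\<omega>, t) - X 0 (\<omega>, t)" for n t
        by (rule sum_lessThan_telescope[of "\<lambda>i. X i (\<omega>, t)"])
      then show ?thesis using * by simp
    qed
    have lim: "(\<lambda>n. X n (\<omega>, t)) \<longlonglongrightarrow> Xl (\<omega>, t)"
      "Xl (\<omega>, t) = X 0 (\<omega>, t) + (\<Sum>i. X (Suc i) (\<omega>, t) - X i (\<omega>, t))" if "t \<in> {0..T}" for t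
    proof -
      note l = tendsto_uniform_limitI[OF ul that]
      then show eq: "Xl (\<omega>, t) = X 0 (\<omega>, t) + (\<Sum>i. X (Suc i) (\<omega>, t) - X i (\<omega>, t))"
        unfolding Xl_def by (rule limI)
      show "(\<lambda>n. X n (\<omega>, t)) \<longlonglongrightarrow> Xl (\<omega>, t)" unfolding eq by (rule l)
    qed
    have "continuous_on {0..T} (\<lambda>t. X 0 (\<omega>, t) + (\<Sum>i. X (Suc i) (\<omega>, t) - X i (\<omega>, t)))"
      by (rule uniform_limit_theorem[OF _ ul]) (use elim(1) in auto)
    then have "continuous_on {0..T} (\<lambda>t. Xl (\<omega>, t))"
      by (rule continuous_on_eq) (simp add: lim(2))
    then show ?case using lim(1) by blast
  qed

  \<comment> \<open>At each time of the dense set the norm of Xl is the limit of the norms of X n,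
    which the suprema of the paths dominate; Fatou's lemma does the rest.\<close>
  have norm_le: "lpn P r (sup_path Xl) \<le> ennreal \<kappa> * mixed (factorized \<Phi>)"
  proof (rule lpn_Fatou[where f = "\<lambda>n. sup_path (X n)" and B = "\<lambda>n. ennreal \<kappa> * (mixed (factorized \<Phi>) + ennreal (e n))"])
    show "sup_path (X n) \<in> borel_measurable P" for n by (rule measurable_sup_path[OF Xm])
    show "AE \<omega> in P. sup_path Xl \<omega> \<le> liminf (\<lambda>n. sup_path (X n) \<omega>)"
      using conv
    proof eventually_elim
      case (elim \<omega>)
      show ?case
        unfolding sup_path_def[of Xl]
      proof (rule SUP_least)
        fix t assume t: "t \<in> time_dense T"
        then have "(\<lambda>n. X n (\<omega>, t)) \<longlonglongrightarrow> Xl (\<omega>, t)" using elim time_dense(2)[of T] by blast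
        then have "(\<lambda>n. ennreal (norm (X n (\<omega>, t)))) \<longlonglongrightarrow> ennreal (norm (Xl (\<omega>, t)))"
          by (intro tendsto_ennrealI tendsto_norm)
        then have "ennreal (norm (Xl (\<omega>, t))) = liminf (\<lambda>n. ennreal (norm (X n (\<omega>, t))))"
          by (intro lim_imp_Liminf[symmetric]) auto
        also have "\<dots> \<le> liminf (\<lambda>n. sup_path (X n) \<omega>)"
          unfolding sup_path_def using t by (intro Liminf_mono always_eventually allI SUP_upper)
        finally show "ennreal (norm (Xl (\<omega>, t))) \<le> liminf (\<lambda>n. sup_path (X n) \<omega>)" .
      qed
    qed
    show "lpn P r (sup_path (X n)) \<le> ennreal \<kappa> * (mixed (factorized \<Phi>) + ennreal (e n))" for n
    proof -
      have "mixed (G n) \<le> mixed (factorized \<Phi>) + mixed (\<lambda>s z. factorized \<Phi> s z - G n s z)"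
      proof (rule mixed_triangle[OF jt jD])
        show "norm (G n s z) \<le> norm (factorized \<Phi> s z) + norm (factorized \<Phi> s z - G n s z)" for s z
          using norm_triangle_ineq4[of "factorized \<Phi> s z" "factorized \<Phi> s z - G n s z"] by simp
      qed
      also have "\<dots> \<le> mixed (factorized \<Phi>) + ennreal (e n)"
        by (intro add_left_mono less_imp_le mixed)
      finally have "ennreal \<kappa> * mixed (G n) \<le> ennreal \<kappa> * (mixed (factorized \<Phi>) + ennreal (e n))"
        by (rule mult_left_mono) simp
      with bound[OF st[of n]] show ?thesis unfolding X_def by (rule order_trans)
    qed
    have "(\<lambda>n. mixed (factorized \<Phi>) + ennreal (e n)) \<longlonglongrightarrow> mixed (factorized \<Phi>) + ennreal 0"
      by (intro tendsto_add tendsto_const tendsto_ennrealI e0)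
    then show "(\<lambda>n. ennreal \<kappa> * (mixed (factorized \<Phi>) + ennreal (e n))) \<longlonglongrightarrow> ennreal \<kappa> * mixed (factorized \<Phi>)"
      by (intro ennreal_tendsto_cmult) simp_all
  qed (rule r_pos)
  also have "\<dots> \<le> ennreal \<kappa> * Lambda_norm P T p q r S \<beta> \<Phi>"
    by (intro mult_left_mono mixed_factorized_le \<Phi>) simp
  finally have norm_le': "lpn P r (sup_path Xl) \<le> ennreal \<kappa> * Lambda_norm P T p q r S \<beta> \<Phi>" .
  also have "\<dots> < \<top>" using \<Phi>(2) by (simp add: ennreal_mult_less_top)
  finally have "lpn P r (sup_path Xl) < \<top>" .
  then have XlL: "Xl \<in> Lr" using Xlm conv by (auto simp: Lr_iff)

  have ident: "AE \<omega> in P. I (conv t \<Phi>) (\<omega>, t) = Xl (\<omega>, t)" if t: "t \<in> {0..T}" for t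
  proof -
    let ?J = "I (conv t \<Phi>)"
    have cL: "conv t \<Phi> \<in> Lpq" by (rule conv_Lpq[OF \<Phi> t])
    have [measurable]: "(\<lambda>\<omega>. ?J (\<omega>, t)) \<in> borel_measurable P"
      by (rule slice_measurable[OF Lr_measurable[OF I_Lr[OF cL]] t])
    have [measurable]: "(\<lambda>\<omega>. X n (\<omega>, t)) \<in> borel_measurable P" "(\<lambda>\<omega>. Xl (\<omega>, t)) \<in> borel_measurable P" for n
      using slice_measurable[OF Xm t] slice_measurable[OF Xlm t] by auto
    \<comment> \<open>At time t, X n is \<open>I\<close> of \<open>c\<beta>\<close> times
      \<open>Vop t (G n)\<close>, whose distance to \<open>conv t \<Phi>\<close> in L^{p,q} is of
      order e n. Continuity of \<open>I\<close> bounds the error, and Fatou's lemma with limiting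
      bound 0 gives equality a.e.\<close>
    have "lpn P r (\<lambda>\<omega>. ennreal (norm (Xl (\<omega>, t) - ?J (\<omega>, t)))) \<le> 0"
    proof (rule lpn_Fatou[where f = "\<lambda>n \<omega>. ennreal (norm (X n (\<omega>, t) - ?J (\<omega>, t)))"
          and B = "\<lambda>n. ennreal N * (ennreal (c\<beta> * M * K) * ennreal (e n))"])
      show "AE \<omega> in P. ennreal (norm (Xl (\<omega>, t) - ?J (\<omega>, t)))
          \<le> liminf (\<lambda>n. ennreal (norm (X n (\<omega>, t) - ?J (\<omega>, t))))"
        using conv
      proof eventually_elim
        case (elim \<omega>)
        then have "(\<lambda>n. ennreal (norm (X n (\<omega>, t) - ?J (\<omega>, t)))) \<longlonglongrightarrow> ennreal (norm (Xl (\<omega>, t) - ?J (\<omega>, t)))"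
          using t by (intro tendsto_ennrealI tendsto_norm tendsto_diff tendsto_const) auto
        then have "liminf (\<lambda>n. ennreal (norm (X n (\<omega>, t) - ?J (\<omega>, t)))) = ennreal (norm (Xl (\<omega>, t) - ?J (\<omega>, t)))"
          by (intro lim_imp_Liminf) auto
        then show ?case by simp
      qed
      show "lpn P r (\<lambda>\<omega>. ennreal (norm (X n (\<omega>, t) - ?J (\<omega>, t))))
          \<le> ennreal N * (ennreal (c\<beta> * M * K) * ennreal (e n))" for n
      proof -
        let ?V = "Vop t (G n)"
        have V: "?V \<in> Lpq" "AE \<omega> in P. I ?V (\<omega>, t) = Xop (Y n) (\<omega>, t)"
          using step_V[OF t st[of n]] by auto
        have cV: "(\<lambda>z. c\<beta> *\<^sub>R ?V z) \<in> Lpq" by (rule Lpq_scaleR[OF V(1)])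
        have dL: "(\<lambda>z. conv t \<Phi> z - c\<beta> *\<^sub>R ?V z) \<in> Lpq" by (rule Lpq_diff[OF cL cV])
        have "lpn P r (\<lambda>\<omega>. ennreal (norm (X n (\<omega>, t) - ?J (\<omega>, t))))
            \<le> lpn P r (sup_path (I (\<lambda>z. conv t \<Phi> z - c\<beta> *\<^sub>R ?V z)))"
        proof (rule lpn_mono_AE[OF _ r_pos(1)],
            use V(2) I_diff[OF cL cV] I_scaleR[OF V(1), of c\<beta>] Lr_continuous[OF I_Lr[OF dL]] in eventually_elim)
          case (elim \<omega>)
          have "norm (X n (\<omega>, t) - ?J (\<omega>, t)) = norm (I (\<lambda>z. conv t \<Phi> z - c\<beta> *\<^sub>R ?V z) (\<omega>, t))"
            using elim t by (simp add: X_def norm_minus_commute)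
          then show ?case using norm_le_sup_path[OF elim(4) t] by simp
        qed
        also have "\<dots> \<le> ennreal N * nrm (\<lambda>z. conv t \<Phi> z - c\<beta> *\<^sub>R ?V z)" by (rule I_norm[OF dL])
        also have "\<dots> \<le> ennreal N * (ennreal (c\<beta> * M * K) * ennreal (e n))"
          by (intro mult_left_mono order_trans[OF conv_step_bound[OF \<Phi> st t]]
              mult_left_mono[OF less_imp_le[OF mixed]]) simp_all
        finally show ?thesis .
      qed
      have "(\<lambda>n. ennreal N * (ennreal (c\<beta> * M * K) * ennreal (e n))) \<longlonglongrightarrow> ennreal N * (ennreal (c\<beta> * M * K) * ennreal 0)"
        by (intro ennreal_tendsto_cmult tendsto_ennrealI e0) simp_all
      then show "(\<lambda>n. ennreal N * (ennreal (c\<beta> * M * K) * ennreal (e n))) \<longlonglongrightarrow> 0" by simp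
    qed (use r_pos in \<open>measurable\<close>)
    then have "lpn P r (\<lambda>\<omega>. ennreal (norm (Xl (\<omega>, t) - ?J (\<omega>, t)))) = 0" by simp
    then have "AE \<omega> in P. ennreal (norm (Xl (\<omega>, t) - ?J (\<omega>, t))) = 0"
      by (subst (asm) lpn_eq_0_iff) measurable
    then show ?thesis by eventually_elim simp
  qed
  show ?thesis
    using XlL ident norm_le' unfolding \<kappa>_def by blast
qed

section \<open>The operator on equivalence classes: linearity, compatibility, norm and
  uniqueness\<close>

abbreviation "Lam \<equiv> reps (Lambda_space P F T p q r S \<beta> :: ('w \<times> real, 'u \<Rightarrow>\<^sub>L 'h) class_space)"
abbreviation "Lam_norm \<equiv> Lambda_norm P T p q r S \<beta> :: ('w \<times> real \<Rightarrow> 'u \<Rightarrow>\<^sub>L 'h) \<Rightarrow> ennreal"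

lemma Lam_iff: "\<Phi> \<in> Lam \<longleftrightarrow> strongly_measurable \<Phi> \<and> Lam_norm \<Phi> < \<top>"
  by (simp add: Lambda_space_def)

lemma strongly_measurable_add: "strongly_measurable \<Phi> \<Longrightarrow> strongly_measurable \<Psi> \<Longrightarrow> strongly_measurable (\<lambda>z. \<Phi> z + \<Psi> z)"
  by (auto simp: blinfun.add_left intro: borel_measurable_add)

lemma strongly_measurable_scaleR: "strongly_measurable \<Phi> \<Longrightarrow> strongly_measurable (\<lambda>z. c *\<^sub>R \<Phi> z)"
  by (auto simp: blinfun.scaleR_left intro: borel_measurable_scaleR)

lemma measurable_lpn2_hs_weight: "strongly_measurable \<Phi> \<Longrightarrow> (\<lambda>t. lpn2 P p time q (hs_weight \<Phi> t)) \<in> borel_measurable time"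
  by (rule mx.measurable_lpn2[OF joint_hs_weight_P])

lemma Lam_norm_add:
  assumes "strongly_measurable \<Phi>" "strongly_measurable \<Psi>"
  shows "Lam_norm (\<lambda>z. \<Phi> z + \<Psi> z) \<le> Lam_norm \<Phi> + Lam_norm \<Psi>"
proof -
  have hs_weight: "hs_weight (\<lambda>z. \<Phi> z + \<Psi> z) t z \<le> hs_weight \<Phi> t z + hs_weight \<Psi> t z" for t z
    by (simp add: hs_weight_def blinfun_compose_add_right hs_enorm_add mult_left_mono flip: distrib_left)
  have "Lam_norm (\<lambda>z. \<Phi> z + \<Psi> z)
      \<le> lpn time r (\<lambda>t. lpn2 P p time q (hs_weight \<Phi> t) + lpn2 P p time q (hs_weight \<Psi> t))"
    unfolding Lambda_norm_eq[OF strongly_measurable_add[OF assms]]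
  proof (rule lpn_mono[OF _ r_pos(1)])
    fix t assume "t \<in> space time"
    then have t: "t \<in> {0..T}" by simp
    have "lpn2 P p time q (hs_weight (\<lambda>z. \<Phi> z + \<Psi> z) t) \<le> lpn2 P p time q (\<lambda>z. hs_weight \<Phi> t z + hs_weight \<Psi> t z)"
      by (intro mx.lpn2_mono hs_weight)
    also have "\<dots> \<le> lpn2 P p time q (hs_weight \<Phi> t) + lpn2 P p time q (hs_weight \<Psi> t)"
      by (intro mx.lpn2_add hs_weight_slice assms t)
    finally show "lpn2 P p time q (hs_weight (\<lambda>z. \<Phi> z + \<Psi> z) t) \<le> lpn2 P p time q (hs_weight \<Phi> t) + lpn2 P p time q (hs_weight \<Psi> t)" .
  qed
  also have "\<dots> \<le> Lam_norm \<Phi> + Lam_norm \<Psi>"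
    unfolding Lambda_norm_eq[OF assms(1)] Lambda_norm_eq[OF assms(2)]
    by (intro lpn_add sigma_finite_time r_pos measurable_lpn2_hs_weight assms)
  finally show ?thesis .
qed

lemma Lam_norm_scaleR:
  assumes "strongly_measurable \<Phi>"
  shows "Lam_norm (\<lambda>z. c *\<^sub>R \<Phi> z) = ennreal \<bar>c\<bar> * Lam_norm \<Phi>"
proof -
  have hs_weight: "hs_weight (\<lambda>z. c *\<^sub>R \<Phi> z) t z = ennreal \<bar>c\<bar> * hs_weight \<Phi> t z" for t z
    by (simp add: hs_weight_def blinfun_compose_scaleR_right hs_enorm_scaleR mult_ac)
  have "Lam_norm (\<lambda>z. c *\<^sub>R \<Phi> z) = lpn time r (\<lambda>t. ennreal \<bar>c\<bar> * lpn2 P p time q (hs_weight \<Phi> t))"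
    unfolding Lambda_norm_eq[OF strongly_measurable_scaleR[OF assms]] hs_weight
    by (intro lpn_cong mx.lpn2_cmult hs_weight_slice assms) simp
  also have "\<dots> = ennreal \<bar>c\<bar> * Lam_norm \<Phi>"
    unfolding Lambda_norm_eq[OF assms] by (rule lpn_cmult[OF measurable_lpn2_hs_weight[OF assms] r_pos(3)])
  finally show ?thesis .
qed

lemma Lam_add: "\<Phi> \<in> Lam \<Longrightarrow> \<Psi> \<in> Lam \<Longrightarrow> (\<lambda>z. \<Phi> z + \<Psi> z) \<in> Lam"
  using Lam_norm_add[of \<Phi> \<Psi>] strongly_measurable_add[of \<Phi> \<Psi>] by (auto simp: Lam_iff intro: le_less_trans)

lemma Lam_scaleR: "\<Phi> \<in> Lam \<Longrightarrow> (\<lambda>z. c *\<^sub>R \<Phi> z) \<in> Lam"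
  using Lam_norm_scaleR[of \<Phi> c] strongly_measurable_scaleR[of \<Phi> c] by (auto simp: Lam_iff ennreal_mult_less_top)

lemma Lam_diff: "\<Phi> \<in> Lam \<Longrightarrow> \<Psi> \<in> Lam \<Longrightarrow> (\<lambda>z. \<Phi> z - \<Psi> z) \<in> Lam"
  using Lam_add[OF _ Lam_scaleR, of \<Phi> \<Psi> "-1"] by simp

lemma zero_Lam: "(\<lambda>z. 0) \<in> Lam"
proof -
  have "strongly_measurable (\<lambda>z. 0)" by simp
  moreover have "Lam_norm (\<lambda>z. 0) = 0"
    using Lam_norm_scaleR[of "\<lambda>z. 0" 0] by simp
  ultimately show ?thesis by (simp add: Lam_iff)
qed

text \<open>\<open>to_hs\<close> is additive only on Hilbert--Schmidt operators: a sum can be one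
  although its terms are not. The identities are therefore restricted to the points that
  \<open>AE_hilbert_schmidt\<close> provides.\<close>

lemma conv_good:
  assumes hs: "\<forall>s\<in>{0..T}. snd z < s \<longrightarrow> hilbert_schmidt (S (s - snd z) o\<^sub>L \<Phi> z)"
    and hs': "\<forall>s\<in>{0..T}. snd z < s \<longrightarrow> hilbert_schmidt (S (s - snd z) o\<^sub>L \<Psi> z)" and t: "t \<in> {0..T}"
  shows "conv t (\<lambda>z. \<Phi> z + \<Psi> z) z = conv t \<Phi> z + conv t \<Psi> z"
    and "conv t (\<lambda>z. c *\<^sub>R \<Phi> z) z = c *\<^sub>R conv t \<Phi> z"
  using assms
  by (auto simp: convolution_integrand_def case_prod_beta' blinfun_compose_add_right blinfun_compose_scaleR_right to_hs_add to_hs_scaleR)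

lemma I_conv_add:
  assumes "\<Phi> \<in> Lam" "\<Psi> \<in> Lam" and t: "t \<in> {0..T}"
  shows "AE \<omega> in P. I (conv t (\<lambda>z. \<Phi> z + \<Psi> z)) (\<omega>, t) = I (conv t \<Phi>) (\<omega>, t) + I (conv t \<Psi>) (\<omega>, t)"
proof -
  have L: "conv t \<Phi> \<in> Lpq" "conv t \<Psi> \<in> Lpq" "conv t (\<lambda>z. \<Phi> z + \<Psi> z) \<in> Lpq"
    using assms Lam_add[OF assms(1,2)] by (auto simp: Lam_iff intro!: conv_Lpq)
  have "AE z in P \<Otimes>\<^sub>M time. \<forall>s\<in>{0..T}. snd z < s \<longrightarrow> hilbert_schmidt (S (s - snd z) o\<^sub>L \<Phi> z)"
    "AE z in P \<Otimes>\<^sub>M time. \<forall>s\<in>{0..T}. snd z < s \<longrightarrow> hilbert_schmidt (S (s - snd z) o\<^sub>L \<Psi> z)"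
    using assms by (auto simp: Lam_iff intro!: AE_hilbert_schmidt)
  then have "AE z in P \<Otimes>\<^sub>M time. conv t (\<lambda>z. \<Phi> z + \<Psi> z) z = conv t \<Phi> z + conv t \<Psi> z"
    by eventually_elim (rule conv_good(1)[OF _ _ t])
  from I_cong[OF L(3) Lpq_add[OF L(1,2)] this] I_add[OF L(1,2)] show ?thesis
    by eventually_elim (use t in auto)
qed

lemma I_conv_scaleR:
  assumes "\<Phi> \<in> Lam" and t: "t \<in> {0..T}"
  shows "AE \<omega> in P. I (conv t (\<lambda>z. c *\<^sub>R \<Phi> z)) (\<omega>, t) = c *\<^sub>R I (conv t \<Phi>) (\<omega>, t)"
proof -
  have L: "conv t \<Phi> \<in> Lpq" "conv t (\<lambda>z. c *\<^sub>R \<Phi> z) \<in> Lpq"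
    using assms Lam_scaleR[OF assms(1)] by (auto simp: Lam_iff intro!: conv_Lpq)
  have "AE z in P \<Otimes>\<^sub>M time. \<forall>s\<in>{0..T}. snd z < s \<longrightarrow> hilbert_schmidt (S (s - snd z) o\<^sub>L \<Phi> z)"
    using assms by (auto simp: Lam_iff intro!: AE_hilbert_schmidt)
  then have "AE z in P \<Otimes>\<^sub>M time. conv t (\<lambda>z. c *\<^sub>R \<Phi> z) z = c *\<^sub>R conv t \<Phi> z"
    by eventually_elim (rule conv_good(2)[OF _ _ t])
  from I_cong[OF L(2) Lpq_scaleR[OF L(1)] this] I_scaleR[OF L(1), of c] show ?thesis
    by eventually_elim (use t in auto)
qed

text \<open>The null set for each t may depend on t; countably many of them are joined over a dense
  set of times, and continuity reaches the remaining times.\<close>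

lemma indistinguishable:
  assumes X: "AE \<omega> in P. continuous_on {0..T} (\<lambda>t. X (\<omega>, t))"
    and Y: "AE \<omega> in P. continuous_on {0..T} (\<lambda>t. Y (\<omega>, t) :: 'h)"
    and eq: "\<And>t. t \<in> {0..T} \<Longrightarrow> AE \<omega> in P. X (\<omega>, t) = Y (\<omega>, t)"
  shows "same_path X Y"
proof -
  have "AE \<omega> in P. \<forall>t\<in>time_dense T. X (\<omega>, t) = Y (\<omega>, t)"
    using eq time_dense(2)[of T] by (subst AE_ball_countable[OF time_dense(1)]) blast
  with X Y show ?thesis
    unfolding same_path_iff
  proof eventually_elim
    case (elim \<omega>)
    show ?case
    proof
      fix t assume "t \<in> {0..T}"
      then have "X (\<omega>, t) - Y (\<omega>, t) \<in> {0}"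
        by (rule time_dense_extend[OF continuous_on_diff[OF elim(1,2)] closed_singleton, rotated])
          (simp add: elim(3))
      then show "X (\<omega>, t) = Y (\<omega>, t)" by simp
    qed
  qed
qed

text \<open>One representative is chosen for each \<Phi>, without regard to the linear structure;
  linearity up to \<open>same_path\<close> is recovered from
  \<open>indistinguishable\<close>.\<close>

definition Cop :: "('w \<times> real \<Rightarrow> 'u \<Rightarrow>\<^sub>L 'h) \<Rightarrow> 'w \<times> real \<Rightarrow> 'h" where
  "Cop \<Phi> = (SOME X. X \<in> Lr \<and> (\<forall>t\<in>{0..T}. AE \<omega> in P. I (conv t \<Phi>) (\<omega>, t) = X (\<omega>, t)) \<and>
    lpn P r (sup_path X) \<le> ennreal (c\<beta> * M * K * N) * Lam_norm \<Phi>)"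

lemma Cop:
  assumes "\<Phi> \<in> Lam"
  shows Cop_Lr: "Cop \<Phi> \<in> Lr"
    and Cop_eq: "t \<in> {0..T} \<Longrightarrow> AE \<omega> in P. I (conv t \<Phi>) (\<omega>, t) = Cop \<Phi> (\<omega>, t)"
    and Cop_bound: "lpn P r (sup_path (Cop \<Phi>)) \<le> ennreal (c\<beta> * M * K * N) * Lam_norm \<Phi>"
proof -
  have "\<exists>X. X \<in> Lr \<and> (\<forall>t\<in>{0..T}. AE \<omega> in P. I (conv t \<Phi>) (\<omega>, t) = X (\<omega>, t)) \<and>
    lpn P r (sup_path X) \<le> ennreal (c\<beta> * M * K * N) * Lam_norm \<Phi>"
    using exists_convolution assms unfolding Lam_iff by blast
  then have X: "Cop \<Phi> \<in> Lr \<and> (\<forall>t\<in>{0..T}. AE \<omega> in P. I (conv t \<Phi>) (\<omega>, t) = Cop \<Phi> (\<omega>, t)) \<and>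
    lpn P r (sup_path (Cop \<Phi>)) \<le> ennreal (c\<beta> * M * K * N) * Lam_norm \<Phi>"
    unfolding Cop_def by (rule someI_ex)
  show "Cop \<Phi> \<in> Lr" using X by (rule conjunct1)
  show "t \<in> {0..T} \<Longrightarrow> AE \<omega> in P. I (conv t \<Phi>) (\<omega>, t) = Cop \<Phi> (\<omega>, t)"
    using conjunct1[OF conjunct2[OF X]] by (rule bspec)
  show "lpn P r (sup_path (Cop \<Phi>)) \<le> ennreal (c\<beta> * M * K * N) * Lam_norm \<Phi>"
    using conjunct2[OF conjunct2[OF X]] .
qed

lemma Cop_continuous: "\<Phi> \<in> Lam \<Longrightarrow> AE \<omega> in P. continuous_on {0..T} (\<lambda>t. Cop \<Phi> (\<omega>, t))"
  by (rule Lr_continuous[OF Cop_Lr])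

lemma Cop_add:
  assumes "\<Phi> \<in> Lam" "\<Psi> \<in> Lam"
  shows "same_path (Cop (\<lambda>z. \<Phi> z + \<Psi> z)) (\<lambda>z. Cop \<Phi> z + Cop \<Psi> z)"
proof (rule indistinguishable)
  show "AE \<omega> in P. continuous_on {0..T} (\<lambda>t. Cop (\<lambda>z. \<Phi> z + \<Psi> z) (\<omega>, t))"
    by (rule Cop_continuous[OF Lam_add[OF assms]])
  show "AE \<omega> in P. continuous_on {0..T} (\<lambda>t. Cop \<Phi> (\<omega>, t) + Cop \<Psi> (\<omega>, t))"
    using Cop_continuous[OF assms(1)] Cop_continuous[OF assms(2)]
    by eventually_elim (rule continuous_on_add)
  fix t assume t: "t \<in> {0..T}"
  from Cop_eq[OF Lam_add[OF assms] t] Cop_eq[OF assms(1) t] Cop_eq[OF assms(2) t] I_conv_add[OF assms t]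
  show "AE \<omega> in P. Cop (\<lambda>z. \<Phi> z + \<Psi> z) (\<omega>, t) = Cop \<Phi> (\<omega>, t) + Cop \<Psi> (\<omega>, t)"
    by eventually_elim simp
qed

lemma Cop_scaleR:
  assumes "\<Phi> \<in> Lam"
  shows "same_path (Cop (\<lambda>z. c *\<^sub>R \<Phi> z)) (\<lambda>z. c *\<^sub>R Cop \<Phi> z)"
proof (rule indistinguishable)
  show "AE \<omega> in P. continuous_on {0..T} (\<lambda>t. Cop (\<lambda>z. c *\<^sub>R \<Phi> z) (\<omega>, t))"
    by (rule Cop_continuous[OF Lam_scaleR[OF assms]])
  show "AE \<omega> in P. continuous_on {0..T} (\<lambda>t. c *\<^sub>R Cop \<Phi> (\<omega>, t))"
    using Cop_continuous[OF assms(1)] by eventually_elim (intro continuous_intros)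
  fix t assume t: "t \<in> {0..T}"
  from Cop_eq[OF Lam_scaleR[OF assms, of c] t] Cop_eq[OF assms t] I_conv_scaleR[OF assms t, of c]
  show "AE \<omega> in P. Cop (\<lambda>z. c *\<^sub>R \<Phi> z) (\<omega>, t) = c *\<^sub>R Cop \<Phi> (\<omega>, t)"
    by eventually_elim simp
qed

text \<open>Write \<Phi> as the difference plus \<Psi>. By the norm bound the image of the
  difference has norm 0, so it vanishes at all times for a.e. \<omega>, and additivity
  concludes.\<close>

lemma Cop_cong:
  assumes "\<Phi> \<in> Lam" "\<Psi> \<in> Lam" and "Lam_norm (\<lambda>z. \<Phi> z - \<Psi> z) = 0"
  shows "same_path (Cop \<Phi>) (Cop \<Psi>)"
proof -
  let ?\<Delta> = "\<lambda>z. \<Phi> z - \<Psi> z"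
  have \<Delta>: "?\<Delta> \<in> Lam" by (rule Lam_diff[OF assms(1,2)])
  have "lpn P r (sup_path (Cop ?\<Delta>)) = 0" using Cop_bound[OF \<Delta>] assms(3) by simp
  then have "AE \<omega> in P. sup_path (Cop ?\<Delta>) \<omega> = 0"
    by (subst (asm) lpn_eq_0_iff[OF measurable_sup_path[OF Lr_measurable[OF Cop_Lr[OF \<Delta>]]]])
  moreover have "same_path (Cop (\<lambda>z. ?\<Delta> z + \<Psi> z)) (\<lambda>z. Cop ?\<Delta> z + Cop \<Psi> z)"
    by (rule Cop_add[OF \<Delta> assms(2)])
  ultimately show ?thesis
    using Cop_continuous[OF \<Delta>] unfolding same_path_iff
  proof eventually_elim
    case (elim \<omega>)
    then have "Cop ?\<Delta> (\<omega>, t) = 0" if "t \<in> {0..T}" for t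
      using norm_le_sup_path[OF elim(3) that] by simp
    then show ?case using elim(2) by simp
  qed
qed

lemma convolution_const_eq: "convolution_const \<beta> r T M N = c\<beta> * M * K * N"
  by (simp add: convolution_const_def c\<beta>_def K_def)

lemma class_norm_Cop:
  assumes "\<Phi> \<in> Lam"
  shows "class_norm (Lr_path_space P F T r) (Cop \<Phi>)
    \<le> class_norm (Lambda_space P F T p q r S \<beta>) \<Phi> * convolution_const \<beta> r T M N"
proof -
  have \<kappa>: "0 \<le> c\<beta> * M * K * N" using c\<beta>_pos M_nonneg K_nonneg N_nonneg by simp
  have "class_norm (Lr_path_space P F T r) (Cop \<Phi>) = enn2real (lpn P r (sup_path (Cop \<Phi>)))"
    by (simp add: Lr_path_space_def path_norm_sup_path[OF Cop_continuous[OF assms]])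
  also have "\<dots> \<le> enn2real (ennreal (c\<beta> * M * K * N) * Lam_norm \<Phi>)"
    using Cop_bound[OF assms] assms by (intro enn2real_mono) (auto simp: Lam_iff ennreal_mult_less_top)
  also have "\<dots> = class_norm (Lambda_space P F T p q r S \<beta>) \<Phi> * convolution_const \<beta> r T M N"
    using \<kappa> by (simp add: Lambda_space_def enn2real_mult convolution_const_eq)
  finally show ?thesis .
qed

lemma continuous_linear_Cop:
  "continuous_linear_op (Lambda_space P F T p q r S \<beta>) (Lr_path_space P F T r) Cop"
  unfolding continuous_linear_op_def
proof (intro conjI ballI allI impI exI)
  fix \<Phi> \<Psi> :: "'w \<times> real \<Rightarrow> 'u \<Rightarrow>\<^sub>L 'h"
  assume \<Phi>: "\<Phi> \<in> Lam"
  show "Cop \<Phi> \<in> Lr" by (rule Cop_Lr[OF \<Phi>])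
  show "same_path (Cop (\<lambda>x. c *\<^sub>R \<Phi> x)) (\<lambda>y. c *\<^sub>R Cop \<Phi> y)" for c by (rule Cop_scaleR[OF \<Phi>])
  show "class_norm (Lr_path_space P F T r) (Cop \<Phi>)
      \<le> class_norm (Lambda_space P F T p q r S \<beta>) \<Phi> * convolution_const \<beta> r T M N"
    by (rule class_norm_Cop[OF \<Phi>])
  assume \<Psi>: "\<Psi> \<in> Lam"
  show "same_path (Cop (\<lambda>x. \<Phi> x + \<Psi> x)) (\<lambda>y. Cop \<Phi> y + Cop \<Psi> y)" by (rule Cop_add[OF \<Phi> \<Psi>])
  show "same_path (Cop \<Phi>) (Cop \<Psi>)" if "same (Lambda_space P F T p q r S \<beta>) \<Phi> \<Psi>"
    using Cop_cong[OF \<Phi> \<Psi>] that by (simp add: Lambda_space_def)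
qed

lemma op_norm_Cop:
  "op_norm (Lambda_space P F T p q r S \<beta>) (Lr_path_space P F T r) Cop \<le> convolution_const \<beta> r T M N"
  unfolding op_norm_def
proof (rule cSUP_least)
  show "Lam \<noteq> {}" using zero_Lam by blast
  fix \<Phi> :: "'w \<times> real \<Rightarrow> 'u \<Rightarrow>\<^sub>L 'h" assume \<Phi>: "\<Phi> \<in> Lam"
  have nn: "0 \<le> class_norm (Lambda_space P F T p q r S \<beta>) \<Phi>" by (simp add: Lambda_space_def)
  \<comment> \<open>Needed for classes of norm 0, whose ratio is 0.\<close>
  have "0 \<le> convolution_const \<beta> r T M N"
    using c\<beta>_pos M_nonneg K_nonneg N_nonneg by (simp add: convolution_const_eq)
  then show "class_norm (Lr_path_space P F T r) (Cop \<Phi>) / class_norm (Lambda_space P F T p q r S \<beta>) \<Phi>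
      \<le> convolution_const \<beta> r T M N"
    using class_norm_Cop[OF \<Phi>] nn
    by (cases "class_norm (Lambda_space P F T p q r S \<beta>) \<Phi> = 0") (simp_all add: divide_le_eq less_le mult.commute)
qed

lemma Cop_unique:
  assumes C': "continuous_linear_op (Lambda_space P F T p q r S \<beta>) (Lr_path_space P F T r) C'"
    and eq: "\<forall>\<Phi>\<in>Lam. \<forall>t\<in>{0..T}. AE \<omega> in P. I (conv t \<Phi>) (\<omega>, t) = C' \<Phi> (\<omega>, t)"
    and \<Phi>: "\<Phi> \<in> Lam"
  shows "same_path (C' \<Phi>) (Cop \<Phi>)"
proof (rule indistinguishable)
  have "C' \<Phi> \<in> Lr" using C' \<Phi> unfolding continuous_linear_op_def by blast
  then show "AE \<omega> in P. continuous_on {0..T} (\<lambda>t. C' \<Phi> (\<omega>, t))" by (rule Lr_continuous)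
  show "AE \<omega> in P. continuous_on {0..T} (\<lambda>t. Cop \<Phi> (\<omega>, t))" by (rule Cop_continuous[OF \<Phi>])
  fix t assume t: "t \<in> {0..T}"
  from bspec[OF bspec[OF eq \<Phi>] t] Cop_eq[OF \<Phi> t]
  show "AE \<omega> in P. C' \<Phi> (\<omega>, t) = Cop \<Phi> (\<omega>, t)" by eventually_elim simp
qed

end

theorem theorem3p13:
  fixes P :: "'w measure" and F :: "real \<Rightarrow> 'w measure" and T p q r \<beta> M :: real
    and I :: "('w \<times> real \<Rightarrow> ('u::{real_inner,banach,second_countable_topology},
                              'h::{real_inner,banach,second_countable_topology}) hs_op)
              \<Rightarrow> ('w \<times> real \<Rightarrow> 'h)"
    and S :: "real \<Rightarrow> 'h \<Rightarrow>\<^sub>L 'h"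
  assumes T: "T > 0"
    and filtered: "complete_filtered_prob_space P F T"
    and exponents: "p \<ge> 1" "q \<ge> 1" "r > 1" "1 / r < \<beta>" "\<beta> < 1"
    and I: "continuous_linear_op (Lpq_space P F T p q) (Lr_path_space P F T r) I"
    and I_commutes: "\<And>Q \<Psi>. \<Psi> \<in> reps (Lpq_space P F T p q) \<Longrightarrow>
      same (Lr_path_space P F T r) (\<lambda>x. blinfun_apply Q (I \<Psi> x)) (I (\<lambda>x. hs_compose Q (\<Psi> x)))"
    and S: "C0_semigroup S"
    and M: "M = (SUP t\<in>{0..T}. norm (S t))"
  shows "\<exists>C :: ('w \<times> real \<Rightarrow> 'u \<Rightarrow>\<^sub>L 'h) \<Rightarrow> ('w \<times> real \<Rightarrow> 'h).
    continuous_linear_op (Lambda_space P F T p q r S \<beta>) (Lr_path_space P F T r) C \<and>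
    (\<forall>\<Phi>\<in>reps (Lambda_space P F T p q r S \<beta>). \<forall>t\<in>{0..T}.
       AE \<omega> in P. I (convolution_integrand S t \<Phi>) (\<omega>, t) = C \<Phi> (\<omega>, t)) \<and>
    (\<forall>C'. continuous_linear_op (Lambda_space P F T p q r S \<beta>) (Lr_path_space P F T r) C' \<and>
       (\<forall>\<Phi>\<in>reps (Lambda_space P F T p q r S \<beta>). \<forall>t\<in>{0..T}.
          AE \<omega> in P. I (convolution_integrand S t \<Phi>) (\<omega>, t) = C' \<Phi> (\<omega>, t)) \<longrightarrow>
       (\<forall>\<Phi>\<in>reps (Lambda_space P F T p q r S \<beta>). same (Lr_path_space P F T r) (C' \<Phi>) (C \<Phi>))) \<and>
    op_norm (Lambda_space P F T p q r S \<beta>) (Lr_path_space P F T r) C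
      \<le> convolution_const \<beta> r T M (op_norm (Lpq_space P F T p q) (Lr_path_space P F T r) I)"
proof -
  interpret stochastic_convolution P F T r \<beta> M S p q I
    by unfold_locales (fact assms)+
  show ?thesis
    using continuous_linear_Cop Cop_eq Cop_unique op_norm_Cop unfolding N_def
    by (intro exI[of _ Cop] conjI) blast+
qed

end
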